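(* Let $T$ be an oriented non-split alternating tangle with $2k$ boundary points, $k>0$. Orient the simple smoothings appearing in the Jones polynomial $\hat J(T)$ by the gravity information of $T$, so that $\hat J(T)$ is regarded as an element of $\mathcal M_k^{(o)}$. Then $\hat J(T)\in\mathcal A_k$; that is, $\hat J(T)$ is coherently alternating.
   Context: Jones polynomial of tangles. Let $\mathcal S_k$ be the set of isotopy classes of crossingless diagrams of $k$ arcs in a disc with $2k$ fixed boundary points and no closed components (simple smoothings). For an oriented tangle diagram with $2k$ ends, $\hat J(T)\in\mathbb Z[q,q^{-1}][\mathcal S_k]$ is obtained by expanding every crossing by the skein relations: (positive crossing) $=q\,(\text{oriented smoothing})-q^2(\text{other smoothing})$; (negative crossing) $=-q^{-2}(\text{other smoothing})+q^{-1}(\text{oriented smoothing})$, where the oriented smoothing is the one compatible with the orientation of the tangle, and by deleting each closed loop at the cost of a factor $q+q^{-1}$. This is an invariant of $T$. Non-split alternating tangle: a tangle represented by a connected alternating diagram; such a diagram is used. Gravity information: put on every edge of the diagram an arrow pointing away from crossings where the edge is over and into crossings where the edge is under (consistent by alternation; for the single arc without crossings choose either direction). An end of the diagram is an in-strand if its arrow points into the disc and an out-strand if it points out of the disc; these alternate around the boundary, and smoothing a crossing preserves the arrows, so every smoothing of the diagram becomes an alternatingly oriented smoothing. Oriented smoothings. Fix $2k$ points on the boundary circle of a disc, labelled alternately "in" and "out" (a boundary pattern). A $k$-strand smoothing (possibly with loops) consists, up to planar isotopy rel boundary, of $k$ disjoint open arcs with endpoints the $2k$ points and finitely many disjoint circles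 (loops), with no crossings, oriented so that open strands run from in-points to out-points and each region of the complement lies either to the left of all strands on its boundary (positive region) or to the right of all of them (negative region). $\mathcal S_k^{(o)}$ is the set of those without loops, and $\mathcal M_k^{(o)}$ the free $\mathbb Z[q,q^{-1}]$-module on $\mathcal S_k^{(o)}$. Rotation number. For an open strand $\alpha$, number the boundary points $0,\dots,2k-1$ counterclockwise starting at the in-point of $\alpha$; if $\alpha$ ends at point $i$, then $R(\alpha)=\frac{i-k}{2k}$. For a loop, $R=1$ if counterclockwise, $-1$ if clockwise. $R(\sigma)$ is the sum over all strands and loops. A loopless smoothing is minimal (maximal) if all its strands have rotation number $\frac{1-k}{2k}$ (respectively $\frac{k-1}{2k}$). Alternating elements. A Laurent polynomial is alternating if it is of the form $\sum_{i=0}^n(-1)^{r+i}a_iq^{t+2i}$ with $r,t\in\mathbb Z$ and integers $a_i\ge0$; two alternating polynomials have the same parity if they can be written in this form with the same $r$ and $t$. $P=A_0\sigma_0+\dots+A_m\sigma_m\in\mathcal M_k^{(o)}$ ($\sigma_0$ minimal, $\sigma_m$ maximal, coefficients possibly zero) is alternating if every $A_i$ is an alternating polynomial and there are $c_1,c_2\in\frac12\mathbb Z$ such that each $A_i$ has the same parity as $(-1)^{R(\sigma_i)+c_1}q^{R(\sigma_i)+c_2}$. Closures. A unary basic diagram is a disc with one input disc and disjoint oriented arcs in the annulus between, exactly one of which has both ends on the input disc (a curl), all others joining the input disc to the external boundary, with at least one arc ending on the external boundary and with incoming and outgoing arcs alternating along both boundary components. It acts linearly $\mathcal M_k^{(o)}\to\mathcal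 M_{k-1}^{(o)}$ (when orientations match) by inserting smoothings, deleting each resulting loop with a factor $q+q^{-1}$ and collecting like terms. A partial closure of $P\in\mathcal M_k^{(o)}$ is $D_l\circ\cdots\circ D_1(P)$ with $0\le l<k$ and each $D_i$ a unary basic operator. $P$ is coherently alternating if it is alternating and every partial closure of it is alternating; $\mathcal A_k\subset\mathcal M_k^{(o)}$ is the set of coherently alternating elements and $\mathcal A=\bigcup_k\mathcal A_k$. *)

theory Defs
  imports Main "HOL.Rat" "HOL-Library.Poly_Mapping" "HOL-Combinatorics.Orbits"
begin

section \<open>Laurent polynomials\<close>

text \<open>The ring \<open>\<int>[q,q\<^sup>-\<^sup>1]\<close> is the group ring of the additive group \<open>\<int>\<close>, with the
  convolution product of \<^theory>\<open>HOL-Library.Poly_Mapping\<close>: the monomial \<open>c q\<^sup>e\<close> is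
  \<open>Poly_Mapping.single e c\<close>.\<close>

type_synonym laurent = "int \<Rightarrow>\<^sub>0 int"

definition q_pow :: "int \<Rightarrow> laurent" where
  "q_pow e = Poly_Mapping.single e 1"

definition loop_value :: laurent where
  "loop_value = q_pow 1 + q_pow (-1)"

definition neg_one_pow :: "int \<Rightarrow> int" where
  "neg_one_pow r = (if even r then 1 else -1)"

definition alternating_form :: "int \<Rightarrow> int \<Rightarrow> laurent \<Rightarrow> bool" where
  "alternating_form r t A \<longleftrightarrow>
     (\<exists>(n::nat) (a::nat \<Rightarrow> int). (\<forall>i. 0 \<le> a i) \<and>
        A = (\<Sum>i=0..n. Poly_Mapping.single (t + 2 * int i) (neg_one_pow (r + int i) * a i)))"

definition alternating_poly :: "laurent \<Rightarrow> bool" where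
  "alternating_poly A \<longleftrightarrow> (\<exists>r t. alternating_form r t A)"

definition same_parity :: "laurent \<Rightarrow> laurent \<Rightarrow> bool" where
  "same_parity A B \<longleftrightarrow> (\<exists>r t. alternating_form r t A \<and> alternating_form r t B)"


section \<open>Oriented smoothings without loops\<close>

text \<open>The \<open>2k\<close> boundary points of a disc are \<open>0, \<dots>, 2k - 1\<close>, counterclockwise.  A boundary
  pattern is given by its set \<open>I\<close> of in-points; the other points are the out-points.\<close>

definition boundary_pattern :: "nat \<Rightarrow> nat set \<Rightarrow> bool" where
  "boundary_pattern k I \<longleftrightarrow>
     I \<subseteq> {..<2 * k} \<and> (\<forall>i<2 * k. i \<in> I \<longleftrightarrow> (i + 1) mod (2 * k) \<notin> I)"

text \<open>Up to planar isotopy rel boundary, a loopless crossingless diagram of arcs is determined by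
  which endpoints it joins, and a perfect matching of the boundary points arises in this way iff
  no two of its chords interlace.  An oriented arc is the pair (in-point, out-point).  Since in-
  and out-points alternate, every region is automatically either to the left of all strands on
  its boundary or to the right of all of them.\<close>

type_synonym smoothing = "(nat \<times> nat) set"

fun interlaced :: "nat \<times> nat \<Rightarrow> nat \<times> nat \<Rightarrow> bool" where
  "interlaced (a, b) (c, d) \<longleftrightarrow>
     (min a b < c \<and> c < max a b) \<noteq> (min a b < d \<and> d < max a b)"

definition oriented_smoothings :: "nat \<Rightarrow> nat set \<Rightarrow> smoothing set" where
  "oriented_smoothings k I =
     {\<sigma>. \<sigma> \<subseteq> I \<times> ({..<2 * k} - I) \<and>
         (\<forall>a\<in>I. \<exists>!b. (a, b) \<in> \<sigma>) \<and>
         (\<forall>b\<in>{..<2 * k} - I. \<exists>!a. (a, b) \<in> \<sigma>) \<and>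
         (\<forall>\<alpha>\<in>\<sigma>. \<forall>\<beta>\<in>\<sigma>. \<alpha> \<noteq> \<beta> \<longrightarrow> \<not> interlaced \<alpha> \<beta>)}"

fun strand_rotation :: "nat \<Rightarrow> nat \<times> nat \<Rightarrow> rat" where
  "strand_rotation k (a, b) =
     (of_int ((int b - int a) mod (2 * int k)) - of_nat k) / (2 * of_nat k)"

definition rotation_number :: "nat \<Rightarrow> smoothing \<Rightarrow> rat" where
  "rotation_number k \<sigma> = (\<Sum>\<alpha>\<in>\<sigma>. strand_rotation k \<alpha>)"


section \<open>Alternating elements\<close>

definition smoothing_module :: "nat \<Rightarrow> nat set \<Rightarrow> (smoothing \<Rightarrow>\<^sub>0 laurent) set" where
  "smoothing_module k I = {P. Poly_Mapping.keys P \<subseteq> oriented_smoothings k I}"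

text \<open>The monomial \<open>(-1)\<^sup>u q\<^sup>v\<close> with \<open>u = R(\<sigma>) + c\<^sub>1\<close> and \<open>v = R(\<sigma>) + c\<^sub>2\<close> only makes sense
  when both exponents are integers, which is why \<open>u\<close> and \<open>v\<close> are quantified over \<open>int\<close>.\<close>

definition alternating_element ::
    "nat \<Rightarrow> nat set \<Rightarrow> (smoothing \<Rightarrow>\<^sub>0 laurent) \<Rightarrow> bool" where
  "alternating_element k I P \<longleftrightarrow>
     P \<in> smoothing_module k I \<and>
     (\<forall>\<sigma>\<in>oriented_smoothings k I. alternating_poly (Poly_Mapping.lookup P \<sigma>)) \<and>
     (\<exists>c\<^sub>1 c\<^sub>2 :: rat. 2 * c\<^sub>1 \<in> \<int> \<and> 2 * c\<^sub>2 \<in> \<int> \<and>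
        (\<forall>\<sigma>\<in>oriented_smoothings k I. \<exists>u v :: int.
           of_int u = rotation_number k \<sigma> + c\<^sub>1 \<and>
           of_int v = rotation_number k \<sigma> + c\<^sub>2 \<and>
           same_parity (Poly_Mapping.lookup P \<sigma>)
             (Poly_Mapping.single v (neg_one_pow u))))"


section \<open>Unary basic operators and partial closures\<close>

text \<open>In a unary basic diagram whose input disc has \<open>2k\<close> boundary points, some arc runs to the
  external boundary.  So, by planarity, the curl joins two cyclically adjacent points \<open>j\<close> and
  \<open>j + 1\<close> of the input disc, and the remaining arcs join the other input points to the
  \<open>2k - 2\<close> external points preserving the cyclic order.  Below, \<open>\<phi>\<close> maps the input end of
  each of these arcs to its external end; \<open>s\<close> is where the first of them arrives.
  The arcs inherit their orientations from the smoothing that is inserted.\<close>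

definition unary_basic :: "nat \<Rightarrow> nat \<Rightarrow> (nat \<Rightarrow> nat) \<Rightarrow> bool" where
  "unary_basic k j \<phi> \<longleftrightarrow>
     2 \<le> k \<and> j < 2 * k \<and>
     (\<exists>s. \<forall>i<2 * k - 2. \<phi> ((j + 2 + i) mod (2 * k)) = (s + i) mod (2 * k - 2))"

definition curl_ends :: "nat \<Rightarrow> nat \<Rightarrow> nat set" where
  "curl_ends k j = {j, (j + 1) mod (2 * k)}"

definition insert_pattern :: "nat \<Rightarrow> nat \<Rightarrow> (nat \<Rightarrow> nat) \<Rightarrow> nat set \<Rightarrow> nat set" where
  "insert_pattern k j \<phi> I = \<phi> ` (I - curl_ends k j)"

text \<open>The strands of \<open>\<sigma>\<close> that avoid the curl survive, and a strand from \<open>a\<close> to one end of the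
  curl continues along the curl and the strand leaving its other end.  If one strand joins both
  ends of the curl, it closes up to a loop.\<close>

definition insert_smoothing ::
    "nat \<Rightarrow> nat \<Rightarrow> (nat \<Rightarrow> nat) \<Rightarrow> smoothing \<Rightarrow> smoothing" where
  "insert_smoothing k j \<phi> \<sigma> =
     (let C = curl_ends k j in
      map_prod \<phi> \<phi> ` {(a, b). a \<notin> C \<and> b \<notin> C \<and>
        ((a, b) \<in> \<sigma> \<or> (\<exists>x\<in>C. \<exists>y\<in>C. x \<noteq> y \<and> (a, x) \<in> \<sigma> \<and> (y, b) \<in> \<sigma>))})"

definition insert_loop_factor :: "nat \<Rightarrow> nat \<Rightarrow> smoothing \<Rightarrow> laurent" where
  "insert_loop_factor k j \<sigma> =
     (if \<exists>x\<in>curl_ends k j. \<exists>y\<in>curl_ends k j. (x, y) \<in> \<sigma> then loop_value else 1)"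

definition unary_operator ::
    "nat \<Rightarrow> nat \<Rightarrow> (nat \<Rightarrow> nat) \<Rightarrow> (smoothing \<Rightarrow>\<^sub>0 laurent) \<Rightarrow> (smoothing \<Rightarrow>\<^sub>0 laurent)" where
  "unary_operator k j \<phi> P =
     (\<Sum>\<sigma>\<in>Poly_Mapping.keys P. Poly_Mapping.single (insert_smoothing k j \<phi> \<sigma>)
        (Poly_Mapping.lookup P \<sigma> * insert_loop_factor k j \<sigma>))"

text \<open>\<open>partial_closure k I P m J Q\<close>: the element \<open>Q\<close>, with \<open>2m\<close> boundary points and in-points
  \<open>J\<close>, is a partial closure of \<open>P\<close>.  As unary basic diagrams require \<open>2 \<le> m\<close>, at most
  \<open>k - 1\<close> of them can be applied.\<close>

inductive partial_closure ::
    "nat \<Rightarrow> nat set \<Rightarrow> (smoothing \<Rightarrow>\<^sub>0 laurent) \<Rightarrow>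
     nat \<Rightarrow> nat set \<Rightarrow> (smoothing \<Rightarrow>\<^sub>0 laurent) \<Rightarrow> bool"
  for k I P where
  refl: "partial_closure k I P k I P"
| step: "partial_closure k I P m J Q \<Longrightarrow> unary_basic m j \<phi> \<Longrightarrow>
         partial_closure k I P (m - 1) (insert_pattern m j \<phi> J) (unary_operator m j \<phi> Q)"

definition coherently_alternating :: "nat \<Rightarrow> nat set \<Rightarrow> (smoothing \<Rightarrow>\<^sub>0 laurent) set" where
  "coherently_alternating k I =
     {P. boundary_pattern k I \<and> P \<in> smoothing_module k I \<and> alternating_element k I P \<and>
         (\<forall>m J Q. partial_closure k I P m J Q \<longrightarrow> alternating_element m J Q)}"


section \<open>Tangle diagrams\<close>

text \<open>A diagram is stored as a combinatorial map.  \<open>Cr x 0, \<dots>, Cr x 3\<close> are the four ends at the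
  crossing \<open>x\<close> in counterclockwise order, where 0 and 2 belong to the under-strand, and 1 and 3
  to the over-strand; \<open>Bd j\<close> is the \<open>j\<close>-th boundary point of the disc, counterclockwise.
  \<open>mate\<close> exchanges the two ends of each edge.  Closed components without crossings cannot be
  represented; they never occur in a connected diagram with boundary points.\<close>

datatype 'c tend = Cr 'c nat | Bd nat

record 'c diagram =
  crossings :: "'c set"
  num_bd :: nat
  mate :: "'c tend \<Rightarrow> 'c tend"

definition ends :: "'c diagram \<Rightarrow> 'c tend set" where
  "ends D = {Cr x i | x i. x \<in> crossings D \<and> i < 4} \<union> {Bd j | j. j < num_bd D}"

definition diagram :: "'c diagram \<Rightarrow> bool" where
  "diagram D \<longleftrightarrow> finite (crossings D) \<and>
     (\<forall>e\<in>ends D. mate D e \<in> ends D \<and> mate D e \<noteq> e \<and> mate D (mate D e) = e)"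

definition mate_steps :: "'c diagram \<Rightarrow> ('c tend \<times> 'c tend) set" where
  "mate_steps D = {(e, mate D e) | e. e \<in> ends D}"

definition connected_diagram :: "'c diagram \<Rightarrow> bool" where
  "connected_diagram D \<longleftrightarrow>
     (\<forall>e\<in>ends D. \<forall>f\<in>ends D.
        (e, f) \<in> (mate_steps D \<union>
           {(Cr x i, Cr x i') | x i i'. x \<in> crossings D \<and> i < 4 \<and> i' < 4})\<^sup>*)"

text \<open>Collapse the boundary circle to one additional vertex, around which the boundary points
  appear in reversed cyclic order.  A connected diagram with boundary points can be drawn in the
  disc iff this map is a map on the sphere, i.e. iff V - E + F = 2; the faces are the cycles of
  \<open>e \<mapsto> next_end (mate e)\<close>.\<close>

fun next_end :: "'c diagram \<Rightarrow> 'c tend \<Rightarrow> 'c tend" where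
  "next_end D (Cr x i) = Cr x ((i + 1) mod 4)"
| "next_end D (Bd j) = Bd ((j + num_bd D - 1) mod num_bd D)"

definition faces :: "'c diagram \<Rightarrow> 'c tend set set" where
  "faces D = orbit (next_end D \<circ> mate D) ` ends D"

definition edges :: "'c diagram \<Rightarrow> 'c tend set set" where
  "edges D = {{e, mate D e} | e. e \<in> ends D}"

definition connected_planar_diagram :: "'c diagram \<Rightarrow> bool" where
  "connected_planar_diagram D \<longleftrightarrow>
     diagram D \<and> 0 < num_bd D \<and> connected_diagram D \<and>
     int (card (crossings D) + 1) - int (card (edges D)) + int (card (faces D)) = 2"

definition alternating_diagram :: "'c diagram \<Rightarrow> bool" where
  "alternating_diagram D \<longleftrightarrow>
     (\<forall>x i y i'. x \<in> crossings D \<and> i < 4 \<and> mate D (Cr x i) = Cr y i' \<longrightarrow> even i \<noteq> even i')"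

text \<open>In the next two predicates, \<open>ori e\<close> (resp. \<open>g e\<close>) means that the direction of the edge at
  its end \<open>e\<close> points away from the crossing or boundary point at \<open>e\<close>.\<close>

definition orientation :: "'c diagram \<Rightarrow> ('c tend \<Rightarrow> bool) \<Rightarrow> bool" where
  "orientation D ori \<longleftrightarrow>
     (\<forall>e\<in>ends D. ori (mate D e) \<longleftrightarrow> \<not> ori e) \<and>
     (\<forall>x\<in>crossings D. \<forall>i<4. ori (Cr x ((i + 2) mod 4)) \<longleftrightarrow> \<not> ori (Cr x i))"

definition gravity :: "'c diagram \<Rightarrow> ('c tend \<Rightarrow> bool) \<Rightarrow> bool" where
  "gravity D g \<longleftrightarrow>
     (\<forall>e\<in>ends D. g (mate D e) \<longleftrightarrow> \<not> g e) \<and>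
     (\<forall>x\<in>crossings D. \<forall>i<4. g (Cr x i) \<longleftrightarrow> odd i)"

definition in_points :: "'c diagram \<Rightarrow> ('c tend \<Rightarrow> bool) \<Rightarrow> nat set" where
  "in_points D g = {j. j < num_bd D \<and> g (Bd j)}"


section \<open>The Jones polynomial of a tangle diagram\<close>

text \<open>The two smoothings of a crossing join its ends as 0-1, 2-3 (for \<open>False\<close>) or as 1-2, 3-0
  (for \<open>True\<close>).\<close>

definition smoothing_partner :: "bool \<Rightarrow> nat \<Rightarrow> nat" where
  "smoothing_partner b i =
     (if b then (if odd i then (i + 1) mod 4 else (i + 3) mod 4)
      else (if even i then i + 1 else i - 1))"

text \<open>A state is the set \<open>S\<close> of crossings that are smoothed according to \<open>True\<close>.\<close>

definition state_curves :: "'c diagram \<Rightarrow> 'c set \<Rightarrow> ('c tend \<times> 'c tend) set" where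
  "state_curves D S =
     (mate_steps D \<union>
      {(Cr x i, Cr x (smoothing_partner (x \<in> S) i)) | x i. x \<in> crossings D \<and> i < 4})\<^sup>*"

definition state_smoothing :: "'c diagram \<Rightarrow> 'c set \<Rightarrow> nat set set" where
  "state_smoothing D S =
     {{i, j} | i j. i < num_bd D \<and> j < num_bd D \<and> i \<noteq> j \<and> (Bd i, Bd j) \<in> state_curves D S}"

definition state_loops :: "'c diagram \<Rightarrow> 'c set \<Rightarrow> nat" where
  "state_loops D S = card {c \<in> ends D // state_curves D S. \<forall>j. Bd j \<notin> c}"

text \<open>If the under-strand leaves through end 2, then the crossing is positive (right-handed) iff
  the over-strand leaves through end 1; if it leaves through end 0, iff the over-strand leaves
  through end 3.\<close>

definition positive_crossing :: "('c tend \<Rightarrow> bool) \<Rightarrow> 'c \<Rightarrow> bool" where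
  "positive_crossing ori x \<longleftrightarrow> (ori (Cr x 1) \<longleftrightarrow> ori (Cr x 2))"

definition is_oriented_smoothing :: "('c tend \<Rightarrow> bool) \<Rightarrow> 'c \<Rightarrow> bool \<Rightarrow> bool" where
  "is_oriented_smoothing ori x b \<longleftrightarrow>
     (\<forall>i<4. ori (Cr x (smoothing_partner b i)) \<longleftrightarrow> \<not> ori (Cr x i))"

definition skein_coeff :: "('c tend \<Rightarrow> bool) \<Rightarrow> 'c \<Rightarrow> bool \<Rightarrow> laurent" where
  "skein_coeff ori x b =
     (if positive_crossing ori x
      then (if is_oriented_smoothing ori x b then q_pow 1 else - q_pow 2)
      else (if is_oriented_smoothing ori x b then q_pow (-1) else - q_pow (-2)))"

definition jones :: "'c diagram \<Rightarrow> ('c tend \<Rightarrow> bool) \<Rightarrow> (nat set set \<Rightarrow>\<^sub>0 laurent)" where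
  "jones D ori =
     (\<Sum>S\<in>Pow (crossings D). Poly_Mapping.single (state_smoothing D S)
        ((\<Prod>x\<in>crossings D. skein_coeff ori x (x \<in> S)) * loop_value ^ state_loops D S))"

text \<open>Each strand of a simple smoothing is directed from its in-point to its out-point.\<close>

definition orient_smoothing :: "nat set \<Rightarrow> nat set set \<Rightarrow> smoothing" where
  "orient_smoothing I \<sigma> = {(a, b). {a, b} \<in> \<sigma> \<and> a \<in> I \<and> b \<notin> I}"

definition orient_element ::
    "nat set \<Rightarrow> (nat set set \<Rightarrow>\<^sub>0 laurent) \<Rightarrow> (smoothing \<Rightarrow>\<^sub>0 laurent)" where
  "orient_element I P =
     (\<Sum>\<sigma>\<in>Poly_Mapping.keys P.
        Poly_Mapping.single (orient_smoothing I \<sigma>) (Poly_Mapping.lookup P \<sigma>))"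

end

theory Submission
  imports Defs
begin

text \<open>Up to a monomial that does not depend on the state \<open>S\<close> (the set of crossings smoothed
  according to \<open>True\<close>), its coefficient is \<open>(-q)\<close> to the power \<open>card S\<close> times one factor
  \<open>q + q\<^sup>-\<^sup>1\<close> per loop.  Resolve the crossings one by one.  If a smoothing splits off a closed
  component, then the crossing is nugatory, and its two smoothings together contribute \<open>-q\<^sup>2\<close> or
  \<open>-q\<^sup>-\<^sup>2\<close> times what the other smoothing contributes.  Hence every coefficient is a sum, over loopless states only, of
  terms \<open>(-q\<^sup>2)\<^sup>j (-q)\<^sup>c\<close> with \<open>c = card S\<close>.

  It remains to see that \<open>card S - R(\<sigma>)\<close> is the same for all loopless states \<open>S\<close>, where \<open>\<sigma>\<close> is the
  smoothing given by \<open>S\<close>.  Count the boundary cycles of the positive and of the negative regions of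
  \<open>S\<close>.  Toggling a crossing changes either number by one, which bounds their sum from below by
  Euler's formula for the diagram.  On the other hand, every positive (negative) boundary cycle
  passes a strand that descends (ascends) with respect to the order of the boundary points, which
  bounds the sum from above.  The two bounds agree, so \<open>card S\<close> is the number of
  descending strands plus a constant, and so is \<open>R(\<sigma>)\<close>.  The equality also forces the strands not to
  cross.

  All this applies to partial closures as well, if these are regarded as closures of the diagram: a
  curl changes one of the two numbers of cycles by one, and leaves the other one unchanged.\<close>

section \<open>Connected components of a relation\<close>

text \<open>Gravity is what makes the regions of all states comparable: every state directs its
  curves along it, so the positive and the negative boundary cycles of any state are the cycles of
  permutations of one fixed set, the directed edges. Toggling a crossing composes such a permutation
  with a transposition, hence the change by exactly one. The comparison starts from the two extreme
  states: with all crossings smoothed according to \<open>True\<close> the positive cycles are the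
  positive faces of the diagram, and with none the negative cycles are the negative faces. On the
  way to a state with \<open>c = card S\<close>, at most \<open>card N - c\<close> positive and
  \<open>c\<close> negative cycles get lost, so Euler's formula leaves at least \<open>m + 1\<close>
  cycles, for \<open>2 * m\<close> open ends. The upper bound is \<open>m + 1\<close> too: each
  strand is counted once, and the step between the last and the first boundary point once more. The
  obstacle is that planarity is known only as an Euler number. It is never turned into a drawing;
  that strands do not cross and that in- and out-points alternate has to be extracted from tight
  counts. For closures only the inequality has to be inherited.\<close>

definition equivcl :: "('a \<times> 'a) set \<Rightarrow> ('a \<times> 'a) set" where
  "equivcl R = (R \<union> R\<inverse>)\<^sup>*"

definition component :: "('a \<times> 'a) set \<Rightarrow> 'a \<Rightarrow> 'a set" where
  "component R x = equivcl R `` {x}"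

text \<open>State curves, cycles of permutations and connectedness of the diagram are all classes of
  the closure of a relation, so one way of counting serves throughout.\<close>

definition num_comps :: "'a set \<Rightarrow> ('a \<times> 'a) set \<Rightarrow> nat" where
  "num_comps Y R = card (component R ` Y)"

definition graph_on :: "'a set \<Rightarrow> ('a \<Rightarrow> 'a) \<Rightarrow> ('a \<times> 'a) set" where
  "graph_on Y f = (\<lambda>x. (x, f x)) ` Y"

lemma ec_refl [simp]: "(x, x) \<in> equivcl R"
  by (simp add: equivcl_def)

lemma ec_sym: "(x, y) \<in> equivcl R \<Longrightarrow> (y, x) \<in> equivcl R"
proof -
  have "sym (equivcl R)"
    unfolding equivcl_def by (intro sym_rtrancl) (auto simp: sym_def)
  then show "(x, y) \<in> equivcl R \<Longrightarrow> (y, x) \<in> equivcl R" by (auto dest: symD)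
qed

lemma ec_trans [trans]:
  "(x, y) \<in> equivcl R \<Longrightarrow> (y, z) \<in> equivcl R \<Longrightarrow> (x, z) \<in> equivcl R"
  unfolding equivcl_def by (rule rtrancl_trans)

lemma ec_base: "(x, y) \<in> R \<Longrightarrow> (x, y) \<in> equivcl R"
  by (auto simp: equivcl_def)

lemma ec_base_sym: "(y, x) \<in> R \<Longrightarrow> (x, y) \<in> equivcl R"
  by (auto simp: equivcl_def)

lemma ec_invariant:
  assumes "(x, y) \<in> equivcl R" "P x"
    and "\<And>a b. (a, b) \<in> R \<Longrightarrow> P a \<longleftrightarrow> P b"
  shows "P y"
  using assms(1) unfolding equivcl_def
proof (induction rule: rtrancl_induct)
  case base then show ?case by (rule assms(2))
next
  case (step y z) then show ?case using assms(3) by auto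
qed

lemma ec_map:
  assumes "(x, y) \<in> equivcl R"
    and "\<And>a b. (a, b) \<in> R \<Longrightarrow> (f a, f b) \<in> equivcl R'"
  shows "(f x, f y) \<in> equivcl R'"
  using ec_invariant[OF assms(1), of "\<lambda>z. (f x, f z) \<in> equivcl R'"] assms(2)
  by (meson ec_refl ec_sym ec_trans)

lemma ec_least:
  assumes "R \<subseteq> equivcl R'"
  shows "equivcl R \<subseteq> equivcl R'"
  using ec_map[where f = "\<lambda>x. x" and R = R and R' = R'] assms by auto

lemma ec_mono: "R \<subseteq> R' \<Longrightarrow> equivcl R \<subseteq> equivcl R'"
  by (rule ec_least) (auto intro: ec_base)

lemma ec_eqI:
  "R \<subseteq> equivcl R' \<Longrightarrow> R' \<subseteq> equivcl R \<Longrightarrow> equivcl R = equivcl R'"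
  by (simp add: ec_least subset_antisym)

lemma ec_restrict:
  assumes "(x, y) \<in> equivcl R" "x \<in> Y" "R \<subseteq> Y \<times> Y"
  shows "y \<in> Y"
  using ec_invariant[OF assms(1), of "\<lambda>z. z \<in> Y"] assms by auto

lemma mem_component: "y \<in> component R x \<longleftrightarrow> (x, y) \<in> equivcl R"
  by (simp add: component_def)

lemma component_eq_iff: "component R x = component R y \<longleftrightarrow> (x, y) \<in> equivcl R"
proof
  assume "component R x = component R y"
  then have "y \<in> component R x" by (simp add: mem_component)
  then show "(x, y) \<in> equivcl R" by (simp add: mem_component)
next
  assume xy: "(x, y) \<in> equivcl R"
  show "component R x = component R y"
    unfolding set_eq_iff mem_component
    by (intro allI iffI) (erule ec_trans[OF ec_sym[OF xy]], erule ec_trans[OF xy])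
qed

lemma component_cong: "equivcl R = equivcl R' \<Longrightarrow> component R = component R'"
  by (simp add: component_def fun_eq_iff)

lemma num_comps_cong:
  "equivcl R = equivcl R' \<Longrightarrow> num_comps Y R = num_comps Y R'"
  unfolding num_comps_def by (drule component_cong) simp

text \<open>A path can be shortened until it uses the new link at most once, in one of the two
  directions.\<close>

lemma ec_insert:
  "equivcl (insert (u, v) R) =
     {(a, b). (a, b) \<in> equivcl R \<or>
        (a, u) \<in> equivcl R \<and> (v, b) \<in> equivcl R \<or>
        (a, v) \<in> equivcl R \<and> (u, b) \<in> equivcl R}" (is "?L = ?E")
proof (intro equalityI subrelI)
  fix a b assume ab: "(a, b) \<in> ?L"
  have "(a, a) \<in> ?E" by simp
  with ab have "(a, b) \<in> ?E"
  proof (rule ec_invariant[where P = "\<lambda>z. (a, z) \<in> ?E"])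
    fix c d assume "(c, d) \<in> insert (u, v) R"
    then consider "c = u" "d = v" | "(c, d) \<in> equivcl R" by (auto intro: ec_base)
    then show "(a, c) \<in> ?E \<longleftrightarrow> (a, d) \<in> ?E"
    proof cases
      case 1
      then show ?thesis by (auto intro: ec_sym ec_trans)
    next
      case 2
      then have "\<And>z. (z, c) \<in> equivcl R \<longleftrightarrow> (z, d) \<in> equivcl R"
        by (meson ec_sym ec_trans)
      then show ?thesis by auto
    qed
  qed
  then show "(a, b) \<in> ?E" .
next
  fix a b assume "(a, b) \<in> ?E"
  moreover have "equivcl R \<subseteq> ?L" by (intro ec_mono) auto
  moreover have "(u, v) \<in> ?L" "(v, u) \<in> ?L" by (auto intro: ec_base ec_base_sym)
  ultimately show "(a, b) \<in> ?L" by (auto intro: ec_trans)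
qed

lemma ec_insert_absorb:
  assumes "(u, v) \<in> equivcl R"
  shows "equivcl (insert (u, v) R) = equivcl R"
  using assms by (intro ec_eqI) (auto intro: ec_base)

lemma component_insert:
  assumes "(x, u) \<notin> equivcl R" "(x, v) \<notin> equivcl R"
  shows "component (insert (u, v) R) x = component R x"
  using assms unfolding set_eq_iff mem_component ec_insert by auto

lemma component_insert_merge:
  "component (insert (u, v) R) u = component R u \<union> component R v"
  unfolding set_eq_iff Un_iff mem_component ec_insert by auto

lemma num_comps_insert:
  assumes "finite Y" "u \<in> Y" "v \<in> Y" "(u, v) \<notin> equivcl R"
  shows "num_comps Y R = Suc (num_comps Y (insert (u, v) R))"
proof -
  define E where "E = equivcl R"
  let ?R = "insert (u, v) R"
  let ?C = "component R ` Y"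
  let ?Z = "?C - {component R u, component R v}"
  have "component ?R ` Y = insert (component R u \<union> component R v) ?Z"
  proof (intro equalityI subsetI)
    fix c assume "c \<in> component ?R ` Y"
    then obtain x where x: "x \<in> Y" "c = component ?R x" by auto
    show "c \<in> insert (component R u \<union> component R v) ?Z"
    proof (cases "(x, u) \<in> equivcl R \<or> (x, v) \<in> equivcl R")
      case True
      then have "(x, u) \<in> equivcl ?R" by (auto simp: ec_insert)
      then show ?thesis using x component_eq_iff component_insert_merge by (metis insertI1)
    next
      case False
      then have "c = component R x" using x component_insert by metis
      then show ?thesis using x False component_eq_iff by (metis Diff_iff image_eqI insert_iff empty_iff)
    qed
  next
    fix c assume "c \<in> insert (component R u \<union> component R v) ?Z"
    then consider "c = component ?R u" | x where "x \<in> Y" "c = component R x" "c \<noteq> component R u" "c \<noteq> component R v"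
      by (auto simp: component_insert_merge)
    then show "c \<in> component ?R ` Y"
    proof cases
      case 2
      then have "component ?R x = component R x"
        using component_insert component_eq_iff by metis
      then show ?thesis using 2 by auto
    qed (use assms in auto)
  qed
  moreover have "component R u \<union> component R v \<notin> ?Z"
  proof
    assume *: "component R u \<union> component R v \<in> ?Z"
    then obtain x where x: "component R u \<union> component R v = component R x" by auto
    have "u \<in> component R x" unfolding x[symmetric] by (simp add: mem_component)
    then have "component R x = component R u" by (simp add: mem_component component_eq_iff)
    then show False using * x by auto
  qed
  ultimately have "num_comps Y ?R = Suc (card ?Z)"
    using assms(1) by (simp add: num_comps_def)
  moreover have "component R u \<noteq> component R v" using assms(4) component_eq_iff by metis
  moreover have "card ?Z + card {component R u, component R v} = card ?C"
  proof -
    have "{component R u, component R v} \<subseteq> ?C" using assms(2,3) by auto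
    then show ?thesis
      using card_Diff_subset[of "{component R u, component R v}" ?C] card_mono[of ?C] assms(1) by simp
  qed
  ultimately show ?thesis by (simp add: num_comps_def)
qed

text \<open>\<open>\<phi>\<close> respects the relations, so it induces a map of classes, and this
  map hits every class that meets \<open>Z\<close>.\<close>

lemma num_comps_le:
  assumes "finite Y"
    and "\<And>z. z \<in> Z \<Longrightarrow> \<exists>y\<in>Y. (\<phi> y, z) \<in> equivcl R'"
    and "\<And>x y. (x, y) \<in> R \<Longrightarrow> (\<phi> x, \<phi> y) \<in> equivcl R'"
  shows "num_comps Z R' \<le> num_comps Y R"
proof -
  \<comment> \<open>The induced map is written with a chosen representative, since it has to act on
    classes.\<close>
  let ?h = "\<lambda>c. component R' (\<phi> (SOME y. y \<in> c))"
  have h: "?h (component R y) = component R' (\<phi> y)" for y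
  proof -
    have "(SOME z. z \<in> component R y) \<in> component R y"
      by (rule someI[of _ y]) (simp add: mem_component)
    then have "(y, SOME z. z \<in> component R y) \<in> equivcl R" by (simp add: mem_component)
    then have "(\<phi> y, \<phi> (SOME z. z \<in> component R y)) \<in> equivcl R'"
      by (rule ec_map) (rule assms(3))
    then show ?thesis by (simp add: component_eq_iff ec_sym)
  qed
  have "component R' ` Z \<subseteq> ?h ` component R ` Y"
  proof
    fix c assume "c \<in> component R' ` Z"
    then obtain z where z: "z \<in> Z" "c = component R' z" by auto
    with assms(2) obtain y where "y \<in> Y" "(\<phi> y, z) \<in> equivcl R'" by blast
    then have "c = ?h (component R y)" using z h component_eq_iff by metis
    with \<open>y \<in> Y\<close> show "c \<in> ?h ` component R ` Y" by blast
  qed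
  then show ?thesis unfolding num_comps_def
    by (meson assms(1) card_image_le card_mono finite_imageI le_trans)
qed


section \<open>Cycles of permutations\<close>

text \<open>Pigeonhole yields a repetition among the iterates, and injectivity cancels its common
  initial part.\<close>

lemma finite_return:
  assumes "finite Y" "inj_on f Y" "f ` Y \<subseteq> Y" "x \<in> Y"
  obtains n where "0 < n" "(f ^^ n) x = x"
proof -
  have in_Y: "(f ^^ n) x \<in> Y" for n using assms(3,4) by (induction n) auto
  have "\<not> inj (\<lambda>n. (f ^^ n) x)"
    using finite_subset[of "range (\<lambda>n. (f ^^ n) x)" Y] in_Y assms(1)
    by (meson finite_imageD image_subsetI infinite_UNIV_nat)
  then obtain i j where "i < j" "(f ^^ i) x = (f ^^ j) x"
    unfolding inj_def by (metis linorder_neqE_nat)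
  moreover have "(f ^^ i) x = (f ^^ (i + d)) x \<Longrightarrow> x = (f ^^ d) x" for d
  proof (induction i)
    case (Suc i)
    then show ?case using assms(2) in_Y by (auto dest: inj_onD)
  qed simp
  ultimately show ?thesis using that[of "j - i"] by (metis add_diff_inverse_nat less_imp_not_less zero_less_diff)
qed

lemma ec_funpow:
  assumes "\<And>y. y \<in> Y \<Longrightarrow> f y \<in> Y" "x \<in> Y"
  shows "(x, (f ^^ n) x) \<in> equivcl (graph_on Y f)"
proof (induction n)
  case (Suc n)
  have "(f ^^ n) x \<in> Y" using assms by (induction n) auto
  then have "((f ^^ n) x, f ((f ^^ n) x)) \<in> equivcl (graph_on Y f)"
    by (intro ec_base) (auto simp: graph_on_def)
  with Suc show ?case by (auto intro: ec_trans)
qed simp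

text \<open>On a finite set a step back along an injective \<open>f\<close> is a number of steps
  forward, so the symmetric closure adds nothing to the forward orbit.\<close>

lemma component_graph_on:
  assumes "finite Y" "inj_on f Y" "f ` Y \<subseteq> Y" "x \<in> Y"
  shows "component (graph_on Y f) x = orbit f x"
proof -
  have 1: "(x, y) \<in> equivcl (graph_on Y f)" if "y \<in> orbit f x" for y
    using that assms(3,4) ec_funpow[of Y f x] by (auto simp: orbit_altdef)
  obtain n where n: "0 < n" "(f ^^ n) x = x" using finite_return[OF assms] .
  have "x \<in> orbit f x" using n unfolding orbit_altdef by (metis (mono_tags, lifting) CollectI)
  have "y \<in> orbit f x" if "(x, y) \<in> equivcl (graph_on Y f)" for y
    using that \<open>x \<in> orbit f x\<close>
  proof (rule ec_invariant)
    fix a b assume "(a, b) \<in> graph_on Y f"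
    then have ab: "a \<in> Y" "b = f a" by (auto simp: graph_on_def)
    show "a \<in> orbit f x \<longleftrightarrow> b \<in> orbit f x"
    proof
      assume "b \<in> orbit f x"
      obtain m where m: "0 < m" "(f ^^ m) a = a" using finite_return[OF assms(1-3) ab(1)] .
      then have "a = (f ^^ (m - 1)) b" using ab by (metis Suc_pred' comp_apply funpow_Suc_right)
      then show "a \<in> orbit f x" using \<open>b \<in> orbit f x\<close>
        by (metis funpow_in_orbit)
    qed (use ab in \<open>auto intro: orbit.step\<close>)
  qed
  with 1 show ?thesis by (auto simp: mem_component)
qed

text \<open>Here \<open>f'\<close> is \<open>f\<close> composed with the transposition of
  \<open>u\<close> and \<open>v\<close>. Toggling a crossing, attaching a curl and restoring an edge
  in the genus count all have this form.\<close>

locale swapped_maps =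
  fixes Y :: "'a set" and f f' :: "'a \<Rightarrow> 'a" and u v :: 'a
  assumes finite_Y: "finite Y" and inj_f: "inj_on f Y" and f_Y: "f ` Y \<subseteq> Y"
    and u: "u \<in> Y" and v: "v \<in> Y" and u_neq_v: "u \<noteq> v"
    and f'_u: "f' u = f v" and f'_v: "f' v = f u"
    and f'_else: "\<And>x. x \<in> Y \<Longrightarrow> x \<noteq> u \<Longrightarrow> x \<noteq> v \<Longrightarrow> f' x = f x"
begin

text \<open>Once \<open>u\<close> and \<open>v\<close> are linked, it is irrelevant which of the two
  has which image.\<close>

lemma ec_insert_eq:
  "equivcl (insert (u, v) (graph_on Y f)) = equivcl (insert (u, v) (graph_on Y f'))"
proof (rule ec_eqI)
  have *: "(x, h' x) \<in> equivcl (insert (u, v) (graph_on Y h))"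
    if "x \<in> Y" "h' u = h v" "h' v = h u" "x \<noteq> u \<Longrightarrow> x \<noteq> v \<Longrightarrow> h' x = h x" for x and h h' :: "'a \<Rightarrow> 'a"
  proof -
    have b: "(y, h y) \<in> equivcl (insert (u, v) (graph_on Y h))" if "y \<in> Y" for y
      using that by (intro ec_base) (auto simp: graph_on_def)
    have uv: "(u, v) \<in> equivcl (insert (u, v) (graph_on Y h))" by (intro ec_base) simp
    consider "x = u" | "x = v" | "x \<noteq> u" "x \<noteq> v" by blast
    then show ?thesis
      using that b[OF u] b[OF v] b[OF \<open>x \<in> Y\<close>] uv ec_sym[OF uv]
      by cases (auto intro: ec_trans)
  qed
  show "insert (u, v) (graph_on Y f) \<subseteq> equivcl (insert (u, v) (graph_on Y f'))"
    using *[where h = f' and h' = f] f'_u f'_v f'_else by (auto simp: graph_on_def intro: ec_base)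
  show "insert (u, v) (graph_on Y f') \<subseteq> equivcl (insert (u, v) (graph_on Y f))"
    using *[where h = f and h' = f'] f'_u f'_v f'_else by (auto simp: graph_on_def intro: ec_base)
qed

lemma inj_f': "inj_on f' Y" and f'_Y: "f' ` Y \<subseteq> Y"
proof -
  show "inj_on f' Y"
    by (rule inj_onI) (metis f'_u f'_v f'_else inj_f inj_onD u v)
  show "f' ` Y \<subseteq> Y"
    using f'_u f'_v f'_else f_Y u v by (metis image_subset_iff)
qed

text \<open>Follow \<open>f\<close> from \<open>f v\<close> up to the first visit to
  \<open>u\<close> or \<open>v\<close>; until then \<open>f'\<close> takes the same steps. If the
  visit is to \<open>u\<close>, then \<open>f\<close> connects \<open>v\<close> with
  \<open>u\<close>, while for \<open>f'\<close> the path closes up at \<open>u\<close> and misses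
  \<open>v\<close>. If it is to \<open>v\<close>, the roles are exchanged.\<close>

lemma dichotomy:
  "(u, v) \<in> equivcl (graph_on Y f) \<longleftrightarrow> (u, v) \<notin> equivcl (graph_on Y f')"
proof -
  define p where "p i = (f ^^ i) (f v)" for i
  have p_Y: "p i \<in> Y" for i using f_Y v unfolding p_def by (induction i) auto
  obtain m where m: "0 < m" "(f ^^ m) v = v" using finite_return[OF finite_Y inj_f f_Y v] .
  then have "p (m - 1) = v" unfolding p_def by (metis Suc_pred' comp_apply funpow_Suc_right)
  then have ex: "\<exists>i. p i \<in> {u, v}" by blast
  define n where "n = (LEAST i. p i \<in> {u, v})"
  have n: "p n \<in> {u, v}" unfolding n_def by (rule LeastI_ex[OF ex])
  have less: "p i \<noteq> u" "p i \<noteq> v" if "i < n" for i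
    using not_less_Least[of i "\<lambda>i. p i \<in> {u, v}"] that unfolding n_def by auto
  have p': "p i = (f' ^^ i) (f v)" if "i \<le> n" for i
    using that
  proof (induction i)
    case (Suc i)
    then have "f' (p i) = f (p i)" by (intro f'_else p_Y less) simp_all
    moreover have "p (Suc i) = f (p i)" by (simp add: p_def)
    ultimately show ?case using Suc by simp
  qed (simp add: p_def)
  have p0: "p 0 = f v" and pS: "p (Suc i) = f (p i)" for i by (auto simp: p_def)
  have f_Y': "\<And>y. y \<in> Y \<Longrightarrow> f y \<in> Y" "\<And>y. y \<in> Y \<Longrightarrow> f' y \<in> Y" using f_Y f'_Y by auto
  have up: "(v, p n) \<in> equivcl (graph_on Y f)"
    using ec_funpow[of Y f v "Suc n"] f_Y' v unfolding p_def funpow_Suc_right by simp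
  have up': "(u, p n) \<in> equivcl (graph_on Y f')"
    using ec_funpow[of Y f' u "Suc n"] f_Y' u p' unfolding p_def funpow_Suc_right by (simp add: f'_u)
  \<comment> \<open>The path is a whole cycle of the map \<open>h\<close> that sends its last point
    \<open>w\<close> back to \<open>f v\<close>; this is \<open>f'\<close> for \<open>w = u\<close>
    and \<open>f\<close> for \<open>w = v\<close>.\<close>
  define P where "P = p ` {..n}"
  have step: "h w \<in> P \<and> (h x \<in> P \<longleftrightarrow> x \<in> P)"
    if "p n = w" "h w = f v" "\<And>y. y \<in> Y \<Longrightarrow> y \<noteq> u \<Longrightarrow> y \<noteq> v \<Longrightarrow> h y = f y"
      "inj_on h Y" "x \<in> Y" "w \<in> {u,v}" for h w x
  proof -
    have w: "h w \<in> P" using that(2) p0 unfolding P_def by (metis atMost_iff imageI le0)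
    moreover have hp: "h (p i) = p (Suc i)" if "i < n" for i
      using \<open>\<And>y. y \<in> Y \<Longrightarrow> y \<noteq> u \<Longrightarrow> y \<noteq> v \<Longrightarrow> h y = f y\<close> less[OF that] p_Y pS by auto
    have "h x \<in> P" if "x \<in> P"
    proof -
      from that obtain i where i: "i \<le> n" "x = p i" by (auto simp: P_def)
      show ?thesis
      proof (cases "i = n")
        case True then show ?thesis using i w \<open>p n = w\<close> by simp
      next
        case False then show ?thesis using i hp[of i] by (auto simp: P_def)
      qed
    qed
    moreover have "x \<in> P" if "h x \<in> P"
    proof -
      from that obtain i where i: "i \<le> n" "h x = p i" by (auto simp: P_def)
      show ?thesis
      proof (cases i)
        case 0
        then have "h x = h w" using i p0 \<open>h w = f v\<close> by simp
        then have "x = w" using \<open>inj_on h Y\<close> \<open>x \<in> Y\<close> u v \<open>w \<in> {u,v}\<close> by (auto dest: inj_onD)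
        then show ?thesis using \<open>p n = w\<close> by (auto simp: P_def)
      next
        case (Suc i')
        then have "h x = h (p i')" using i hp[of i'] by simp
        then have "x = p i'" using \<open>inj_on h Y\<close> \<open>x \<in> Y\<close> p_Y by (auto dest: inj_onD)
        then show ?thesis using Suc i by (auto simp: P_def)
      qed
    qed
    ultimately show ?thesis by blast
  qed
  have closed: "y \<in> P" if "p n = w" "h w = f v" "\<And>y. y \<in> Y \<Longrightarrow> y \<noteq> u \<Longrightarrow> y \<noteq> v \<Longrightarrow> h y = f y"
      "inj_on h Y" "w \<in> {u,v}" "(w, y) \<in> equivcl (graph_on Y h)" for h w y
  proof -
    have "w \<in> P" using that(1) by (auto simp: P_def)
    with that(6) show ?thesis
      by (rule ec_invariant) (use step[OF that(1-4) _ that(5)] in \<open>auto simp: graph_on_def\<close>)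
  qed
  consider "p n = u" | "p n = v" using n by blast
  then show ?thesis
  proof cases
    case 1
    have "v \<notin> P" using less(2) 1 u_neq_v unfolding P_def by (metis atMost_iff imageE le_neq_implies_less)
    then have "(u, v) \<notin> equivcl (graph_on Y f')"
      using closed[OF 1 f'_u f'_else inj_f'] by auto
    with up 1 show ?thesis by (auto intro: ec_sym)
  next
    case 2
    have "u \<notin> P" using less(1) 2 u_neq_v unfolding P_def by (metis atMost_iff imageE le_neq_implies_less)
    then have "(v, u) \<notin> equivcl (graph_on Y f)"
      using closed[OF 2 _ _ inj_f] by auto
    with up' 2 show ?thesis by (auto intro: ec_sym)
  qed
qed

text \<open>With the link from \<open>u\<close> to \<open>v\<close> added, both maps have the same
  classes. By \<open>dichotomy\<close> exactly one of them has this link already, and for the other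
  one the link merges two cycles.\<close>

lemma num_comps_swap:
  "(u, v) \<in> equivcl (graph_on Y f) \<Longrightarrow>
     num_comps Y (graph_on Y f') = Suc (num_comps Y (graph_on Y f))"
  "(u, v) \<notin> equivcl (graph_on Y f) \<Longrightarrow>
     num_comps Y (graph_on Y f) = Suc (num_comps Y (graph_on Y f'))"
proof -
  let ?N = "\<lambda>R. num_comps Y R"
  have *: "?N (insert (u, v) (graph_on Y f)) = ?N (insert (u, v) (graph_on Y f'))"
    by (rule num_comps_cong[OF ec_insert_eq])
  show "?N (graph_on Y f') = Suc (?N (graph_on Y f))" if "(u, v) \<in> equivcl (graph_on Y f)"
    using that dichotomy num_comps_insert[OF finite_Y u v] *
      num_comps_cong[OF ec_insert_absorb[OF that]] by metis
  show "?N (graph_on Y f) = Suc (?N (graph_on Y f'))" if "(u, v) \<notin> equivcl (graph_on Y f)"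
  proof -
    have uv': "(u, v) \<in> equivcl (graph_on Y f')" using that dichotomy by blast
    show ?thesis
      using num_comps_insert[OF finite_Y u v that] *
        num_comps_cong[OF ec_insert_absorb[OF uv']] by metis
  qed
qed

lemma num_comps_swap_le: "num_comps Y (graph_on Y f) \<le> Suc (num_comps Y (graph_on Y f'))"
  using num_comps_swap by (cases "(u, v) \<in> equivcl (graph_on Y f)") auto

end

text \<open>Multiplying \<open>\<nu>\<close> by the transpositions \<open>(e \<mu>(e))\<close> one after the other splits or joins a cycle
  each time, and it joins two of them whenever the transposition connects two components.\<close>

lemma genus_inequality:
  assumes fin: "finite X" and inj: "inj_on \<nu> X" and \<nu>X: "\<nu> ` X \<subseteq> X"
    and \<mu>: "\<And>e. e \<in> X \<Longrightarrow> \<mu> e \<in> X \<and> \<mu> e \<noteq> e \<and> \<mu> (\<mu> e) = e"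
    and W: "W \<subseteq> X" "\<And>e. e \<in> W \<Longrightarrow> \<mu> e \<in> W"
  shows "2 * num_comps X (graph_on X (\<lambda>e. \<nu> (if e \<in> W then \<mu> e else e)))
           + 2 * num_comps X (graph_on X \<nu>)
         \<le> card W + 4 * num_comps X (graph_on X \<nu> \<union> graph_on W \<mu>)"
  using W
proof (induction "card W" arbitrary: W rule: less_induct)
  case less
  let ?N = "num_comps X"
  \<comment> \<open>With the cycles of \<open>\<nu>\<close> as vertices, the pairs in
    \<open>W\<close> as edges and the cycles of \<open>h W\<close> as faces, the claim is V - E + F
    <= 2C; \<open>card W\<close> is twice the number of edges.\<close>
  define h where "h W e = \<nu> (if e \<in> W then \<mu> e else e)" for W e
  have h_fun: "h W = (\<lambda>e. \<nu> (if e \<in> W then \<mu> e else e))" for W by (simp add: h_def fun_eq_iff)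
  show ?case
  proof (cases "W = {}")
    case True
    then show ?thesis by (simp add: graph_on_def)
  next
    case False
    then obtain e where e: "e \<in> W" by blast
    define W' where "W' = W - {e, \<mu> e}"
    have finW: "finite W" using less.prems(1) fin finite_subset by blast
    have e': "\<mu> e \<in> W" "\<mu> e \<noteq> e" "\<mu> (\<mu> e) = e" using e less.prems \<mu> by auto
    have W: "W = insert e (insert (\<mu> e) W')" "e \<notin> W'" "\<mu> e \<notin> W'" using e e' by (auto simp: W'_def)
    have card: "card W = card W' + 2" using finW e e' by (subst W(1)) (auto simp: W'_def)
    have W'_closed: "\<mu> x \<in> W'" if "x \<in> W'" for x
      using that less.prems \<mu> e' unfolding W'_def by (metis Diff_iff insert_iff subsetD empty_iff)
    have W'X: "W' \<subseteq> X" using less.prems by (auto simp: W'_def)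
    have IH: "2 * ?N (graph_on X (h W')) + 2 * ?N (graph_on X \<nu>)
         \<le> card W' + 4 * ?N (graph_on X \<nu> \<union> graph_on W' \<mu>)"
      unfolding h_fun by (rule less.hyps) (use card W'_closed W'X in auto)
    define \<mu>' where "\<mu>' x = (if x \<in> W' then \<mu> x else x)" for x
    have \<mu>'inj: "inj_on \<mu>' X" "\<mu>' ` X \<subseteq> X"
    proof -
      have "\<mu>' (\<mu>' x) = x" if "x \<in> X" for x using that \<mu> W'_closed by (auto simp: \<mu>'_def)
      then show "inj_on \<mu>' X" by (rule inj_on_inverseI)
      show "\<mu>' ` X \<subseteq> X" using \<mu> by (auto simp: \<mu>'_def)
    qed
    have h': "h W' = \<nu> \<circ> \<mu>'" by (auto simp: h_def \<mu>'_def)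
    interpret swapped_maps X "h W'" "h W" e "\<mu> e"
    proof
      show "inj_on (h W') X" unfolding h'
        by (rule comp_inj_on[OF \<mu>'inj(1)]) (rule inj_on_subset[OF inj \<mu>'inj(2)])
      show "h W' ` X \<subseteq> X" unfolding h' using \<mu>'inj \<nu>X by auto
      show "h W e = h W' (\<mu> e)" "h W (\<mu> e) = h W' e" using W e e' by (auto simp: h_def)
      show "h W x = h W' x" if "x \<noteq> e" "x \<noteq> \<mu> e" for x using that by (auto simp: h_def W'_def)
    qed (use fin e e' less.prems in auto)
    let ?R = "graph_on X \<nu> \<union> graph_on W \<mu>" and ?R' = "graph_on X \<nu> \<union> graph_on W' \<mu>"
    have eR: "equivcl ?R = equivcl (insert (e, \<mu> e) ?R')"
    proof (rule ec_eqI)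
      show "?R \<subseteq> equivcl (insert (e, \<mu> e) ?R')"
        using e' by (auto simp: graph_on_def W(1) intro: ec_base ec_base_sym)
      show "insert (e, \<mu> e) ?R' \<subseteq> equivcl ?R"
        by (auto simp: graph_on_def W(1) intro: ec_base)
    qed
    have hR: "equivcl (graph_on X (h W')) \<subseteq> equivcl ?R'"
    proof (rule ec_least, rule subrelI)
      fix x y assume "(x, y) \<in> graph_on X (h W')"
      then have x: "x \<in> X" "y = \<nu> (\<mu>' x)" by (auto simp: graph_on_def h')
      have "(x, \<mu>' x) \<in> equivcl ?R'" by (auto simp: \<mu>'_def graph_on_def intro: ec_base)
      also have "(\<mu>' x, y) \<in> equivcl ?R'" using x \<mu>'inj by (auto simp: graph_on_def intro!: ec_base)
      finally show "(x, y) \<in> equivcl ?R'" .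
    qed
    have "2 * ?N (graph_on X (h W)) + 2 * ?N (graph_on X \<nu>) \<le> card W + 4 * ?N ?R"
    \<comment> \<open>An edge inside a component adds at most one face. An edge between two
      components merges two faces along with them; the loss of one face and one component balances
      the two new ends.\<close>
    proof (cases "(e, \<mu> e) \<in> equivcl ?R'")
      case True
      then have "?N ?R = ?N ?R'" using num_comps_cong[OF eR] num_comps_cong[OF ec_insert_absorb] by metis
      moreover have "?N (graph_on X (h W)) \<le> Suc (?N (graph_on X (h W')))"
        using num_comps_swap by (cases "(e, \<mu> e) \<in> equivcl (graph_on X (h W'))") auto
      ultimately show ?thesis using IH card by simp
    next
      case False
      then have "?N ?R' = Suc (?N ?R)" using num_comps_insert[OF finite_Y u v] num_comps_cong[OF eR] by metis
      moreover have "?N (graph_on X (h W')) = Suc (?N (graph_on X (h W)))"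
        using False hR num_comps_swap by blast
      ultimately show ?thesis using IH card by simp
    qed
    then show ?thesis unfolding h_fun .
  qed
qed

section \<open>Laurent polynomials with alternating signs\<close>

text \<open>The parity class of \<open>(-1)^u q^v\<close>, without the lowest exponent and the
  length that \<open>alternating_form\<close> asks for. This makes it visibly closed under
  addition.\<close>

definition sign_coherent :: "int \<Rightarrow> int \<Rightarrow> laurent \<Rightarrow> bool" where
  "sign_coherent u v A \<longleftrightarrow> (\<forall>w. Poly_Mapping.lookup A w \<noteq> 0 \<longrightarrow>
     even (w - v) \<and> 0 \<le> neg_one_pow (u + (w - v) div 2) * Poly_Mapping.lookup A w)"

lemma neg_one_pow_add: "neg_one_pow (a + b) = neg_one_pow a * neg_one_pow b"
  by (auto simp: neg_one_pow_def)

lemma neg_one_pow_0 [simp]: "neg_one_pow 0 = 1"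
  by (simp add: neg_one_pow_def)

lemma neg_one_pow_mult_left [simp]: "neg_one_pow a * (neg_one_pow a * x) = x"
  by (simp add: neg_one_pow_def)

lemma neg_one_pow_nonzero [simp]: "neg_one_pow a \<noteq> 0"
  by (simp add: neg_one_pow_def)

lemma sign_coherent_0 [simp]: "sign_coherent u v 0"
  by (simp add: sign_coherent_def)

lemma sign_coherent_add:
  assumes "sign_coherent u v A" "sign_coherent u v B"
  shows "sign_coherent u v (A + B)"
  unfolding sign_coherent_def
proof (intro allI impI)
  fix w
  let ?s = "neg_one_pow (u + (w - v) div 2)"
  assume "Poly_Mapping.lookup (A + B) w \<noteq> 0"
  then have "Poly_Mapping.lookup A w \<noteq> 0 \<or> Poly_Mapping.lookup B w \<noteq> 0"
    by (auto simp: lookup_add)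
  then have "even (w - v)" using assms unfolding sign_coherent_def by blast
  moreover have "0 \<le> ?s * Poly_Mapping.lookup A w" "0 \<le> ?s * Poly_Mapping.lookup B w"
    using assms unfolding sign_coherent_def by (metis mult_zero_right order_refl)+
  ultimately show "even (w - v) \<and> 0 \<le> ?s * Poly_Mapping.lookup (A + B) w"
    by (simp add: lookup_add distrib_left)
qed

lemma lookup_single_mult:
  fixes A :: laurent
  shows "Poly_Mapping.lookup (Poly_Mapping.single w c * A) x = c * Poly_Mapping.lookup A (x - w)"
proof -
  have "(\<Sum>q. Poly_Mapping.lookup A q when x = l + q) = Poly_Mapping.lookup A (x - l)" for l
  proof -
    have "(\<lambda>q. Poly_Mapping.lookup A q when x = l + q) = (\<lambda>q. Poly_Mapping.lookup A q when q = x - l)"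
      by (auto simp: fun_eq_iff when_def)
    then have "(\<Sum>q. Poly_Mapping.lookup A q when x = l + q) = (\<Sum>q. Poly_Mapping.lookup A q when q = x - l)"
      by (rule arg_cong)
    then show ?thesis by (simp only: Sum_any_when_equal)
  qed
  then show ?thesis
    by (simp add: lookup_mult lookup_single mult_when when_mult)
qed

lemma sign_coherent_mult_single:
  assumes "sign_coherent u v A"
  shows "sign_coherent (u + a) (v + b) (Poly_Mapping.single b (neg_one_pow a) * A)"
  unfolding sign_coherent_def lookup_single_mult
proof (intro allI impI)
  fix w assume "neg_one_pow a * Poly_Mapping.lookup A (w - b) \<noteq> 0"
  then have "Poly_Mapping.lookup A (w - b) \<noteq> 0" by simp
  with assms have *: "even (w - b - v)"
    "0 \<le> neg_one_pow (u + (w - b - v) div 2) * Poly_Mapping.lookup A (w - b)"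
    unfolding sign_coherent_def by blast+
  have "w - (v + b) = w - b - v" by simp
  moreover have "neg_one_pow (u + a + z) * (neg_one_pow a * y) = neg_one_pow (u + z) * y" for z y
    by (simp add: neg_one_pow_add)
  ultimately show "even (w - (v + b)) \<and>
    0 \<le> neg_one_pow (u + a + (w - (v + b)) div 2) * (neg_one_pow a * Poly_Mapping.lookup A (w - b))"
    using * by metis
qed

text \<open>Moving the reference exponent by \<open>2 * z\<close> changes the prescribed sign by
  \<open>(-1)^z\<close>, so both pairs describe one parity class. Hence factors \<open>-q^2\<close>
  and \<open>-q^-2\<close> preserve it.\<close>

lemma sign_coherent_shift:
  "sign_coherent (u + z) (v + 2 * z) A \<longleftrightarrow> sign_coherent u v A"
proof -
  have "even (w - (v + 2 * z)) \<longleftrightarrow> even (w - v)" for w by simp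
  moreover have "u + z + (w - (v + 2 * z)) div 2 = u + (w - v) div 2" for w by presburger
  ultimately show ?thesis unfolding sign_coherent_def by (simp only:)
qed

lemma sign_coherent_mult_q2:
  assumes "sign_coherent u v A"
  shows "sign_coherent u v (- q_pow 2 * A)" "sign_coherent u v (- q_pow (-2) * A)"
proof -
  have "- q_pow b = Poly_Mapping.single b (neg_one_pow z)" if "odd z" for b z
    using that by (simp add: q_pow_def neg_one_pow_def single_uminus)
  from this[of 1 2] this[of "-1" "-2"]
  show "sign_coherent u v (- q_pow 2 * A)" "sign_coherent u v (- q_pow (-2) * A)"
    using sign_coherent_mult_single[OF assms, of 1 2] sign_coherent_mult_single[OF assms, of "-1" "-2"]
      sign_coherent_shift[of u 1 v] sign_coherent_shift[of u "-1" v]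
    by (simp_all del: mult_minus_left)
qed

lemma sign_coherent_single: "sign_coherent u v (Poly_Mapping.single v (neg_one_pow u))"
  by (auto simp: sign_coherent_def lookup_single when_def split: if_splits)

text \<open>The sum starts at \<open>v - 2 * L\<close> rather than at the lowest exponent of
  \<open>A\<close>: \<open>same_parity\<close> needs a start shared with the monomial
  \<open>(-1)^u q^v\<close>.\<close>

lemma sign_coherent_imp_alternating_form:
  assumes A: "sign_coherent u v A"
    and bound: "\<And>w. Poly_Mapping.lookup A w \<noteq> 0 \<Longrightarrow> \<bar>w - v\<bar> \<le> 2 * int L"
  shows "alternating_form (u - int L) (v - 2 * int L) A"
  unfolding alternating_form_def
proof (intro exI conjI)
  let ?r = "u - int L" and ?t = "v - 2 * int L"
  define a where "a i = neg_one_pow (?r + int i) * Poly_Mapping.lookup A (?t + 2 * int i)" for i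
  show "\<forall>i. 0 \<le> a i"
  proof
    fix i
    have "u + (?t + 2 * int i - v) div 2 = ?r + int i" by simp
    then show "0 \<le> a i" using A unfolding a_def sign_coherent_def by (metis mult_zero_right order_refl)
  qed
  show "A = (\<Sum>i = 0..2 * L. Poly_Mapping.single (?t + 2 * int i) (neg_one_pow (?r + int i) * a i))"
  proof (rule poly_mapping_eqI)
    fix w
    let ?f = "\<lambda>i. (Poly_Mapping.lookup A (?t + 2 * int i) when ?t + 2 * int i = w)"
    have "Poly_Mapping.lookup (\<Sum>i = 0..2 * L. Poly_Mapping.single (?t + 2 * int i) (neg_one_pow (?r + int i) * a i)) w
        = (\<Sum>i = 0..2 * L. ?f i)"
      by (simp add: lookup_sum lookup_single a_def)
    also have "\<dots> = Poly_Mapping.lookup A w"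
    proof (cases "Poly_Mapping.lookup A w = 0")
      case True
      then show ?thesis by (intro sum.neutral trans[OF sum.neutral]) (auto simp: when_def)
    next
      case False
      then have "even (w - v)" "\<bar>w - v\<bar> \<le> 2 * int L" using A bound unfolding sign_coherent_def by auto
      define j where "j = nat ((w - ?t) div 2)"
      have j: "?t + 2 * int j = w" "j \<le> 2 * L"
        using \<open>even (w - v)\<close> \<open>\<bar>w - v\<bar> \<le> 2 * int L\<close> unfolding j_def by (auto elim!: evenE)
      have "(\<Sum>i = 0..2 * L. ?f i) = (\<Sum>i\<in>{j}. ?f i)"
        using j by (intro sum.mono_neutral_right) (auto simp: when_def)
      then show ?thesis using j by simp
    qed
    finally show "Poly_Mapping.lookup A w = Poly_Mapping.lookup
      (\<Sum>i = 0..2 * L. Poly_Mapping.single (?t + 2 * int i) (neg_one_pow (?r + int i) * a i)) w" by simp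
  qed
qed

lemma sign_coherent_imp_same_parity:
  assumes "sign_coherent u v A"
  shows "alternating_poly A \<and> same_parity A (Poly_Mapping.single v (neg_one_pow u))"
proof -
  have "bdd_above ((\<lambda>w. \<bar>w - v\<bar>) ` Poly_Mapping.keys A)" by (intro bdd_above_finite) simp
  then obtain L where L: "\<And>w. w \<in> Poly_Mapping.keys A \<Longrightarrow> \<bar>w - v\<bar> \<le> L"
    unfolding bdd_above_def by auto
  have "alternating_form (u - int (nat \<bar>L\<bar>)) (v - 2 * int (nat \<bar>L\<bar>)) A"
    using L by (intro sign_coherent_imp_alternating_form[OF assms]) (force simp: in_keys_iff)
  moreover have "alternating_form (u - int (nat \<bar>L\<bar>)) (v - 2 * int (nat \<bar>L\<bar>))
      (Poly_Mapping.single v (neg_one_pow u))"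
    by (intro sign_coherent_imp_alternating_form[OF sign_coherent_single])
      (auto simp: lookup_single when_def split: if_splits)
  ultimately show ?thesis unfolding alternating_poly_def same_parity_def by blast
qed

lemma q_pow_mult: "q_pow a * q_pow b = q_pow (a + b)"
  by (simp add: q_pow_def mult_single)

lemma q_pow_0: "q_pow 0 = 1"
  by (simp add: q_pow_def)

lemma minus_q_pow_eq: "- q_pow v = Poly_Mapping.single v (-1)"
  by (simp add: q_pow_def single_uminus)

lemma minus_q_power: "(- q_pow 1) ^ n = Poly_Mapping.single (int n) (neg_one_pow (int n))"
  by (induction n) (simp_all add: minus_q_pow_eq mult_single neg_one_pow_def)


section \<open>Linear extension\<close>

text \<open>The common form of \<open>unary_operator\<close> and \<open>orient_element\<close>. Both
  sum over the keys of their argument, which hides additivity because terms may cancel; it is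
  recovered by summing over a larger fixed set of keys.\<close>

definition linear_extension ::
    "('a \<Rightarrow> 'b) \<Rightarrow> ('a \<Rightarrow> laurent) \<Rightarrow> ('a \<Rightarrow>\<^sub>0 laurent) \<Rightarrow> ('b \<Rightarrow>\<^sub>0 laurent)" where
  "linear_extension h c P =
     (\<Sum>\<sigma>\<in>Poly_Mapping.keys P. Poly_Mapping.single (h \<sigma>) (Poly_Mapping.lookup P \<sigma> * c \<sigma>))"

lemma linear_extension_superset:
  assumes "finite K" "Poly_Mapping.keys P \<subseteq> K"
  shows "linear_extension h c P =
     (\<Sum>\<sigma>\<in>K. Poly_Mapping.single (h \<sigma>) (Poly_Mapping.lookup P \<sigma> * c \<sigma>))"
  unfolding linear_extension_def using assms
  by (intro sum.mono_neutral_left) (auto simp: in_keys_iff)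

lemma linear_extension_add:
  "linear_extension h c (P + Q) = linear_extension h c P + linear_extension h c Q"
proof -
  let ?K = "Poly_Mapping.keys P \<union> Poly_Mapping.keys Q"
  have "Poly_Mapping.keys (P + Q) \<subseteq> ?K" by (rule Poly_Mapping.keys_add)
  then show ?thesis
    by (simp add: linear_extension_superset[of ?K] lookup_add distrib_right single_add sum.distrib)
qed

lemma linear_extension_single:
  "linear_extension h c (Poly_Mapping.single s w) = Poly_Mapping.single (h s) (w * c s)"
  by (simp add: linear_extension_def)

lemma linear_extension_sum_single:
  assumes "finite A"
  shows "linear_extension h c (\<Sum>i\<in>A. Poly_Mapping.single (s i) (w i)) =
     (\<Sum>i\<in>A. Poly_Mapping.single (h (s i)) (w i * c (s i)))"
  using assms
proof (induction A rule: finite_induct)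
  case empty then show ?case by (simp add: linear_extension_def)
next
  case (insert x F)
  then show ?case by (simp add: linear_extension_add linear_extension_single)
qed

lemma unary_operator_linear_extension:
  "unary_operator k j \<phi> = linear_extension (insert_smoothing k j \<phi>) (insert_loop_factor k j)"
  by (simp add: fun_eq_iff unary_operator_def linear_extension_def)

lemma orient_element_linear_extension:
  "orient_element I = linear_extension (orient_smoothing I) (\<lambda>_. 1)"
  by (simp add: fun_eq_iff orient_element_def linear_extension_def)

lemma lookup_sum_single:
  assumes "finite A"
  shows "Poly_Mapping.lookup (\<Sum>i\<in>A. Poly_Mapping.single (s i) (w i)) \<sigma> = (\<Sum>i\<in>{i \<in> A. s i = \<sigma>}. w i)"
  using assms by (simp add: lookup_sum lookup_single when_def sum.If_cases Int_def)

section \<open>Curves of the states of a closed diagram\<close>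

lemma mem_ends [simp]:
  "Cr x i \<in> ends D \<longleftrightarrow> x \<in> crossings D \<and> i < 4"
  "Bd j \<in> ends D \<longleftrightarrow> j < num_bd D"
  by (auto simp: ends_def)

lemma finite_ends: "diagram D \<Longrightarrow> finite (ends D)"
proof -
  assume "diagram D"
  then have "finite (crossings D)" by (simp add: diagram_def)
  moreover have "ends D = (\<lambda>(x, i). Cr x i) ` (crossings D \<times> {..<4}) \<union> Bd ` {..<num_bd D}"
    by (auto simp: ends_def)
  ultimately show ?thesis by simp
qed

lemma smoothing_partner_less: "i < 4 \<Longrightarrow> smoothing_partner b i < 4"
  unfolding smoothing_partner_def by (cases b; simp; presburger)

lemma smoothing_partner_involution: "i < 4 \<Longrightarrow> smoothing_partner b (smoothing_partner b i) = i"
proof -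
  assume "i < 4"
  then consider "i = 0" | "i = 1" | "i = 2" | "i = 3" by linarith
  then show ?thesis by cases (auto simp: smoothing_partner_def)
qed

lemma even_smoothing_partner: "i < 4 \<Longrightarrow> even (smoothing_partner b i) \<longleftrightarrow> odd i"
proof -
  assume "i < 4"
  then consider "i = 0" | "i = 1" | "i = 2" | "i = 3" by linarith
  then show ?thesis by cases (auto simp: smoothing_partner_def)
qed

lemma smoothing_partner_simps:
  "smoothing_partner False 0 = 1" "smoothing_partner False (Suc 0) = 0"
  "smoothing_partner False 2 = 3" "smoothing_partner False 3 = 2"
  "smoothing_partner True 0 = 3" "smoothing_partner True (Suc 0) = 2"
  "smoothing_partner True 2 = 1" "smoothing_partner True 3 = 0"
  by (simp_all add: smoothing_partner_def)

locale gravity_diagram =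
  fixes D :: "'c diagram" and g :: "'c tend \<Rightarrow> bool"
  assumes diagram: "diagram D" and gravity: "gravity D g" and connected: "connected_diagram D"
begin

abbreviation "X \<equiv> ends D"
abbreviation "mt \<equiv> mate D"
abbreviation "N \<equiv> crossings D"

lemma finite_X: "finite X" using finite_ends[OF diagram] .

lemma finite_N: "finite N"
  using diagram by (simp add: diagram_def)

lemma mate: "e \<in> X \<Longrightarrow> mt e \<in> X" "e \<in> X \<Longrightarrow> mt (mt e) = e" "e \<in> X \<Longrightarrow> g (mt e) \<longleftrightarrow> \<not> g e"
  "e \<in> X \<Longrightarrow> mt e \<noteq> e"
  using diagram gravity by (auto simp: diagram_def gravity_def)

lemma g_Cr: "x \<in> N \<Longrightarrow> i < 4 \<Longrightarrow> g (Cr x i) \<longleftrightarrow> odd i"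
  using gravity by (auto simp: gravity_def)

end

text \<open>A partial closure of a diagram keeps its ends, and joins those boundary points that are no
  longer on the boundary in pairs, as given by \<open>curl\<close>; \<open>\<beta>\<close> lists the remaining ones.\<close>

locale closed_diagram = gravity_diagram D g
  for D :: "'c diagram" and g :: "'c tend \<Rightarrow> bool" +
  fixes curl :: "'c tend \<Rightarrow> 'c tend" and m :: nat and \<beta> :: "nat \<Rightarrow> 'c tend"
  assumes m_pos: "0 < m"
    and \<beta>_inj: "inj_on \<beta> {..<2 * m}"
    and \<beta>_Bd: "\<And>i. i < 2 * m \<Longrightarrow> \<beta> i \<in> ends D \<inter> range Bd"
    and \<beta>_Suc: "\<And>i. i < 2 * m \<Longrightarrow> g (\<beta> ((i + 1) mod (2 * m))) \<longleftrightarrow> \<not> g (\<beta> i)"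
    and curl: "\<And>e. e \<in> ends D \<inter> range Bd - \<beta> ` {..<2 * m} \<Longrightarrow>
      curl e \<in> ends D \<inter> range Bd - \<beta> ` {..<2 * m} \<and> curl (curl e) = e \<and> (g (curl e) \<longleftrightarrow> \<not> g e)"
begin

abbreviation "Open \<equiv> \<beta> ` {..<2 * m}"

definition partner :: "'c set \<Rightarrow> 'c tend \<Rightarrow> 'c tend" where
  "partner S e = (case e of Cr x i \<Rightarrow> Cr x (smoothing_partner (x \<in> S) i) | Bd j \<Rightarrow> curl e)"

text \<open>The crossings of \<open>U\<close> are deleted: their ends keep their edges but are not
  joined to each other.\<close>

definition cut :: "'c set \<Rightarrow> 'c set \<Rightarrow> ('c tend \<times> 'c tend) set" where
  "cut U S = graph_on X mt \<union> graph_on (X - Open - {Cr x i | x i. x \<in> U}) (partner S)"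

definition curves :: "'c set \<Rightarrow> ('c tend \<times> 'c tend) set" where
  "curves S = graph_on X mt \<union> graph_on (X - Open) (partner S)"

abbreviation conn :: "'c set \<Rightarrow> ('c tend \<times> 'c tend) set" where
  "conn S \<equiv> equivcl (curves S)"

text \<open>The crossings of \<open>U\<close> are left unresolved, as vertices that connect their
  four ends. So \<open>joined N\<close> has the connectivity of the closed diagram itself and
  \<open>joined {}\<close> that of a state.\<close>

definition joined :: "'c set \<Rightarrow> 'c set \<Rightarrow> ('c tend \<times> 'c tend) set" where
  "joined U S = cut U S \<union> {(Cr x i, Cr x j) | x i j. x \<in> U \<and> i < 4 \<and> j < 4}"

definition strands :: "'c set \<Rightarrow> smoothing" where
  "strands S = {(a, b). a < 2 * m \<and> b < 2 * m \<and> g (\<beta> a) \<and> \<not> g (\<beta> b) \<and>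
     (\<beta> a, \<beta> b) \<in> conn S}"

definition loops :: "'c set \<Rightarrow> 'c tend set set" where
  "loops S = {c \<in> component (curves S) ` X. c \<inter> Open = {}}"

lemma Open_X: "e \<in> Open \<Longrightarrow> e \<in> X"
  using \<beta>_Bd by auto

lemma Cr_not_Open: "Cr x i \<notin> Open"
  using \<beta>_Bd by fastforce

lemma \<beta>_eq_iff: "i < 2 * m \<Longrightarrow> j < 2 * m \<Longrightarrow> \<beta> i = \<beta> j \<longleftrightarrow> i = j"
  using \<beta>_inj by (auto simp: inj_on_eq_iff)

lemma partner_Cr [simp]: "partner S (Cr x i) = Cr x (smoothing_partner (x \<in> S) i)"
  by (simp add: partner_def)

lemma partner:
  assumes "e \<in> X - Open"
  shows "partner S e \<in> X - Open" "partner S (partner S e) = e" "g (partner S e) \<longleftrightarrow> \<not> g e"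
proof -
  have "partner S e \<in> X - Open \<and> partner S (partner S e) = e \<and> (g (partner S e) \<longleftrightarrow> \<not> g e)"
  proof (cases e)
    case (Cr x i)
    then have "x \<in> N" "i < 4" using assms by auto
    then show ?thesis
      using Cr Cr_not_Open
      by (simp add: smoothing_partner_less smoothing_partner_involution g_Cr even_smoothing_partner)
  next
    case (Bd j)
    then have "e \<in> ends D \<inter> range Bd - Open" using assms by auto
    from curl[OF this] Bd show ?thesis by (auto simp: partner_def)
  qed
  then show "partner S e \<in> X - Open" "partner S (partner S e) = e" "g (partner S e) \<longleftrightarrow> \<not> g e"
    by auto
qed

lemma ec_mate: "e \<in> X \<Longrightarrow> graph_on X mt \<subseteq> R \<Longrightarrow> (e, mt e) \<in> equivcl R"
  by (rule ec_base) (auto simp: graph_on_def)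

lemma ec_partner: "e \<in> X - Open \<Longrightarrow> (e, partner S e) \<in> conn S"
  by (rule ec_base) (auto simp: graph_on_def curves_def)

lemma curves_restrict: "curves S \<subseteq> X \<times> X"
  unfolding curves_def graph_on_def using mate partner by auto

lemma ec_curves_X: "(a, b) \<in> conn S \<Longrightarrow> a \<in> X \<Longrightarrow> b \<in> X"
  by (erule ec_restrict[OF _ _ curves_restrict])

lemma step_inj: "inj_on (partner S \<circ> mt) {e \<in> X. mt e \<notin> Open}"
proof (rule inj_on_inverseI[where g = "mt \<circ> partner S"])
  fix e assume "e \<in> {e \<in> X. mt e \<notin> Open}"
  then show "(mt \<circ> partner S) ((partner S \<circ> mt) e) = e"
    using mate partner(2)[of "mt e"] by auto
qed

text \<open>Walk along the curve, alternating \<open>mt\<close> and \<open>partner\<close>. A walk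
  that never meets an open end would by injectivity return to \<open>e0\<close>, which is impossible
  because an open end is not the partner of any end. Each edge reverses \<open>g\<close> and each
  junction reverses it back.\<close>

lemma strand_from:
  assumes "e0 \<in> Open"
  obtains e where "e \<in> Open" "(e0, e) \<in> conn S" "g e \<longleftrightarrow> \<not> g e0"
    "\<And>e'. e' \<in> Open \<Longrightarrow> (e0, e') \<in> conn S \<Longrightarrow> e' = e0 \<or> e' = e"
proof -
  define p where "p n = ((partner S \<circ> mt) ^^ n) e0" for n
  have p0: "p 0 = e0" and pS: "p (Suc n) = partner S (mt (p n))" for n by (simp_all add: p_def)
  have ex: "\<exists>n. mt (p n) \<in> Open"
  proof (rule ccontr)
    assume "\<nexists>n. mt (p n) \<in> Open"
    then have nO: "mt (p n) \<notin> Open" for n by blast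
    have pX: "p n \<in> X" for n
      by (induction n) (use assms Open_X mate partner nO in \<open>auto simp: p0 pS\<close>)
    obtain n where "0 < n" "((partner S \<circ> mt) ^^ n) e0 = e0"
    proof (rule finite_return[of "range p" "partner S \<circ> mt" e0])
      show "finite (range p)" using finite_X pX by (meson finite_subset image_subsetI)
      show "inj_on (partner S \<circ> mt) (range p)"
        by (rule inj_on_subset[OF step_inj]) (use pX nO in auto)
      show "(partner S \<circ> mt) ` range p \<subseteq> range p" using pS by (auto simp del: range_composition) (metis rangeI)
      show "e0 \<in> range p" using p0 by (metis rangeI)
    qed
    then have "p n = e0" "p n = partner S (mt (p (n - 1)))" using pS[of "n - 1"] by (auto simp: p_def)
    moreover have "partner S (mt (p (n - 1))) \<notin> Open" using partner(1) pX mate nO by blast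
    ultimately show False using assms by simp
  qed
  define n where "n = (LEAST n. mt (p n) \<in> Open)"
  have n: "mt (p n) \<in> Open" unfolding n_def by (rule LeastI_ex[OF ex])
  have less: "mt (p i) \<notin> Open" if "i < n" for i using not_less_Least that unfolding n_def by blast
  have p: "p i \<in> X \<and> (0 < i \<longrightarrow> p i \<notin> Open) \<and> (g (p i) \<longleftrightarrow> g e0) \<and> (e0, p i) \<in> conn S"
    if "i \<le> n" for i
    using that
  proof (induction i)
    case 0 then show ?case using assms Open_X by (simp add: p0)
  next
    case (Suc i)
    then have *: "mt (p i) \<in> X - Open" using less mate by auto
    have "(p i, mt (p i)) \<in> conn S" using Suc by (intro ec_mate) (auto simp: curves_def)
    with Suc ec_partner[OF *] have "(e0, p (Suc i)) \<in> conn S"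
      unfolding pS by (meson Suc_leD ec_trans)
    then show ?case using Suc partner[OF *] mate unfolding pS by auto
  qed
  \<comment> \<open>The path up to its first open end is closed under \<open>mt\<close> and
    \<open>partner\<close>, so it contains the whole class of \<open>e0\<close>, and there is no
    third open end.\<close>
  define P where "P = p ` {..n} \<union> mt ` p ` {..n}"
  have mtP: "mt a \<in> P" if "a \<in> P" for a using that p mate by (auto simp: P_def)
  have partnerP: "partner S a \<in> P" if "a \<in> P" "a \<in> X - Open" for a
  proof -
    from \<open>a \<in> P\<close> consider i where "i \<le> n" "a = p i" | i where "i \<le> n" "a = mt (p i)"
      by (auto simp: P_def)
    then show ?thesis
    proof cases
      case 1
      then have "i \<noteq> 0" using that p0 assms by auto
      then obtain i' where i': "i = Suc i'" by (cases i) auto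
      then have "mt (p i') \<in> X - Open" using less 1 p mate by auto
      then have "partner S a = mt (p i')" using 1 i' pS partner by simp
      then show ?thesis using 1 i' by (auto simp: P_def)
    next
      case 2
      then have "i \<noteq> n" using that n by auto
      then have "partner S a = p (Suc i)" "Suc i \<le> n" using 2 pS by auto
      then show ?thesis by (auto simp: P_def)
    qed
  qed
  have inP: "e' \<in> P" if "(e0, e') \<in> conn S" for e'
    using that
  proof (rule ec_invariant)
    show "e0 \<in> P" unfolding P_def using p0 by (metis UnI1 atMost_iff imageI le0)
    fix a b assume "(a, b) \<in> curves S"
    then consider "a \<in> X" "b = mt a" | "a \<in> X - Open" "b = partner S a"
      by (auto simp: curves_def graph_on_def)
    then show "a \<in> P \<longleftrightarrow> b \<in> P"
      by cases (use mtP mate partnerP partner in \<open>metis\<close>)+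
  qed
  show ?thesis
  proof (rule that)
    show "mt (p n) \<in> Open" by (rule n)
    show "g (mt (p n)) \<longleftrightarrow> \<not> g e0" using p mate by auto
    have "(p n, mt (p n)) \<in> conn S"
      using p by (intro ec_mate) (auto simp: curves_def)
    then show "(e0, mt (p n)) \<in> conn S" using p by (meson ec_trans order_refl)
    show "e' = e0 \<or> e' = mt (p n)" if e': "e' \<in> Open" "(e0, e') \<in> conn S" for e'
    proof -
      from inP[OF e'(2)] consider i where "i \<le> n" "e' = p i" | i where "i \<le> n" "e' = mt (p i)"
        by (auto simp: P_def)
      then show ?thesis
      proof cases
        case 1 then show ?thesis using p[of i] e' p0 by (cases i) auto
      next
        case 2 then show ?thesis using less[of i] e' by (cases "i = n") auto
      qed
    qed
  qed
qed

lemma same_sign_eq: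
  assumes "a < 2 * m" "b < 2 * m" "g (\<beta> a) \<longleftrightarrow> g (\<beta> b)" "(\<beta> a, \<beta> b) \<in> conn S"
  shows "a = b"
proof -
  have "\<beta> a \<in> Open" using assms by auto
  then obtain e where "g e \<longleftrightarrow> \<not> g (\<beta> a)"
    "\<And>e'. e' \<in> Open \<Longrightarrow> (\<beta> a, e') \<in> conn S \<Longrightarrow> e' = \<beta> a \<or> e' = e"
    by (rule strand_from[where S = S]) blast
  then show ?thesis using assms \<beta>_eq_iff by (metis imageI lessThan_iff)
qed

lemma strand_ex:
  assumes "a < 2 * m"
  obtains b where "b < 2 * m" "g (\<beta> b) \<longleftrightarrow> \<not> g (\<beta> a)" "(\<beta> a, \<beta> b) \<in> conn S"
proof -
  have "\<beta> a \<in> Open" using assms by auto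
  then obtain e where "e \<in> Open" "(\<beta> a, e) \<in> conn S" "g e \<longleftrightarrow> \<not> g (\<beta> a)"
    by (rule strand_from[where S = S]) blast
  then show ?thesis using that by auto
qed

lemma strand_out_ex:
  assumes "a < 2 * m" "g (\<beta> a)"
  obtains b where "(a, b) \<in> strands S"
  using strand_ex[OF assms(1), of S] assms that unfolding strands_def by blast

lemma strand_in_ex:
  assumes "b < 2 * m" "\<not> g (\<beta> b)"
  obtains a where "(a, b) \<in> strands S"
proof -
  obtain a where "a < 2 * m" "g (\<beta> a)" "(\<beta> b, \<beta> a) \<in> conn S"
    using strand_ex[OF assms(1), of S] assms(2) by blast
  then show ?thesis using that[of a] assms ec_sym[of "\<beta> b"] unfolding strands_def by blast
qed

lemma strands_unique:
  assumes "(a, b) \<in> strands S" "(a', b') \<in> strands S"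
  shows "a = a' \<longleftrightarrow> b = b'"
proof
  assume "a = a'"
  then have "(\<beta> b, \<beta> b') \<in> conn S"
    using assms unfolding strands_def by (auto intro: ec_trans ec_sym)
  then show "b = b'" using assms same_sign_eq unfolding strands_def by blast
next
  assume "b = b'"
  then have "(\<beta> a, \<beta> a') \<in> conn S"
    using assms unfolding strands_def by (auto intro: ec_trans ec_sym)
  then show "a = a'" using assms same_sign_eq unfolding strands_def by blast
qed

lemma finite_strands: "finite (strands S)"
  by (rule finite_subset[of _ "{..<2 * m} \<times> {..<2 * m}"]) (auto simp: strands_def)


subsection \<open>Merging two components\<close>

text \<open>The class of \<open>u\<close> is a loop; the link absorbs it into the class of
  \<open>v\<close>, which remains a loop or a strand with the same open ends.\<close>

lemma loops_strands_merge:
  assumes eq: "equivcl (curves S') = equivcl (insert (u, v) (curves S))"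
    and uv: "u \<in> X" "v \<in> X" "(u, v) \<notin> conn S"
    and no_open: "\<And>e. e \<in> Open \<Longrightarrow> (u, e) \<notin> conn S"
  shows "strands S' = strands S" "card (loops S) = Suc (card (loops S'))"
proof -
  let ?E = "conn S" and ?E' = "equivcl (curves S')"
  have E': "(a, b) \<in> ?E' \<longleftrightarrow> (a, b) \<in> ?E \<or> (a, u) \<in> ?E \<and> (v, b) \<in> ?E \<or> (a, v) \<in> ?E \<and> (u, b) \<in> ?E" for a b
    unfolding eq ec_insert by auto
  have same: "(a, b) \<in> ?E' \<longleftrightarrow> (a, b) \<in> ?E" if "a \<in> Open" "b \<in> Open" for a b
    using no_open that unfolding E' by (meson ec_sym)
  then show "strands S' = strands S" unfolding strands_def by auto
  have comp: "component (curves S') = component (insert (u, v) (curves S))"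
    by (rule component_cong[OF eq])
  let ?C = "component (curves S)" and ?C' = "component (curves S')"
  have C'u: "?C' u = ?C u \<union> ?C v" by (simp add: comp component_insert_merge)
  have C'_other: "?C' x = ?C x" if "(x, u) \<notin> ?E" "(x, v) \<notin> ?E" for x
    unfolding comp using that by (rule component_insert)
  have C'_uv: "?C' x = ?C' u" if "(x, u) \<in> ?E \<or> (x, v) \<in> ?E" for x
    using that unfolding component_eq_iff E' by auto
  have Cu: "?C u \<inter> Open = {}" using no_open by (auto simp: mem_component)
  have neq: "?C u \<noteq> ?C v" using uv by (simp add: component_eq_iff)
  \<comment> \<open>The loops not involved; they are the same before and after the merge.\<close>
  define Z where "Z = {c \<in> ?C ` X. c \<inter> Open = {} \<and> c \<noteq> ?C u \<and> c \<noteq> ?C v}"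
  have Z': "Z = {c \<in> ?C' ` X. c \<inter> Open = {} \<and> c \<noteq> ?C' u}"
  proof (intro equalityI subsetI)
    fix c assume "c \<in> Z"
    then obtain x where x: "x \<in> X" "c = ?C x" "c \<inter> Open = {}" "?C x \<noteq> ?C u" "?C x \<noteq> ?C v"
      unfolding Z_def by blast
    then have "(x, u) \<notin> ?E" "(x, v) \<notin> ?E" by (simp_all add: component_eq_iff)
    note x = x(1-3) this
    then have "?C' x = c" using C'_other by simp
    moreover have "x \<notin> ?C' u" unfolding C'u using x by (auto simp: mem_component dest: ec_sym)
    ultimately show "c \<in> {c \<in> ?C' ` X. c \<inter> Open = {} \<and> c \<noteq> ?C' u}"
      using x by (auto simp: mem_component)
  next
    fix c assume "c \<in> {c \<in> ?C' ` X. c \<inter> Open = {} \<and> c \<noteq> ?C' u}"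
    then obtain x where x: "x \<in> X" "c = ?C' x" "c \<inter> Open = {}" "?C' x \<noteq> ?C' u" by auto
    then have "(x, u) \<notin> ?E" "(x, v) \<notin> ?E" using C'_uv by blast+
    then have "c = ?C x" "?C x \<noteq> ?C u" "?C x \<noteq> ?C v" using x C'_other by (simp_all add: component_eq_iff)
    then show "c \<in> Z" using x(1,3) unfolding Z_def by blast
  qed
  have fin: "finite Z" unfolding Z_def using finite_X by simp
  have Cu_Z: "?C u \<notin> Z" "?C v \<notin> Z" by (auto simp: Z_def)
  have C'u_Z: "?C' u \<notin> Z" unfolding Z' by auto
  show "card (loops S) = Suc (card (loops S'))"
  proof (cases "?C v \<inter> Open = {}")
    case True
    then have "loops S = insert (?C u) (insert (?C v) Z)"
      using Cu uv unfolding loops_def Z_def by auto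
    moreover have "loops S' = insert (?C' u) Z"
    proof -
      have "?C' u \<inter> Open = {}" using Cu True C'u by auto
      then show ?thesis using uv unfolding loops_def Z' by auto
    qed
    ultimately show ?thesis using fin Cu_Z C'u_Z neq by simp
  next
    case False
    then have "loops S = insert (?C u) Z"
      using Cu uv unfolding loops_def Z_def by auto
    moreover have "loops S' = Z"
    proof -
      have "?C' u \<inter> Open \<noteq> {}" using False C'u by auto
      then show ?thesis unfolding loops_def Z' by auto
    qed
    ultimately show ?thesis using fin Cu_Z by simp
  qed
qed

text \<open>A closed curve that visits a crossing exactly once leaves and re-enters it through the two
  ends that are joined there, so these remain connected when the crossing is removed.\<close>

lemma loop_through_crossing:
  assumes x: "x \<in> N" and i: "i < 4"
    and no_open: "\<And>e. e \<in> Open \<Longrightarrow> (Cr x i, e) \<notin> conn S"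
    and once: "\<And>j. j < 4 \<Longrightarrow> (Cr x i, Cr x j) \<in> conn S \<Longrightarrow>
      j = i \<or> j = smoothing_partner (x \<in> S) i"
  shows "(Cr x i, Cr x (smoothing_partner (x \<in> S) i)) \<in> equivcl (cut {x} S)"
proof -
  let ?f = "partner S \<circ> mt" and ?e0 = "Cr x i" and ?i' = "smoothing_partner (x \<in> S) i"
  let ?E = "conn S"
  define p where "p n = (?f ^^ n) ?e0" for n
  have p0: "p 0 = ?e0" and pS: "p (Suc n) = partner S (mt (p n))" for n by (simp_all add: p_def)
  have p: "p n \<in> X \<and> (?e0, p n) \<in> ?E \<and> (g (p n) \<longleftrightarrow> g ?e0) \<and> mt (p n) \<notin> Open" for n
  proof (induction n)
    case 0
    have "(?e0, mt ?e0) \<in> ?E" using x i by (intro ec_mate) (auto simp: curves_def)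
    then show ?case using x i no_open by (auto simp: p0)
  next
    case (Suc n)
    then have *: "mt (p n) \<in> X - Open" using mate by auto
    have "(p n, mt (p n)) \<in> ?E" using Suc by (intro ec_mate) (auto simp: curves_def)
    with Suc have 1: "(?e0, p (Suc n)) \<in> ?E" using ec_partner[OF *, of S] unfolding pS by (meson ec_trans)
    have "(p (Suc n), mt (p (Suc n))) \<in> ?E"
      using partner[OF *] by (intro ec_mate) (auto simp: curves_def pS)
    with 1 have "mt (p (Suc n)) \<notin> Open" using no_open by (meson ec_trans)
    then show ?case using 1 Suc partner[OF *] mate unfolding pS by auto
  qed
  have ex: "\<exists>n. p (Suc n) = ?e0"
  proof -
    obtain n where "0 < n" "(?f ^^ n) ?e0 = ?e0"
    proof (rule finite_return[of "range p" ?f ?e0])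
      show "finite (range p)" using finite_X p by (meson finite_subset image_subsetI)
      show "inj_on ?f (range p)"
        by (rule inj_on_subset[OF step_inj]) (use p in auto)
      show "?f ` range p \<subseteq> range p" using pS by (auto simp del: range_composition) (metis rangeI)
      show "?e0 \<in> range p" using p0 by (metis rangeI)
    qed
    then show ?thesis unfolding p_def by (metis Suc_pred')
  qed
  define n where "n = (LEAST n. p (Suc n) = ?e0)"
  have n: "p (Suc n) = ?e0" unfolding n_def by (rule LeastI_ex[OF ex])
  have less: "p (Suc k) \<noteq> ?e0" if "k < n" for k using not_less_Least that unfolding n_def by blast
  have path: "(?e0, p k) \<in> equivcl (cut {x} S)" if "k \<le> n" for k
    using that
  proof (induction k)
    case 0 then show ?case by (simp add: p0)
  next
    case (Suc k)
    have *: "mt (p k) \<in> X - Open" using p mate by auto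
    have 1: "(p k, mt (p k)) \<in> equivcl (cut {x} S)"
      using p by (intro ec_mate) (auto simp: cut_def)
    \<comment> \<open>The walk can meet \<open>x\<close> again only at the two joined ends. It
      arrives with gravity opposite to that of \<open>Cr x i\<close>, which excludes
      \<open>j = i\<close>, and arriving at the other end would close the walk before time
      \<open>n\<close>.\<close>
    have "mt (p k) \<noteq> Cr x j" for j
    proof
      assume j: "mt (p k) = Cr x j"
      then have j4: "j < 4" using * by auto
      have "(p k, mt (p k)) \<in> ?E" using p by (intro ec_mate) (auto simp: curves_def)
      then have "(?e0, Cr x j) \<in> ?E" using p j by (metis ec_trans)
      then have "j = i \<or> j = ?i'" using once j4 by blast
      moreover have "j \<noteq> i" using p mate j by metis
      ultimately have "p (Suc k) = ?e0" unfolding pS j using i by (simp add: smoothing_partner_involution)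
      then show False using less[of k] Suc.prems by simp
    qed
    then have "(mt (p k), p (Suc k)) \<in> equivcl (cut {x} S)"
      using * unfolding pS by (intro ec_base) (auto simp: cut_def graph_on_def)
    with 1 Suc show ?case by (meson Suc_leD ec_trans)
  qed
  have "mt (p n) \<in> X - Open" using p mate by auto
  then have "mt (p n) = Cr x ?i'" using n partner(2) unfolding pS by (metis partner_Cr)
  moreover have "(p n, mt (p n)) \<in> equivcl (cut {x} S)"
    using p by (intro ec_mate) (auto simp: cut_def)
  ultimately show ?thesis using path[of n] by (metis ec_trans order_refl)
qed

section \<open>Resolving a single crossing\<close>

lemma curves_sub_joined:
  assumes "T \<subseteq> U"
  shows "curves (S \<union> T) \<subseteq> equivcl (joined U S)"
proof (rule subrelI)
  fix a b assume "(a, b) \<in> curves (S \<union> T)"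
  then consider "a \<in> X" "b = mt a" | "a \<in> X - Open" "b = partner (S \<union> T) a"
    by (auto simp: curves_def graph_on_def)
  then show "(a, b) \<in> equivcl (joined U S)"
  proof cases
    case 1
    then show ?thesis by (intro ec_base) (auto simp: joined_def cut_def graph_on_def)
  next
    case 2
    show ?thesis
    proof (cases "a \<in> {Cr x i | x i. x \<in> U}")
      case True
      then obtain x i where "a = Cr x i" "x \<in> U" by blast
      then show ?thesis using 2 smoothing_partner_less
        by (intro ec_base) (auto simp: joined_def)
    next
      case False
      moreover have "y \<in> S \<union> T \<longleftrightarrow> y \<in> S" if "y \<notin> U" for y using that assms by blast
      ultimately have "b = partner S a" using 2 by (cases a) (auto simp: partner_def)
      then show ?thesis using 2 False
        by (intro ec_base) (auto simp: joined_def cut_def graph_on_def)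
    qed
  qed
qed

lemma joined_empty: "joined {} S = curves S"
  by (auto simp: joined_def cut_def curves_def)

text \<open>Either smoothing joins each of the ends 0 and 2 to one of the ends 1 and 3, so a single
  link between 1 and 3 connects all four, however \<open>S\<close> smooths \<open>x\<close>.\<close>

lemma joined_insert:
  assumes "x \<in> N" "x \<notin> U"
  shows "equivcl (joined (insert x U) S) =
     equivcl (insert (Cr x 1, Cr x 3) (joined U S))" (is "_ = ?E")
proof -
  have cr: "(Cr x i, Cr x (smoothing_partner (x \<in> S) i)) \<in> ?E" if "i < 4" for i
    using assms that Cr_not_Open
    by (intro ec_base) (auto simp: joined_def cut_def graph_on_def intro!: image_eqI)
  have 13: "(Cr x 1, Cr x 3) \<in> ?E" by (intro ec_base) auto
  have to1: "(Cr x i, Cr x 1) \<in> ?E" if "i < 4" for i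
  proof -
    from that consider "i = 0" | "i = 1" | "i = 2" | "i = 3" by linarith
    then show ?thesis
      using cr[of 0] cr[of 2] 13 ec_sym[OF 13]
      by cases (cases "x \<in> S"; auto simp: smoothing_partner_simps intro: ec_trans)+
  qed
  show ?thesis
  proof (rule ec_eqI)
    show "joined (insert x U) S \<subseteq> ?E"
    proof (rule subrelI)
      fix a b assume "(a, b) \<in> joined (insert x U) S"
      moreover have "cut (insert x U) S \<subseteq> cut U S"
        unfolding cut_def graph_on_def by blast
      ultimately consider "(a, b) \<in> joined U S" | i j where "a = Cr x i" "b = Cr x j" "i < 4" "j < 4"
        unfolding joined_def by blast
      then show "(a, b) \<in> ?E"
        using to1 by cases (auto intro: ec_base ec_trans ec_sym)
    qed
    show "insert (Cr x 1, Cr x 3) (joined U S) \<subseteq> equivcl (joined (insert x U) S)"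
    proof (rule subrelI)
      fix a b assume ab: "(a, b) \<in> insert (Cr x 1, Cr x 3) (joined U S)"
      have "(a, b) \<in> joined (insert x U) S"
      proof (cases "\<exists>i j. a = Cr x i \<and> b = Cr x j \<and> i < 4 \<and> j < 4")
        case True
        then show ?thesis by (auto simp: joined_def)
      next
        case False
        moreover have "(a, b) \<noteq> (Cr x 1, Cr x 3)"
        proof
          assume "(a, b) = (Cr x 1, Cr x 3)"
          then have "a = Cr x 1 \<and> b = Cr x 3 \<and> (1 :: nat) < 4 \<and> (3 :: nat) < 4" by simp
          with False show False by blast
        qed
        moreover have "\<exists>i j. a = Cr x i \<and> partner S a = Cr x j \<and> i < 4 \<and> j < 4"
          if "a \<in> X" "a = Cr x i" for i using that smoothing_partner_less by auto
        ultimately show ?thesis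
          using ab unfolding joined_def cut_def graph_on_def by blast
      qed
      then show "(a, b) \<in> equivcl (joined (insert x U) S)" by (rule ec_base)
    qed
  qed
qed

lemma joined_insert_cong:
  assumes "S' - {x} = S - {x}"
  shows "joined (insert x U) S' = joined (insert x U) S"
proof -
  let ?Z = "X - Open - {Cr y i | y i. y \<in> insert x U}"
  have "y \<in> S' \<longleftrightarrow> y \<in> S" if "y \<noteq> x" for y using that assms by blast
  then have "partner S' a = partner S a" if "a \<in> ?Z" for a
    using that by (cases a) (auto simp: partner_def)
  then have "graph_on ?Z (partner S') = graph_on ?Z (partner S)"
    unfolding graph_on_def by (intro image_cong) auto
  then show ?thesis by (simp only: joined_def cut_def)
qed

text \<open>The arc at \<open>Cr x i\<close> belongs to a closed piece that passes \<open>x\<close>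
  only there, so its two ends stay connected when \<open>x\<close> is deleted. The other smoothing
  joins them to the two ends of the other arc; then all four are connected, as if \<open>x\<close>
  were unresolved.\<close>

lemma joined_flip:
  assumes x: "x \<in> N" "x \<notin> U"
    and S': "x \<in> S' \<longleftrightarrow> x \<notin> S" "S' - {x} = S - {x}"
    and i: "i = 1 \<or> i = 3"
    and no_open: "\<And>e. e \<in> Open \<Longrightarrow> (Cr x i, e) \<notin> equivcl (joined U S)"
    and 13: "(Cr x 1, Cr x 3) \<notin> equivcl (joined U S)"
  shows "equivcl (joined U S') = equivcl (insert (Cr x 1, Cr x 3) (joined U S))"
proof -
  let ?E = "equivcl (joined U S)" and ?E' = "equivcl (joined U S')"
  have sub: "conn S \<subseteq> ?E"
    by (rule ec_least) (use curves_sub_joined[of "{}" U S] in auto)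
  define i' where "i' = smoothing_partner (x \<in> S) i"
  have pair: "(Cr x j, Cr x (smoothing_partner (x \<in> T) j)) \<in> equivcl (joined U T)" if "j < 4" for j T
    using x that Cr_not_Open
    by (intro ec_base) (auto simp: joined_def cut_def graph_on_def intro!: image_eqI)
  have "(Cr x i, Cr x i') \<in> equivcl (cut {x} S)"
    unfolding i'_def
  proof (rule loop_through_crossing)
    show "(Cr x i, e) \<notin> conn S" if "e \<in> Open" for e using no_open that sub by blast
    show "j = i \<or> j = smoothing_partner (x \<in> S) i"
      if j: "j < 4" "(Cr x i, Cr x j) \<in> conn S" for j
    proof (rule ccontr)
      assume nj: "\<not> (j = i \<or> j = smoothing_partner (x \<in> S) i)"
      have ij: "(Cr x i, Cr x j) \<in> ?E" using j sub by blast
      have "\<exists>j'. {i, j'} = {1, 3} \<and> (Cr x j, Cr x j') \<in> ?E"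
      proof -
        from \<open>j < 4\<close> consider "j = 0" | "j = 1" | "j = 2" | "j = 3" by linarith
        then show ?thesis
          using nj i pair[OF j(1), of S]
          by cases (cases "x \<in> S"; auto simp: smoothing_partner_simps doubleton_eq_iff)+
      qed
      then obtain j' where j': "{i, j'} = {1, 3}" "(Cr x i, Cr x j') \<in> ?E" using ec_trans[OF ij] by blast
      from j'(1) have "i = 1 \<and> j' = 3 \<or> i = 3 \<and> j' = 1" by (auto simp: doubleton_eq_iff)
      then show False using j'(2) 13 ec_sym[OF j'(2)] by auto
    qed
  qed (use x i in auto)
  moreover have "cut {x} S \<subseteq> ?E'"
  proof (rule subrelI)
    fix a b assume "(a, b) \<in> cut {x} S"
    then consider "a \<in> X" "b = mt a" | "a \<in> X - Open - {Cr x i | i. True}" "b = partner S a"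
      by (auto simp: cut_def graph_on_def)
    then show "(a, b) \<in> ?E'"
    proof cases
      case 1
      then show ?thesis by (intro ec_base) (auto simp: joined_def cut_def graph_on_def)
    next
      case 2
      then have "b = partner S' a" using S' by (cases a) (auto simp: partner_def)
      then have "(a, b) \<in> curves S'" using 2 by (auto simp: curves_def graph_on_def)
      then show ?thesis using curves_sub_joined[of "{}" U S'] by auto
    qed
  qed
  ultimately have ii': "(Cr x i, Cr x i') \<in> ?E'" using ec_least by blast
  have conn': "(Cr x 1, Cr x 3) \<in> ?E'"
  proof -
    have "i' < 4" using i unfolding i'_def by (intro smoothing_partner_less) auto
    from ec_trans[OF ii' pair[OF this]]
    have *: "(Cr x i, Cr x (smoothing_partner (x \<in> S') i')) \<in> ?E'" .
    have "smoothing_partner (x \<in> S') i' = (if i = 1 then 3 else 1)"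
      using i S'(1) unfolding i'_def by (cases "x \<in> S") (auto simp: smoothing_partner_simps)
    then show ?thesis using * i ec_sym[OF *] by (metis (full_types))
  qed
  have "equivcl (joined U S') = equivcl (insert (Cr x 1, Cr x 3) (joined U S'))"
    by (rule ec_insert_absorb[OF conn', symmetric])
  also have "\<dots> = equivcl (joined (insert x U) S')"
    by (rule joined_insert[OF x, symmetric])
  also have "joined (insert x U) S' = joined (insert x U) S"
    by (rule joined_insert_cong[OF S'(2)])
  also have "equivcl \<dots> = equivcl (insert (Cr x 1, Cr x 3) (joined U S))"
    by (rule joined_insert[OF x])
  finally show ?thesis .
qed

end

section \<open>Signs of the state sum\<close>

context closed_diagram
begin

definition anchored :: "'c set \<Rightarrow> 'c set \<Rightarrow> bool" where
  "anchored U S \<longleftrightarrow> (\<forall>e\<in>X. \<exists>b\<in>Open. (e, b) \<in> equivcl (joined U S))"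

definition state_weight :: "'c set \<Rightarrow> laurent" where
  "state_weight S = (- q_pow 1) ^ card S * loop_value ^ card (loops S)"

text \<open>The piece that lost the boundary is attached by the link between the ends 1 and 3, so it
  contains exactly one of them. Thus the other smoothing connects what an unresolved
  \<open>x\<close> connects. The same argument with no crossing unresolved applies to each state
  \<open>S \<union> T\<close>, whose curve through this end is a loop.\<close>

lemma separating_smoothing:
  assumes x: "x \<in> N" "x \<notin> U"
    and S': "x \<in> S' \<longleftrightarrow> x \<notin> S" "S' - {x} = S - {x}"
    and good: "anchored (insert x U) S" and bad: "\<not> anchored U S"
  shows "anchored U S'"
    and "\<And>T. T \<subseteq> U \<Longrightarrow> strands (S \<union> T) = strands (S' \<union> T) \<and>
           card (loops (S \<union> T)) = Suc (card (loops (S' \<union> T)))"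
proof -
  let ?E = "equivcl (joined U S)"
  let ?c1 = "Cr x 1" and ?c3 = "Cr x 3"
  from bad obtain e where e: "e \<in> X" "\<And>b. b \<in> Open \<Longrightarrow> (e, b) \<notin> ?E"
    unfolding anchored_def by blast
  from good e(1) obtain b where b: "b \<in> Open" "(e, b) \<in> equivcl (insert (?c1, ?c3) (joined U S))"
    unfolding anchored_def joined_insert[OF x] by blast
  then have "(e, ?c1) \<in> ?E \<and> (?c3, b) \<in> ?E \<or> (e, ?c3) \<in> ?E \<and> (?c1, b) \<in> ?E"
    using e(2) unfolding ec_insert by auto
  then obtain i j where ij: "i = 1 \<and> j = 3 \<or> i = 3 \<and> j = (1::nat)"
    "(e, Cr x i) \<in> ?E" "(Cr x j, b) \<in> ?E" by blast
  have no_open: "(Cr x i, b') \<notin> ?E" if "b' \<in> Open" for b'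
    using e(2)[OF that] ij(2) ec_trans by metis
  have "(Cr x i, Cr x j) \<notin> ?E" using no_open[OF b(1)] ij(3) ec_trans by metis
  then have n13: "(?c1, ?c3) \<notin> ?E" using ij(1) ec_sym by metis
  have i: "i = 1 \<or> i = 3" using ij(1) by auto
  have "equivcl (joined U S') = equivcl (joined (insert x U) S)"
    using joined_flip[OF x S' i no_open n13] joined_insert[OF x, of S] by simp
  then show "anchored U S'" using good unfolding anchored_def by simp
  fix T assume T: "T \<subseteq> U"
  have sub: "equivcl (curves (S \<union> T)) \<subseteq> ?E"
    by (rule ec_least) (rule curves_sub_joined[OF T])
  have "equivcl (joined {} (S' \<union> T)) =
      equivcl (insert (?c1, ?c3) (joined {} (S \<union> T)))"
    by (rule joined_flip[where i = i])
      (use x S' T i no_open n13 sub in \<open>auto simp: joined_empty\<close>)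
  also have "\<dots> = equivcl (insert (Cr x i, Cr x j) (curves (S \<union> T)))"
    using ij(1) unfolding joined_empty ec_insert by auto
  finally have eq: "equivcl (curves (S' \<union> T)) =
      equivcl (insert (Cr x i, Cr x j) (curves (S \<union> T)))" by (simp add: joined_empty)
  have "(Cr x i, Cr x j) \<notin> equivcl (curves (S \<union> T))"
    using \<open>(Cr x i, Cr x j) \<notin> ?E\<close> sub by blast
  moreover have "\<And>b'. b' \<in> Open \<Longrightarrow> (Cr x i, b') \<notin> equivcl (curves (S \<union> T))"
    using no_open sub by blast
  moreover have "Cr x i \<in> X" "Cr x j \<in> X" using ij(1) x(1) by auto
  ultimately show "strands (S \<union> T) = strands (S' \<union> T) \<and>
      card (loops (S \<union> T)) = Suc (card (loops (S' \<union> T)))"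
    using loops_strands_merge[OF eq] by simp
qed

text \<open>The Reidemeister computation: \<open>(q + q^-1) - q = q^-1 = (-q^-2) * (-q)\<close> if
  \<open>S\<close> has the additional loop, and \<open>1 - q * (q + q^-1) = -q^2\<close> if
  \<open>insert x S\<close> has it.\<close>

lemma state_weight_resolve:
  assumes "x \<notin> S" "finite S"
  shows "card (loops S) = Suc (card (loops (insert x S))) \<Longrightarrow>
      state_weight S + state_weight (insert x S) = - q_pow (-2) * state_weight (insert x S)"
    and "card (loops (insert x S)) = Suc (card (loops S)) \<Longrightarrow>
      state_weight S + state_weight (insert x S) = - q_pow 2 * state_weight S"
proof -
  let ?w = "(- q_pow 1) ^ card S" and ?l = "loop_value"
  have card: "card (insert x S) = Suc (card S)" using assms by simp
  have 1: "?l + - q_pow 1 = q_pow (-1)" by (simp add: loop_value_def)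
  have 2: "- q_pow (-2) * - q_pow 1 = q_pow (-1)" "1 + - q_pow 1 * ?l = - q_pow 2"
    by (simp_all add: q_pow_mult q_pow_0 loop_value_def distrib_left)
  show "state_weight S + state_weight (insert x S) = - q_pow (-2) * state_weight (insert x S)"
    if "card (loops S) = Suc (card (loops (insert x S)))"
  proof -
    define n where "n = card (loops (insert x S))"
    have "state_weight S + state_weight (insert x S) = ?w * ?l ^ n * (?l + - q_pow 1)"
      unfolding state_weight_def card that n_def[symmetric] by (simp add: algebra_simps)
    also have "\<dots> = ?w * ?l ^ n * (- q_pow (-2) * - q_pow 1)" unfolding 1 2 ..
    also have "\<dots> = - q_pow (-2) * state_weight (insert x S)"
      unfolding state_weight_def card n_def[symmetric] by (simp only: power_Suc mult_ac)
    finally show ?thesis .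
  qed
  show "state_weight S + state_weight (insert x S) = - q_pow 2 * state_weight S"
    if "card (loops (insert x S)) = Suc (card (loops S))"
  proof -
    define n where "n = card (loops S)"
    have "state_weight S + state_weight (insert x S) = ?w * ?l ^ n * (1 + - q_pow 1 * ?l)"
      unfolding state_weight_def card that n_def[symmetric] by (simp add: algebra_simps)
    then show ?thesis unfolding 2 state_weight_def n_def by (simp add: mult_ac)
  qed
qed

text \<open>If both smoothings of a crossing leave every component attached to the boundary, then their
  contributions are added.  Otherwise the crossing is nugatory, and its removal by a Reidemeister
  move costs a factor \<open>-q\<^sup>2\<close> or \<open>-q\<^sup>-\<^sup>2\<close>, which preserves the alternation of the signs.\<close>

lemma sign_coherent_partial_state_sum:
  assumes "finite U" "U \<subseteq> N" "S \<subseteq> N" "S \<inter> U = {}" "anchored U S"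
    and leaf: "\<And>T. T \<subseteq> N \<Longrightarrow> loops T = {} \<Longrightarrow> strands T = \<sigma> \<Longrightarrow>
      sign_coherent u v ((- q_pow 1) ^ card T)"
  shows "sign_coherent u v (\<Sum>T\<in>Pow U. if strands (S \<union> T) = \<sigma> then state_weight (S \<union> T) else 0)"
  using assms(1-5)
proof (induction U arbitrary: S rule: finite_induct)
  case empty
  \<comment> \<open>With every crossing resolved, \<open>anchored\<close> says that there are no
    loops, so this is a leaf of the resolution.\<close>
  have "loops S = {}"
  proof -
    have "\<exists>b\<in>Open. b \<in> component (curves S) e" if "e \<in> X" for e
      using empty.prems(4) that by (simp add: anchored_def joined_empty mem_component)
    then show ?thesis unfolding loops_def by blast
  qed
  then have "strands S = \<sigma> \<Longrightarrow> sign_coherent u v (state_weight S)"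
    using leaf[of S] empty.prems by (simp add: state_weight_def)
  then show ?case by (cases "strands S = \<sigma>") simp_all
next
  case (insert x U)
  let ?F = "\<lambda>S. \<Sum>T\<in>Pow U. if strands (S \<union> T) = \<sigma> then state_weight (S \<union> T) else 0"
  have x: "x \<in> N" "x \<notin> U" "x \<notin> S" using insert by auto
  have split: "(\<Sum>T\<in>Pow (insert x U). if strands (S \<union> T) = \<sigma> then state_weight (S \<union> T) else 0) =
      ?F S + ?F (insert x S)"
  proof -
    have "inj_on (insert x) (Pow U)" using x(2) by (auto simp: inj_on_def)
    moreover have "Pow U \<inter> insert x ` Pow U = {}" using x(2) by auto
    ultimately show ?thesis
      unfolding Pow_insert using insert.hyps
      by (subst sum.union_disjoint) (simp_all add: sum.reindex cong: if_cong)
  qed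
  have IH: "sign_coherent u v (?F S')"
    if "anchored U S'" "S' = S \<or> S' = insert x S" for S'
    by (rule insert.IH) (use that insert.prems x in auto)
  have fin: "finite (S \<union> T)" if "T \<subseteq> U" for T
    using that insert finite_N by (meson Un_least finite_subset insert_subset order_trans)
  have notin: "x \<notin> S \<union> T" if "T \<subseteq> U" for T using that x by auto
  consider "anchored U S" "anchored U (insert x S)"
    | "\<not> anchored U S" | "\<not> anchored U (insert x S)" by blast
  then show ?case
  proof cases
    case 1
    then show ?thesis unfolding split using IH by (intro sign_coherent_add) blast+
  next
    case 2
    have S': "x \<in> insert x S \<longleftrightarrow> x \<notin> S" "insert x S - {x} = S - {x}" using x by auto
    note sep = separating_smoothing[OF x(1,2) S' insert.prems(4) 2]
    have "?F S + ?F (insert x S) = - q_pow (-2) * ?F (insert x S)"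
      unfolding sum.distrib[symmetric] sum_distrib_left
    proof (rule sum.cong[OF HOL.refl])
      fix T assume "T \<in> Pow U"
      then have T: "T \<subseteq> U" by simp
      show "(if strands (S \<union> T) = \<sigma> then state_weight (S \<union> T) else 0) +
          (if strands (insert x S \<union> T) = \<sigma> then state_weight (insert x S \<union> T) else 0) =
          - q_pow (-2) * (if strands (insert x S \<union> T) = \<sigma> then state_weight (insert x S \<union> T) else 0)"
        using sep(2)[OF T] state_weight_resolve(1)[OF notin[OF T] fin[OF T]]
        by (simp del: mult_minus_left)
    qed
    then show ?thesis unfolding split using IH[OF sep(1)] sign_coherent_mult_q2 by simp
  next
    case 3
    have S': "x \<in> S \<longleftrightarrow> x \<notin> insert x S" "S - {x} = insert x S - {x}" using x by auto
    have "anchored (insert x U) (insert x S)"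
      using insert.prems(4) joined_insert_cong[OF S'(2)] unfolding anchored_def by simp
    note sep = separating_smoothing[OF x(1,2) S' this 3]
    have "?F S + ?F (insert x S) = - q_pow 2 * ?F S"
      unfolding sum.distrib[symmetric] sum_distrib_left
    proof (rule sum.cong[OF HOL.refl])
      fix T assume "T \<in> Pow U"
      then have T: "T \<subseteq> U" by simp
      show "(if strands (S \<union> T) = \<sigma> then state_weight (S \<union> T) else 0) +
          (if strands (insert x S \<union> T) = \<sigma> then state_weight (insert x S \<union> T) else 0) =
          - q_pow 2 * (if strands (S \<union> T) = \<sigma> then state_weight (S \<union> T) else 0)"
        using sep(2)[OF T] state_weight_resolve(2)[OF notin[OF T] fin[OF T]]
        by (simp del: mult_minus_left)
    qed
    then show ?thesis unfolding split using IH[OF sep(1)] sign_coherent_mult_q2 by simp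
  qed
qed

text \<open>Connectedness of the diagram enters here, together with the open end that every partial
  closure retains.\<close>

lemma anchored_unsmoothed: "anchored N {}"
  unfolding anchored_def
proof
  fix e assume e: "e \<in> X"
  have b: "\<beta> 0 \<in> Open" using m_pos by auto
  have "mate_steps D \<union> {(Cr x i, Cr x i') | x i i'. x \<in> N \<and> i < 4 \<and> i' < 4}
      \<subseteq> joined N {}"
    by (auto simp: mate_steps_def joined_def cut_def graph_on_def)
  then have "(e, \<beta> 0) \<in> (joined N {})\<^sup>*"
    using connected e Open_X[OF b] rtrancl_mono unfolding connected_diagram_def by blast
  then have "(e, \<beta> 0) \<in> equivcl (joined N {})"
    unfolding equivcl_def by (rule subsetD[OF rtrancl_mono, rotated]) simp
  then show "\<exists>b\<in>Open. (e, b) \<in> equivcl (joined N {})" using b by blast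
qed

lemma sign_coherent_state_sum:
  assumes "\<And>T. T \<subseteq> N \<Longrightarrow> loops T = {} \<Longrightarrow> strands T = \<sigma> \<Longrightarrow>
      sign_coherent u v ((- q_pow 1) ^ card T)"
  shows "sign_coherent u v (\<Sum>S\<in>{S \<in> Pow N. strands S = \<sigma>}. state_weight S)"
proof -
  have "sign_coherent u v
      (\<Sum>T\<in>Pow N. if strands ({} \<union> T) = \<sigma> then state_weight ({} \<union> T) else 0)"
    by (rule sign_coherent_partial_state_sum)
      (use finite_N anchored_unsmoothed assms in auto)
  then show ?thesis
    unfolding Un_empty_left by (subst sum.inter_filter) (simp_all add: finite_N)
qed

end

section \<open>Rotation numbers\<close>

lemma mod_add_right_cancel:
  fixes i j d n :: nat
  assumes "(i + d) mod n = (j + d) mod n" "i < n" "j < n"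
  shows "i = j"
proof -
  \<comment> \<open>Adding \<open>n * d - d\<close> undoes the addition of \<open>d\<close> modulo
    \<open>n\<close> without leaving the natural numbers.\<close>
  have *: "((k + d) mod n + (n * d - d)) mod n = k" if "k < n" for k
  proof -
    have "d \<le> n * d" using that by (cases n) auto
    then have "k + d + (n * d - d) = k + n * d" by simp
    then have "((k + d) mod n + (n * d - d)) mod n = (k + n * d) mod n" by (metis mod_add_left_eq)
    then show ?thesis using that by simp
  qed
  show ?thesis using *[OF assms(2)] *[OF assms(3)] assms(1) by metis
qed

lemma boundary_pattern_shift:
  assumes "boundary_pattern m I" "0 < m"
  shows "bij_betw (\<lambda>i. (i + 1) mod (2 * m)) I ({..<2 * m} - I)"
proof (rule bij_betw_imageI)
  have I: "I \<subseteq> {..<2 * m}" "\<And>i. i < 2 * m \<Longrightarrow> i \<in> I \<longleftrightarrow> (i + 1) mod (2 * m) \<notin> I"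
    using assms(1) unfolding boundary_pattern_def by blast+
  show "inj_on (\<lambda>i. (i + 1) mod (2 * m)) I"
    by (rule inj_onI) (use I mod_add_right_cancel in blast)
  show "(\<lambda>i. (i + 1) mod (2 * m)) ` I = {..<2 * m} - I"
  proof (intro equalityI subsetI)
    fix b assume b: "b \<in> {..<2 * m} - I"
    define a where "a = (b + (2 * m - 1)) mod (2 * m)"
    have "(a + 1) mod (2 * m) = (b + (2 * m - 1) + 1) mod (2 * m)" unfolding a_def by (simp add: mod_Suc_eq)
    also have "b + (2 * m - 1) + 1 = b + 2 * m" using assms(2) by simp
    finally have "(a + 1) mod (2 * m) = b" using b by simp
    moreover have "a < 2 * m" using assms(2) by (simp add: a_def)
    ultimately show "b \<in> (\<lambda>i. (i + 1) mod (2 * m)) ` I" using I(2)[of a] b by (intro image_eqI[of _ _ a]) auto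
  qed (use I assms(2) in auto)
qed

lemma boundary_pattern_card:
  assumes "boundary_pattern m I" "0 < m"
  shows "card I = m"
proof -
  have I: "I \<subseteq> {..<2 * m}" using assms(1) unfolding boundary_pattern_def by blast
  have "card I = card ({..<2 * m} - I)" using boundary_pattern_shift[OF assms] by (rule bij_betw_same_card)
  also have "\<dots> = 2 * m - card I" using I by (simp add: card_Diff_subset finite_subset)
  finally show ?thesis using card_mono[OF _ I] by simp
qed

definition descents :: "smoothing \<Rightarrow> nat" where
  "descents \<sigma> = card {(a, b) \<in> \<sigma>. b < a}"

text \<open>The part of the rotation number that depends on the pattern only: strands match all
  in-points with all out-points, so the sum of \<open>b - a\<close> over the strands is
  fixed.\<close>

definition rotation_offset :: "nat \<Rightarrow> nat set \<Rightarrow> rat" where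
  "rotation_offset m I =
     of_int ((\<Sum>b\<in>{..<2 * m} - I. int b) - (\<Sum>a\<in>I. int a)) / of_nat (2 * m) - of_nat m / 2"

text \<open>Every out-point follows an in-point, and the difference is 1 except for a wrap from
  \<open>2 * m - 1\<close> to 0, which costs \<open>2 * m\<close>. So the two sums differ by
  \<open>m\<close> or \<open>-m\<close>, and the quotient is 1/2 or -1/2.\<close>

lemma rotation_offset_half_integer:
  assumes "boundary_pattern m I" "0 < m"
  shows "2 * rotation_offset m I \<in> \<int>"
proof -
  have I: "I \<subseteq> {..<2 * m}" using assms(1) unfolding boundary_pattern_def by blast
  then have fin: "finite I" by (rule finite_subset) simp
  have "(\<Sum>b\<in>{..<2 * m} - I. int b) = (\<Sum>a\<in>I. int ((a + 1) mod (2 * m)))"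
    using sum.reindex_bij_betw[OF boundary_pattern_shift[OF assms], of int] by simp
  also have "\<dots> = (\<Sum>a\<in>I. int a + 1 - (if a = 2 * m - 1 then 2 * int m else 0))"
  proof (rule sum.cong[OF HOL.refl])
    fix a assume "a \<in> I"
    then have "a < 2 * m" using I by auto
    then show "int ((a + 1) mod (2 * m)) = int a + 1 - (if a = 2 * m - 1 then 2 * int m else 0)"
      using assms(2) by (cases "a = 2 * m - 1") auto
  qed
  also have "\<dots> = (\<Sum>a\<in>I. int a) + int (card I) - (if 2 * m - 1 \<in> I then 2 * int m else 0)"
    using fin by (simp add: sum_subtractf sum.distrib)
  finally have "(\<Sum>b\<in>{..<2 * m} - I. int b) - (\<Sum>a\<in>I. int a) =
      int m * (if 2 * m - 1 \<in> I then -1 else 1)"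
    using boundary_pattern_card[OF assms] by auto
  then have "2 * rotation_offset m I = (if 2 * m - 1 \<in> I then -1 else 1) - of_nat m"
    using assms(2) unfolding rotation_offset_def by (simp add: field_simps)
  then show ?thesis by simp
qed

text \<open>Reducing \<open>b - a\<close> modulo \<open>2 * m\<close> adds \<open>2 * m\<close>
  exactly for the strands with \<open>b < a\<close>, which is 1 after division.\<close>

lemma rotation_number_eq:
  assumes "boundary_pattern m I" "0 < m" "\<sigma> \<in> oriented_smoothings m I"
  shows "rotation_number m \<sigma> = of_nat (descents \<sigma>) + rotation_offset m I"
proof -
  have \<sigma>: "\<sigma> \<subseteq> I \<times> ({..<2 * m} - I)" "\<And>a. a \<in> I \<Longrightarrow> \<exists>!b. (a, b) \<in> \<sigma>"
    "\<And>b. b \<in> {..<2 * m} - I \<Longrightarrow> \<exists>!a. (a, b) \<in> \<sigma>"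
    using assms(3) by (auto simp: oriented_smoothings_def)
  have I: "I \<subseteq> {..<2 * m}" using assms(1) unfolding boundary_pattern_def by blast
  have fin: "finite I" using I by (rule finite_subset) simp
  have fin\<sigma>: "finite \<sigma>" by (rule finite_subset[OF \<sigma>(1)]) (simp add: fin)
  have bij1: "bij_betw fst \<sigma> I"
  proof (rule bij_betw_imageI)
    show "inj_on fst \<sigma>" unfolding inj_on_def using \<sigma>(1,2) by fastforce
    show "fst ` \<sigma> = I" using \<sigma>(1,2) by force
  qed
  have bij2: "bij_betw snd \<sigma> ({..<2 * m} - I)"
  proof (rule bij_betw_imageI)
    show "inj_on snd \<sigma>" unfolding inj_on_def using \<sigma>(1,3) by fastforce
    show "snd ` \<sigma> = {..<2 * m} - I" using \<sigma>(1,3) by force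
  qed
  have rot: "strand_rotation m \<alpha> =
      of_int (int (snd \<alpha>) - int (fst \<alpha>)) / of_nat (2 * m) - 1 / 2 + (if snd \<alpha> < fst \<alpha> then 1 else 0)"
    if "\<alpha> \<in> \<sigma>" for \<alpha>
  proof -
    obtain a b where \<alpha>: "\<alpha> = (a, b)" by (cases \<alpha>)
    have ab: "a < 2 * m" "b < 2 * m" "a \<noteq> b" using that \<sigma>(1) I \<alpha> by auto
    have *: "(int b - int a) mod (2 * int m) = int b - int a + (if b < a then 2 * int m else 0)"
    proof (cases "b < a")
      case True
      have "(int b - int a) mod (2 * int m) = (int b - int a + 2 * int m) mod (2 * int m)" by simp
      also have "\<dots> = int b - int a + 2 * int m" using ab True by (intro mod_pos_pos_trivial) auto
      finally show ?thesis using True by simp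
    next
      case False
      then show ?thesis using ab by (simp add: mod_pos_pos_trivial)
    qed
    show ?thesis using assms(2) unfolding \<alpha> strand_rotation.simps * by (simp add: field_simps)
  qed
  have "rotation_number m \<sigma> = (\<Sum>\<alpha>\<in>\<sigma>. of_int (int (snd \<alpha>) - int (fst \<alpha>)) / of_nat (2 * m) - 1 / 2 +
      (if snd \<alpha> < fst \<alpha> then 1 else 0))"
    unfolding rotation_number_def using rot by (rule sum.cong[OF HOL.refl])
  also have "\<dots> = of_int ((\<Sum>\<alpha>\<in>\<sigma>. int (snd \<alpha>)) - (\<Sum>\<alpha>\<in>\<sigma>. int (fst \<alpha>))) / of_nat (2 * m)
      - of_nat (card \<sigma>) / 2 + (\<Sum>\<alpha>\<in>\<sigma>. if snd \<alpha> < fst \<alpha> then 1 else 0)"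
    by (simp add: sum.distrib sum_subtractf sum_divide_distrib diff_divide_distrib)
  also have "(\<Sum>\<alpha>\<in>\<sigma>. if snd \<alpha> < fst \<alpha> then 1 else 0) = (of_nat (descents \<sigma>) :: rat)"
  proof -
    have "{\<alpha> \<in> \<sigma>. snd \<alpha> < fst \<alpha>} = {(a, b) \<in> \<sigma>. b < a}" by auto
    then show ?thesis using fin\<sigma> by (simp add: descents_def sum.If_cases Int_def)
  qed
  also have "(\<Sum>\<alpha>\<in>\<sigma>. int (snd \<alpha>)) = (\<Sum>b\<in>{..<2 * m} - I. int b)"
    using sum.reindex_bij_betw[OF bij2, of int] by simp
  also have "(\<Sum>\<alpha>\<in>\<sigma>. int (fst \<alpha>)) = (\<Sum>a\<in>I. int a)"
    using sum.reindex_bij_betw[OF bij1, of int] by simp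
  also have "card \<sigma> = m" using bij_betw_same_card[OF bij1] boundary_pattern_card[OF assms(1,2)] by simp
  finally show ?thesis by (simp add: rotation_offset_def)
qed


section \<open>Counting regions\<close>

context closed_diagram
begin

text \<open>One end per edge, the one where its gravity arrow starts; so these stand for the
  directed edges.\<close>

definition Y :: "'c tend set" where "Y = {e \<in> X. g e}"

definition bd_index :: "'c tend \<Rightarrow> nat" where
  "bd_index = inv_into {..<2 * m} \<beta>"

text \<open>The curve that leaves along the edge of \<open>e\<close> is followed until the next edge starts.  Curves
  that end on the boundary are closed up by proceeding to the boundary point \<open>d\<close> further on.  For
  \<open>d = 1\<close> and \<open>d = -1\<close> (that is, \<open>2 * m - 1\<close>) the cycles are the boundaries of the positive and of
  the negative regions, respectively.\<close>

definition travel :: "nat \<Rightarrow> 'c set \<Rightarrow> 'c tend \<Rightarrow> 'c tend" where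
  "travel d S e = (if mt e \<in> Open then \<beta> ((bd_index (mt e) + d) mod (2 * m)) else partner S (mt e))"

abbreviation travel_rel :: "nat \<Rightarrow> 'c set \<Rightarrow> ('c tend \<times> 'c tend) set" where
  "travel_rel d S \<equiv> equivcl (graph_on Y (travel d S))"

definition num_cycles :: "nat \<Rightarrow> 'c set \<Rightarrow> nat" where
  "num_cycles d S = num_comps Y (graph_on Y (travel d S))"

definition in_ends :: "nat set" where "in_ends = {i. i < 2 * m \<and> g (\<beta> i)}"

lemma finite_Y: "finite Y" using finite_X by (simp add: Y_def)

lemma boundary_pattern: "boundary_pattern m in_ends"
  unfolding boundary_pattern_def in_ends_def using \<beta>_Suc m_pos by auto

lemma bd_index_\<beta>: "i < 2 * m \<Longrightarrow> bd_index (\<beta> i) = i"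
  unfolding bd_index_def using \<beta>_inj by (simp add: inv_into_f_f)

lemma g_\<beta>_add:
  assumes "i < 2 * m"
  shows "g (\<beta> ((i + d) mod (2 * m))) \<longleftrightarrow> (even d \<longleftrightarrow> g (\<beta> i))"
proof (induction d)
  case 0 then show ?case using assms by simp
next
  case (Suc d)
  have "(i + Suc d) mod (2 * m) = ((i + d) mod (2 * m) + 1) mod (2 * m)" by (simp add: mod_Suc_eq)
  then show ?case using \<beta>_Suc[of "(i + d) mod (2 * m)"] m_pos Suc by auto
qed

lemma travel_Y:
  assumes "odd d" "e \<in> Y"
  shows "travel d S e \<in> Y"
proof (cases "mt e \<in> Open")
  case True
  then obtain i where i: "i < 2 * m" "mt e = \<beta> i" by auto
  then have "\<not> g (\<beta> i)" using mate assms(2) unfolding Y_def by force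
  moreover have "\<beta> ((i + d) mod (2 * m)) \<in> X" using m_pos Open_X by simp
  ultimately show ?thesis using i assms(1) g_\<beta>_add[OF i(1), of d] bd_index_\<beta>
    by (simp add: travel_def Y_def)
next
  case False
  then have "mt e \<in> X - Open" "\<not> g (mt e)" using mate assms(2) by (auto simp: Y_def)
  then show ?thesis using False partner[of "mt e" S] by (simp add: travel_def Y_def)
qed

lemma travel_inj:
  assumes "odd d"
  shows "inj_on (travel d S) Y"
proof (rule inj_onI)
  fix e e' assume e: "e \<in> Y" "e' \<in> Y" and eq: "travel d S e = travel d S e'"
  have mtX: "mt e \<in> X" "mt e' \<in> X" using e mate by (auto simp: Y_def)
  have open_image: "\<beta> (k mod (2 * m)) \<in> Open" for k using m_pos by auto
  have "mt e = mt e'"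
  proof (cases "mt e \<in> Open")
    case True
    then have "mt e' \<in> Open" using eq partner(1)[of "mt e'" S] mtX open_image
      by (metis DiffD2 DiffI travel_def)
    with True obtain i j where ij: "i < 2 * m" "mt e = \<beta> i" "j < 2 * m" "mt e' = \<beta> j" by auto
    then have "\<beta> ((i + d) mod (2 * m)) = \<beta> ((j + d) mod (2 * m))"
      using eq True \<open>mt e' \<in> Open\<close> bd_index_\<beta> by (simp add: travel_def)
    then have "(i + d) mod (2 * m) = (j + d) mod (2 * m)" using \<beta>_eq_iff m_pos by simp
    then show ?thesis using mod_add_right_cancel ij by metis
  next
    case False
    then have "mt e' \<notin> Open" using eq partner(1)[of "mt e" S] mtX open_image
      by (metis DiffD2 DiffI travel_def)
    then show ?thesis using False eq partner(2) mtX by (metis DiffI travel_def)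
  qed
  then show "e = e'" using mate e unfolding Y_def by (metis (no_types, lifting) mem_Collect_eq)
qed

text \<open>Gravity enters \<open>x\<close> at the ends 0 and 2 and leaves at 1 and 3, so the
  smoothing only decides which of the two arriving edges continues to which leaving one.\<close>

lemma travel_swapped:
  assumes "odd d" "x \<in> N" "x \<notin> S"
  shows "swapped_maps Y (travel d S) (travel d (insert x S)) (mt (Cr x 0)) (mt (Cr x 2))"
proof
  have c: "Cr x 0 \<in> X" "Cr x 2 \<in> X" using assms by auto
  show "finite Y" by (rule finite_Y)
  show "inj_on (travel d S) Y" by (rule travel_inj[OF assms(1)])
  show "travel d S ` Y \<subseteq> Y" using travel_Y[OF assms(1)] by auto
  show "mt (Cr x 0) \<in> Y" "mt (Cr x 2) \<in> Y" using c mate assms(2) g_Cr by (auto simp: Y_def)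
  show "mt (Cr x 0) \<noteq> mt (Cr x 2)" using c mate by (metis numeral_2_eq_2 tend.inject(1) zero_neq_numeral)
  show "travel d (insert x S) (mt (Cr x 0)) = travel d S (mt (Cr x 2))"
    "travel d (insert x S) (mt (Cr x 2)) = travel d S (mt (Cr x 0))"
    using c mate assms(3) Cr_not_Open by (simp_all add: travel_def smoothing_partner_simps)
  show "travel d (insert x S) e = travel d S e"
    if e: "e \<in> Y" "e \<noteq> mt (Cr x 0)" "e \<noteq> mt (Cr x 2)" for e
  proof -
    have "mt e \<noteq> Cr x i" for i
    proof
      assume *: "mt e = Cr x i"
      then have "i < 4" "\<not> g (Cr x i)" using e(1) mate[of e] by (auto simp: Y_def)
      then have "even i" using g_Cr assms(2) by simp
      then have "i = 0 \<or> i = 2" using \<open>i < 4\<close> by presburger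
      moreover have "e = mt (Cr x i)" using * e(1) mate[of e] by (simp add: Y_def)
      ultimately show False using e by auto
    qed
    then have "partner (insert x S) (mt e) = partner S (mt e)"
    proof (cases "mt e")
      case (Cr y i)
      then have "y \<noteq> x" using \<open>\<And>i. mt e \<noteq> Cr x i\<close> by blast
      then show ?thesis using Cr by simp
    qed (simp add: partner_def)
    then show ?thesis by (simp add: travel_def)
  qed
qed

lemma num_cycles_insert:
  assumes "odd d" "x \<in> N" "x \<notin> S"
  shows "num_cycles d S \<le> Suc (num_cycles d (insert x S))" "num_cycles d (insert x S) \<le> Suc (num_cycles d S)"
proof -
  interpret swapped_maps Y "travel d S" "travel d (insert x S)" "mt (Cr x 0)" "mt (Cr x 2)"
    by (rule travel_swapped[OF assms])
  have "num_cycles d (insert x S) = Suc (num_cycles d S) \<or> num_cycles d S = Suc (num_cycles d (insert x S))"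
    using num_comps_swap unfolding num_cycles_def by blast
  then show "num_cycles d S \<le> Suc (num_cycles d (insert x S))" "num_cycles d (insert x S) \<le> Suc (num_cycles d S)"
    by linarith+
qed

lemma num_cycles_union:
  assumes "odd d" "finite T" "T \<subseteq> N" "S \<inter> T = {}"
  shows "num_cycles d S \<le> num_cycles d (S \<union> T) + card T" "num_cycles d (S \<union> T) \<le> num_cycles d S + card T"
proof -
  have "num_cycles d S \<le> num_cycles d (S \<union> T) + card T \<and> num_cycles d (S \<union> T) \<le> num_cycles d S + card T"
    using assms(2-4)
  proof (induction T rule: finite_induct)
    case (insert x T)
    then have "x \<in> N" "x \<notin> S \<union> T" by auto
    from num_cycles_insert[OF assms(1) this] show ?case using insert by auto
  qed simp
  then show "num_cycles d S \<le> num_cycles d (S \<union> T) + card T" "num_cycles d (S \<union> T) \<le> num_cycles d S + card T"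
    by simp_all
qed

definition edge_start :: "'c tend \<Rightarrow> 'c tend" where
  "edge_start e = (if g e then e else mt e)"

text \<open>Away from the boundary \<open>travel\<close> follows the curves of the state, so each
  curve runs within a single cycle.\<close>

lemma edge_start_travel:
  assumes "odd d" "(a, b) \<in> conn S"
  shows "(edge_start a, edge_start b) \<in> travel_rel d S"
  using assms(2)
proof (rule ec_map)
  fix a b assume "(a, b) \<in> curves S"
  then consider "a \<in> X" "b = mt a" | "a \<in> X - Open" "b = partner S a"
    by (auto simp: curves_def graph_on_def)
  then show "(edge_start a, edge_start b) \<in> travel_rel d S"
  proof cases
    case 1
    then show ?thesis using mate[of a] by (simp add: edge_start_def)
  next
    case 2
    have *: "(mt c, partner S c) \<in> travel_rel d S" if "c \<in> X - Open" "\<not> g c" for c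
    proof -
      have "mt c \<in> Y" "travel d S (mt c) = partner S c" using that mate[of c] by (auto simp: Y_def travel_def)
      then show ?thesis by (intro ec_base) (auto simp: graph_on_def image_iff)
    qed
    show ?thesis
    proof (cases "g a")
      case True
      then show ?thesis using 2 partner[of a S] *[of b] by (auto simp: edge_start_def intro: ec_sym)
    next
      case False
      then show ?thesis using 2 partner[of a S] *[of a] by (auto simp: edge_start_def)
    qed
  qed
qed

lemma strand_travel:
  assumes "odd d" "(a, b) \<in> strands S"
  shows "(\<beta> a, \<beta> ((b + d) mod (2 * m))) \<in> travel_rel d S"
proof -
  have ab: "a < 2 * m" "b < 2 * m" "g (\<beta> a)" "\<not> g (\<beta> b)" "(\<beta> a, \<beta> b) \<in> conn S"
    using assms(2) by (auto simp: strands_def)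
  have "(\<beta> a, mt (\<beta> b)) \<in> travel_rel d S"
    using edge_start_travel[OF assms(1) ab(5)] ab by (simp add: edge_start_def)
  moreover have "\<beta> b \<in> X" using ab Open_X by auto
  then have "mt (\<beta> b) \<in> Y" "travel d S (mt (\<beta> b)) = \<beta> ((b + d) mod (2 * m))"
    using ab mate bd_index_\<beta> by (auto simp: Y_def travel_def)
  then have "(mt (\<beta> b), \<beta> ((b + d) mod (2 * m))) \<in> travel_rel d S"
    by (intro ec_base) (auto simp: graph_on_def image_iff)
  ultimately show ?thesis by (rule ec_trans)
qed

lemma strand_target_in:
  assumes "odd d" "(a, b) \<in> strands S"
  shows "(b + d) mod (2 * m) \<in> in_ends"
  using assms g_\<beta>_add[of b d] m_pos by (auto simp: in_ends_def strands_def)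

text \<open>Without loops every edge lies on a strand, and the start of that strand is an
  in-point.\<close>

lemma reaches_in_index:
  assumes "odd d" "loops S = {}" "e \<in> Y"
  obtains a where "a \<in> in_ends" "(e, \<beta> a) \<in> travel_rel d S"
proof -
  have e: "e \<in> X" "g e" using assms(3) by (auto simp: Y_def)
  then have "component (curves S) e \<inter> Open \<noteq> {}" using assms(2) unfolding loops_def by blast
  then obtain c where c: "c < 2 * m" "(e, \<beta> c) \<in> conn S" by (auto simp: mem_component)
  have ec: "(e, edge_start (\<beta> c)) \<in> travel_rel d S"
    using edge_start_travel[OF assms(1) c(2)] e(2) by (simp add: edge_start_def)
  show ?thesis
  proof (cases "g (\<beta> c)")
    case True
    then show ?thesis using that[of c] ec c by (simp add: edge_start_def in_ends_def)
  next
    case False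
    obtain a where a: "(a, c) \<in> strands S" by (rule strand_in_ex[OF c(1) False])
    have "(\<beta> a, \<beta> c) \<in> conn S" "g (\<beta> a)" "a < 2 * m" using a by (auto simp: strands_def)
    then have "(\<beta> a, edge_start (\<beta> c)) \<in> travel_rel d S"
      using edge_start_travel[OF assms(1)] by (metis edge_start_def)
    then have "(e, \<beta> a) \<in> travel_rel d S" using ec ec_sym ec_trans by metis
    then show ?thesis using that \<open>g (\<beta> a)\<close> \<open>a < 2 * m\<close> by (simp add: in_ends_def)
  qed
qed

text \<open>Strands after which the step to the next boundary point does not lead above the start.
  These are the strands with \<open>b < a\<close> and, as the step from the last point wraps around
  to 0, a strand ending at \<open>2 * m - 1\<close>; \<open>downs\<close> is the mirror
  image.\<close>

definition ups :: "'c set \<Rightarrow> smoothing" where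
  "ups S = {(a, b) \<in> strands S. (b + 1) mod (2 * m) \<le> a}"

definition downs :: "'c set \<Rightarrow> smoothing" where
  "downs S = {(a, b) \<in> strands S. a \<le> (b + (2 * m - 1)) mod (2 * m)}"

lemma odd_minus_one: "odd (2 * m - 1)" using m_pos by simp

text \<open>The strand from the largest in-point of a cycle leads, after the step along the
  boundary, to an in-point of the same cycle, which cannot be larger. For \<open>downs\<close> the
  smallest in-point is taken.\<close>

lemma cycle_has_up:
  assumes "loops S = {}" "e \<in> Y"
  obtains a b where "(a, b) \<in> ups S" "(e, \<beta> a) \<in> travel_rel 1 S"
proof -
  let ?A = "{a \<in> in_ends. (e, \<beta> a) \<in> travel_rel 1 S}"
  have fin: "finite ?A" by (simp add: in_ends_def)
  have "?A \<noteq> {}" using reaches_in_index[OF _ assms, of 1] by auto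
  define a where "a = Max ?A"
  have a: "a \<in> ?A" unfolding a_def by (rule Max_in[OF fin \<open>?A \<noteq> {}\<close>])
  then obtain b where b: "(a, b) \<in> strands S" using strand_out_ex[of a S] by (auto simp: in_ends_def)
  have "(b + 1) mod (2 * m) \<in> ?A"
    using strand_target_in[OF _ b, of 1] strand_travel[OF _ b, of 1] a by (auto intro: ec_trans)
  then have "(b + 1) mod (2 * m) \<le> a" unfolding a_def by (rule Max_ge[OF fin])
  then show ?thesis using that[of a b] a b by (simp add: ups_def)
qed

lemma cycle_has_down:
  assumes "loops S = {}" "e \<in> Y"
  obtains a b where "(a, b) \<in> downs S" "(e, \<beta> a) \<in> travel_rel (2 * m - 1) S"
proof -
  let ?d = "2 * m - 1"
  let ?A = "{a \<in> in_ends. (e, \<beta> a) \<in> travel_rel ?d S}"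
  have fin: "finite ?A" by (simp add: in_ends_def)
  have "?A \<noteq> {}" using reaches_in_index[OF odd_minus_one assms] by blast
  define a where "a = Min ?A"
  have a: "a \<in> ?A" unfolding a_def by (rule Min_in[OF fin \<open>?A \<noteq> {}\<close>])
  then obtain b where b: "(a, b) \<in> strands S" using strand_out_ex[of a S] by (auto simp: in_ends_def)
  have "(b + ?d) mod (2 * m) \<in> ?A"
    using strand_target_in[OF odd_minus_one b] strand_travel[OF odd_minus_one b] a by (auto intro: ec_trans)
  then have "a \<le> (b + ?d) mod (2 * m)" unfolding a_def by (rule Min_le[OF fin])
  then show ?thesis using that[of a b] a b by (simp add: downs_def)
qed

text \<open>Sending a strand of \<open>Q\<close> to its cycle is onto by \<open>cover\<close>; if
  the numbers agree, it is also injective, so every cycle contains exactly one strand of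
  \<open>Q\<close>.\<close>

lemma num_cycles_le_card:
  assumes Q: "Q \<subseteq> strands S"
    and cover: "\<And>e. e \<in> Y \<Longrightarrow> \<exists>a b. (a, b) \<in> Q \<and> (e, \<beta> a) \<in> travel_rel d S"
  shows "num_cycles d S \<le> card Q"
    and "num_cycles d S = card Q \<Longrightarrow> (a, b) \<in> Q \<Longrightarrow> (a', b') \<in> Q \<Longrightarrow>
      (\<beta> a, \<beta> a') \<in> travel_rel d S \<Longrightarrow> a = a'"
proof -
  have fin: "finite Q" using Q finite_strands by (rule finite_subset)
  let ?c = "\<lambda>(a, b). component (graph_on Y (travel d S)) (\<beta> a)"
  have Y: "\<beta> a \<in> Y" if "(a, b) \<in> Q" for a b
    using that Q Open_X by (auto simp: Y_def strands_def)
  have img: "component (graph_on Y (travel d S)) ` Y = ?c ` Q"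
  proof (intro equalityI subsetI)
    fix c assume "c \<in> component (graph_on Y (travel d S)) ` Y"
    then obtain e where e: "e \<in> Y" "c = component (graph_on Y (travel d S)) e" by auto
    with cover obtain a b where "(a, b) \<in> Q" "(e, \<beta> a) \<in> travel_rel d S" by blast
    then have "c = ?c (a, b)" using e component_eq_iff[of "graph_on Y (travel d S)" e "\<beta> a"] by simp
    with \<open>(a, b) \<in> Q\<close> show "c \<in> ?c ` Q" by blast
  next
    fix c assume "c \<in> ?c ` Q"
    then show "c \<in> component (graph_on Y (travel d S)) ` Y" using Y by auto
  qed
  show "num_cycles d S \<le> card Q"
    unfolding num_cycles_def num_comps_def img by (rule card_image_le[OF fin])
  assume "num_cycles d S = card Q"
  then have "inj_on ?c Q"
    unfolding num_cycles_def num_comps_def img using fin by (simp add: eq_card_imp_inj_on)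
  moreover assume "(a, b) \<in> Q" "(a', b') \<in> Q" "(\<beta> a, \<beta> a') \<in> travel_rel d S"
  ultimately show "a = a'"
    using component_eq_iff[of "graph_on Y (travel d S)" "\<beta> a" "\<beta> a'"] inj_onD[of ?c Q "(a, b)" "(a', b')"]
    by auto
qed

lemma strands_bij:
  "bij_betw fst (strands S) in_ends" "bij_betw snd (strands S) ({..<2 * m} - in_ends)"
proof -
  show "bij_betw fst (strands S) in_ends"
  proof (rule bij_betw_imageI)
    show "inj_on fst (strands S)" by (rule inj_onI) (metis prod.collapse strands_unique)
    show "fst ` strands S = in_ends"
    proof (intro equalityI subsetI)
      fix a assume "a \<in> in_ends"
      then obtain b where "(a, b) \<in> strands S" using strand_out_ex unfolding in_ends_def by blast
      then show "a \<in> fst ` strands S" by force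
    qed (auto simp: in_ends_def strands_def)
  qed
  show "bij_betw snd (strands S) ({..<2 * m} - in_ends)"
  proof (rule bij_betw_imageI)
    show "inj_on snd (strands S)" by (rule inj_onI) (metis prod.collapse strands_unique)
    show "snd ` strands S = {..<2 * m} - in_ends"
    proof (intro equalityI subsetI)
      fix b assume "b \<in> {..<2 * m} - in_ends"
      then obtain a where "(a, b) \<in> strands S" using strand_in_ex unfolding in_ends_def by blast
      then show "b \<in> snd ` strands S" by force
    qed (auto simp: in_ends_def strands_def)
  qed
qed

lemma card_strands: "card (strands S) = m"
  using bij_betw_same_card[OF strands_bij(1)] boundary_pattern_card[OF boundary_pattern m_pos] by simp

lemma strands_neq: "(a, b) \<in> strands S \<Longrightarrow> a \<noteq> b"
  by (auto simp: strands_def)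

lemma strands_less: "(a, b) \<in> strands S \<Longrightarrow> a < 2 * m \<and> b < 2 * m"
  by (auto simp: strands_def)

lemma pred_mod: "b < 2 * m \<Longrightarrow> (b + (2 * m - 1)) mod (2 * m) = (if b = 0 then 2 * m - 1 else b - 1)"
proof -
  assume b: "b < 2 * m"
  show ?thesis
  proof (cases "b = 0")
    case False
    then have "b + (2 * m - 1) = (b - 1) + 2 * m" using b by simp
    then have "(b + (2 * m - 1)) mod (2 * m) = (b - 1) mod (2 * m)" by (metis mod_add_self2)
    then show ?thesis using b False by simp
  qed (use b in simp)
qed

lemma card_strands_snd:
  assumes "i < 2 * m"
  shows "card {(a, b) \<in> strands S. b = i} = (if g (\<beta> i) then 0 else 1)"
proof (cases "g (\<beta> i)")
  case True
  then have "{(a, b) \<in> strands S. b = i} = {}" by (auto simp: strands_def)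
  then show ?thesis using True by (metis card.empty)
next
  case False
  then obtain a where "(a, i) \<in> strands S" using assms strand_in_ex by blast
  then have "{(a, b) \<in> strands S. b = i} = {(a, i)}" using strands_unique by blast
  then show ?thesis using False by simp
qed

lemma card_ups: "card (ups S) = descents (strands S) + (if g (\<beta> (2 * m - 1)) then 0 else 1)"
proof -
  have "ups S = {(a, b) \<in> strands S. b < a} \<union> {(a, b) \<in> strands S. b = 2 * m - 1}"
  proof (intro equalityI subrelI)
    fix a b assume ab: "(a, b) \<in> ups S"
    then have "a < 2 * m" "b < 2 * m" "(b + 1) mod (2 * m) \<le> a" "(a, b) \<in> strands S"
      using strands_less by (auto simp: ups_def)
    then show "(a, b) \<in> {(a, b) \<in> strands S. b < a} \<union> {(a, b) \<in> strands S. b = 2 * m - 1}"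
      by (cases "b = 2 * m - 1") auto
  next
    fix a b assume "(a, b) \<in> {(a, b) \<in> strands S. b < a} \<union> {(a, b) \<in> strands S. b = 2 * m - 1}"
    then have "(a, b) \<in> strands S" "b < a \<or> b = 2 * m - 1" "a < 2 * m" using strands_less by auto
    then show "(a, b) \<in> ups S" using m_pos by (auto simp: ups_def)
  qed
  moreover have "{(a, b) \<in> strands S. b < a} \<inter> {(a, b) \<in> strands S. b = 2 * m - 1} = {}"
    using strands_less by fastforce
  moreover have "finite {(a, b) \<in> strands S. b < a}" "finite {(a, b) \<in> strands S. b = 2 * m - 1}"
    by (rule finite_subset[OF _ finite_strands[of S]]; auto)+
  ultimately show ?thesis
    using card_strands_snd[of "2 * m - 1" S] m_pos by (simp add: card_Un_disjoint descents_def)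
qed

lemma card_downs: "card (downs S) = m - descents (strands S) + (if g (\<beta> 0) then 0 else 1)"
proof -
  have "downs S = {(a, b) \<in> strands S. a < b} \<union> {(a, b) \<in> strands S. b = 0}"
  proof (intro equalityI subrelI)
    fix a b assume ab: "(a, b) \<in> downs S"
    then have "a < 2 * m" "b < 2 * m" "a \<le> (b + (2 * m - 1)) mod (2 * m)" "(a, b) \<in> strands S"
      using strands_less by (auto simp: downs_def)
    then show "(a, b) \<in> {(a, b) \<in> strands S. a < b} \<union> {(a, b) \<in> strands S. b = 0}"
      using pred_mod[of b] by (cases "b = 0") auto
  next
    fix a b assume "(a, b) \<in> {(a, b) \<in> strands S. a < b} \<union> {(a, b) \<in> strands S. b = 0}"
    then have "(a, b) \<in> strands S" "a < b \<or> b = 0" "a < 2 * m" "b < 2 * m" using strands_less by auto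
    then show "(a, b) \<in> downs S" using pred_mod[of b] by (auto simp: downs_def)
  qed
  moreover have "{(a, b) \<in> strands S. a < b} \<inter> {(a, b) \<in> strands S. b = 0} = {}" by auto
  moreover have fin: "finite {(a, b) \<in> strands S. a < b}" "finite {(a, b) \<in> strands S. b = 0}"
    "finite {(a, b) \<in> strands S. b < a}"
    by (rule finite_subset[OF _ finite_strands[of S]]; auto)+
  moreover have "card {(a, b) \<in> strands S. a < b} = m - descents (strands S)"
  proof -
    have "strands S = {(a, b) \<in> strands S. a < b} \<union> {(a, b) \<in> strands S. b < a}"
      using strands_neq by fastforce
    then have "card (strands S) = card ({(a, b) \<in> strands S. a < b} \<union> {(a, b) \<in> strands S. b < a})" by simp
    also have "\<dots> = card {(a, b) \<in> strands S. a < b} + card {(a, b) \<in> strands S. b < a}"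
      using fin by (intro card_Un_disjoint) auto
    finally show ?thesis using card_strands by (simp add: descents_def)
  qed
  ultimately show ?thesis
    using card_strands_snd[of 0 S] m_pos by (simp add: card_Un_disjoint)
qed

lemma descents_le: "descents (strands S) \<le> m"
proof -
  have "descents (strands S) \<le> card (strands S)"
    unfolding descents_def by (rule card_mono[OF finite_strands]) auto
  then show ?thesis by (simp add: card_strands)
qed

text \<open>Exactly one of the points 0 and \<open>2 * m - 1\<close> is an out-point. Its strand is
  counted twice, the others once.\<close>

lemma card_ups_downs: "card (ups S) + card (downs S) = m + 1"
proof -
  have "g (\<beta> 0) \<longleftrightarrow> \<not> g (\<beta> (2 * m - 1))" using \<beta>_Suc[of "2 * m - 1"] m_pos by simp
  then show ?thesis using card_ups[of S] card_downs[of S] descents_le[of S] by auto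
qed

end

text \<open>Collapsing the boundary to a vertex, the two terms on the right count the positive and the
  negative faces, so \<open>euler\<close> is one half of Euler's formula.\<close>

locale planar_closed_diagram = closed_diagram D g curl m \<beta>
  for D :: "'c diagram" and g curl m \<beta> +
  assumes euler: "card N + m + 1 \<le> num_cycles 1 N + num_cycles (2 * m - 1) {}"
begin

text \<open>Passing from \<open>S\<close> to \<open>N\<close> gains at most
  \<open>card N - card S\<close> positive cycles, and passing from \<open>{}\<close> to
  \<open>S\<close> loses at most \<open>card S\<close> negative ones. With \<open>euler\<close>, at
  least \<open>m + 1 = card (ups S) + card (downs S)\<close> cycles remain at \<open>S\<close>, so
  every inequality involved is an equality.\<close>

lemma loopless_cycles:
  assumes S: "S \<subseteq> N" and "loops S = {}"
  shows "num_cycles 1 S = card (ups S)" "num_cycles (2 * m - 1) S = card (downs S)"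
    and "num_cycles 1 N + card S = card N + card (ups S)"
proof -
  have fin: "finite S" using S finite_N by (rule finite_subset)
  have 1: "num_cycles 1 S \<le> card (ups S)"
    by (rule num_cycles_le_card) (use cycle_has_up[OF assms(2)] in \<open>auto simp: ups_def, metis\<close>)
  have 2: "num_cycles (2 * m - 1) S \<le> card (downs S)"
    by (rule num_cycles_le_card) (use cycle_has_down[OF assms(2)] in \<open>auto simp: downs_def, metis\<close>)
  have 3: "num_cycles 1 (S \<union> (N - S)) \<le> num_cycles 1 S + card (N - S)"
    using num_cycles_union[of 1 "N - S" S] finite_N by auto
  have 4: "num_cycles (2 * m - 1) {} \<le> num_cycles (2 * m - 1) ({} \<union> S) + card S"
    using num_cycles_union[OF odd_minus_one fin S, of "{}"] by auto
  have "S \<union> (N - S) = N" using S by auto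
  moreover have "card (N - S) + card S = card N"
    using S fin finite_N card_mono[OF finite_N S] by (simp add: card_Diff_subset)
  ultimately show "num_cycles 1 S = card (ups S)" "num_cycles (2 * m - 1) S = card (downs S)"
    "num_cycles 1 N + card S = card N + card (ups S)"
    using 1 2 3 4 euler card_ups_downs[of S] by simp_all
qed

lemma up_unique:
  assumes "S \<subseteq> N" "loops S = {}"
    and "(a, b) \<in> ups S" "(a', b') \<in> ups S" "(\<beta> a, \<beta> a') \<in> travel_rel 1 S"
  shows "a = a'"
proof (rule num_cycles_le_card(2)[of "ups S" S 1])
  show "\<exists>a b. (a, b) \<in> ups S \<and> (e, \<beta> a) \<in> travel_rel 1 S" if "e \<in> Y" for e
    using cycle_has_up[OF assms(2) that] by metis
qed (use assms loopless_cycles in \<open>auto simp: ups_def\<close>)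

lemma down_unique:
  assumes "S \<subseteq> N" "loops S = {}"
    and "(a, b) \<in> downs S" "(a', b') \<in> downs S" "(\<beta> a, \<beta> a') \<in> travel_rel (2 * m - 1) S"
  shows "a = a'"
proof (rule num_cycles_le_card(2)[of "downs S" S "2 * m - 1"])
  show "\<exists>a b. (a, b) \<in> downs S \<and> (e, \<beta> a) \<in> travel_rel (2 * m - 1) S" if "e \<in> Y" for e
    using cycle_has_down[OF assms(2) that] by metis
qed (use assms loopless_cycles in \<open>auto simp: downs_def\<close>)

text \<open>A strand directed upwards cuts off a negative region, whose boundary cycle descends from the
  strand's end to its start along strands that are directed downwards, and vice versa.  So the part
  cut off by a strand is divided into parts cut off by shorter strands.\<close>

lemma no_crossing_strands:
  assumes S: "S \<subseteq> N" "loops S = {}"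
    and "(a, b) \<in> strands S" "min a b < p" "p < max a b" "(p, p') \<in> strands S \<or> (p', p) \<in> strands S"
  shows "min a b < p' \<and> p' < max a b"
  using assms(3-6)
\<comment> \<open>Induction on the length of the strand; the other strands of the boundary cycle are
  shorter.\<close>
proof (induction "max a b - min a b" arbitrary: a b p p' rule: less_induct)
  case less
  note IHouter = less.hyps and pp' = less.prems(4)
  have partner_unique: "q' = y" if "(x, y) \<in> strands S" "(x, q') \<in> strands S \<or> (q', x) \<in> strands S" for x y q'
    using that strands_unique[of x y S x q'] by (auto simp: strands_def)
  have partner_unique': "q' = x" if "(x, y) \<in> strands S" "(y, q') \<in> strands S \<or> (q', y) \<in> strands S" for x y q'
    using that strands_unique[of x y S q' y] by (auto simp: strands_def)
  have ab: "a < 2 * m" "b < 2 * m" "a \<noteq> b" "a \<in> in_ends"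
    using less.prems(1) by (auto simp: strands_def in_ends_def)
  consider "a < b" | "b < a" using ab by linarith
  then show ?case
  proof cases
    case 1
    let ?d = "2 * m - 1"
    let ?\<gamma> = "\<lambda>y. (\<beta> a, \<beta> y) \<in> travel_rel ?d S"
    have a_down: "(a, b) \<in> downs S" using less.prems(1) 1 ab pred_mod[of b] by (auto simp: downs_def)
    \<comment> \<open>The strand from \<open>a\<close> is the only one of its negative cycle in
      \<open>downs\<close>. Every other strand of the cycle therefore ends at \<open>w + 1\<close>
      for some \<open>w < y\<close>, and the cycle continues at \<open>w\<close>, lower
      down.\<close>
    have next_down: "\<exists>z w. (y, z) \<in> strands S \<and> w \<in> in_ends \<and> ?\<gamma> w \<and> w < y \<and> z = w + 1"
      if y: "y \<in> in_ends" "?\<gamma> y" "y \<noteq> a" for y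
    proof -
      obtain z where z: "(y, z) \<in> strands S" using strand_out_ex[of y S] y by (auto simp: in_ends_def)
      have "(y, z) \<notin> downs S" using down_unique[OF S a_down _ y(2)] y(3) by blast
      then have w: "(z + ?d) mod (2 * m) < y" using z by (auto simp: downs_def)
      have "?\<gamma> ((z + ?d) mod (2 * m))" using strand_travel[OF odd_minus_one z] y(2) ec_trans by metis
      moreover have "z = (z + ?d) mod (2 * m) + 1"
        using w pred_mod[of z] strands_less[OF z] by (auto split: if_splits)
      ultimately show ?thesis using z w strand_target_in[OF odd_minus_one z] by blast
    qed
    have above: "a \<le> y" if "y \<in> in_ends" "?\<gamma> y" for y
      using that
    proof (induction y rule: less_induct)
      case (less y)
      show ?case
      proof (cases "y = a")
        case False
        then show ?thesis using next_down[OF less.prems] less.IH by (meson le_trans less_imp_le)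
      qed simp
    qed
    \<comment> \<open>The walk descends from \<open>b - 1\<close> to \<open>a\<close>, jumping from
      \<open>y\<close> to \<open>z\<close> and stepping on to \<open>w = z - 1\<close>. This leaves
      no gap, so \<open>p\<close> is an end of one of these strands or lies inside one.\<close>
    have "a < p' \<and> p' < b"
      if "y \<in> in_ends" "?\<gamma> y" "y < b" "a < p" "p \<le> y" for y
      using that
    proof (induction y rule: less_induct)
      case (less y)
      have "y \<noteq> a" using less.prems by auto
      then obtain z w where zw: "(y, z) \<in> strands S" "w \<in> in_ends" "?\<gamma> w" "w < y" "z = w + 1"
        using next_down less.prems by metis
      have "a \<le> w" using above zw by blast
      have "z \<noteq> y" using strands_neq[OF zw(1)] by simp
      then have z: "a < z" "z < y" using zw \<open>a \<le> w\<close> by auto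
      consider "p = y" | "z < p" "p < y" | "p = z" | "p < z" using less.prems by linarith
      then show ?case
      proof cases
        case 1
        then have "p' = z" using partner_unique[OF zw(1)] pp' by blast
        then show ?thesis using z less.prems by simp
      next
        case 2
        have "min y z < p' \<and> p' < max y z"
          by (rule IHouter[OF _ zw(1) _ _ pp'])
            (use 2 z less.prems in auto)
        then show ?thesis using z less.prems by auto
      next
        case 3
        then have "p' = y" using partner_unique'[OF zw(1)] pp' by blast
        then show ?thesis using z less.prems by simp
      next
        case 4
        then show ?thesis using less.IH[of w] zw less.prems by auto
      qed
    qed
    moreover have "(b + ?d) mod (2 * m) = b - 1" using 1 ab pred_mod[of b] by auto
    then have "b - 1 \<in> in_ends" "?\<gamma> (b - 1)"
      using strand_target_in[OF odd_minus_one less.prems(1)] strand_travel[OF odd_minus_one less.prems(1)] by auto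
    ultimately show ?thesis using less.prems 1 by auto
  next
    case 2
    \<comment> \<open>The mirrored case: the positive cycle of \<open>a\<close> ascends from
      \<open>b + 1\<close> to \<open>a\<close>, so that \<open>2 * m - y\<close> decreases.\<close>
    let ?\<alpha> = "\<lambda>y. (\<beta> a, \<beta> y) \<in> travel_rel 1 S"
    have odd1: "odd (1 :: nat)" by simp
    have a_up: "(a, b) \<in> ups S" using less.prems(1) 2 ab by (auto simp: ups_def)
    have next_up: "\<exists>z w. (y, z) \<in> strands S \<and> w \<in> in_ends \<and> ?\<alpha> w \<and> y < w \<and> w = z + 1"
      if y: "y \<in> in_ends" "?\<alpha> y" "y \<noteq> a" for y
    proof -
      obtain z where z: "(y, z) \<in> strands S" using strand_out_ex[of y S] y by (auto simp: in_ends_def)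
      have "(y, z) \<notin> ups S" using up_unique[OF S a_up _ y(2)] y(3) by blast
      then have w: "y < (z + 1) mod (2 * m)" using z by (auto simp: ups_def)
      have "?\<alpha> ((z + 1) mod (2 * m))" using strand_travel[OF odd1 z] y(2) ec_trans by metis
      moreover have "(z + 1) mod (2 * m) = z + 1"
        using w strands_less[OF z] by (cases "z + 1 = 2 * m") auto
      ultimately show ?thesis using z w strand_target_in[OF odd1 z] by metis
    qed
    have below: "y \<le> a" if "y \<in> in_ends" "?\<alpha> y" for y
      using that
    proof (induction "2 * m - y" arbitrary: y rule: less_induct)
      case (less y)
      show ?case
      proof (cases "y = a")
        case False
        then obtain z w where w: "w \<in> in_ends" "?\<alpha> w" "y < w" using next_up[OF less.prems] by metis
        then have "w \<le> a" using less.hyps[of w] by (auto simp: in_ends_def)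
        then show ?thesis using w by simp
      qed simp
    qed
    have "b < p' \<and> p' < a"
      if "y \<in> in_ends" "?\<alpha> y" "b < y" "p < a" "y \<le> p" for y
      using that
    proof (induction "2 * m - y" arbitrary: y rule: less_induct)
      case (less y)
      have "y \<noteq> a" using less.prems by auto
      then obtain z w where zw: "(y, z) \<in> strands S" "w \<in> in_ends" "?\<alpha> w" "y < w" "w = z + 1"
        using next_up less.prems by metis
      have "w \<le> a" using below zw by blast
      have "z \<noteq> y" using strands_neq[OF zw(1)] by simp
      then have z: "z < a" "y < z" using zw \<open>w \<le> a\<close> by auto
      consider "p = y" | "p < z" "y < p" | "p = z" | "z < p" using less.prems by linarith
      then show ?case
      proof cases
        case 1
        then have "p' = z" using partner_unique[OF zw(1)] pp' by blast
        then show ?thesis using z less.prems by simp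
      next
        case 2
        have "min y z < p' \<and> p' < max y z"
          by (rule IHouter[OF _ zw(1) _ _ pp'])
            (use 2 z less.prems in auto)
        then show ?thesis using z less.prems by auto
      next
        case 3
        then have "p' = y" using partner_unique'[OF zw(1)] pp' by blast
        then show ?thesis using z less.prems by simp
      next
        case 4
        then show ?thesis using less.hyps[of w] zw less.prems by (auto simp: in_ends_def)
      qed
    qed
    moreover have "(b + 1) mod (2 * m) = b + 1" using 2 ab by auto
    then have "b + 1 \<in> in_ends" "?\<alpha> (b + 1)"
      using strand_target_in[OF odd1 less.prems(1)] strand_travel[OF odd1 less.prems(1)] by auto
    ultimately show ?thesis using less.prems 2 by auto
  qed
qed

lemma strands_oriented_smoothing:
  assumes "S \<subseteq> N" "loops S = {}"
  shows "strands S \<in> oriented_smoothings m in_ends"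
  unfolding oriented_smoothings_def
proof (intro CollectI conjI ballI impI)
  show "strands S \<subseteq> in_ends \<times> ({..<2 * m} - in_ends)"
    by (auto simp: strands_def in_ends_def)
  show "\<exists>!b. (a, b) \<in> strands S" if "a \<in> in_ends" for a
    using that strand_out_ex[of a S] strands_unique unfolding in_ends_def by (metis (no_types, lifting) mem_Collect_eq)
  show "\<exists>!a. (a, b) \<in> strands S" if "b \<in> {..<2 * m} - in_ends" for b
    using that strand_in_ex[of b S] strands_unique unfolding in_ends_def
    by (metis (no_types, lifting) Diff_iff lessThan_iff mem_Collect_eq)
  show "\<not> interlaced \<alpha> \<beta>" if "\<alpha> \<in> strands S" "\<beta> \<in> strands S" for \<alpha> \<beta>
  proof -
    obtain a b c d where "\<alpha> = (a, b)" "\<beta> = (c, d)" by (metis surj_pair)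
    then show ?thesis using that no_crossing_strands[OF assms, of a b c d] no_crossing_strands[OF assms, of a b d c]
      by auto
  qed
qed

text \<open>For the skein weights of the diagram this is the oriented Jones polynomial; the same
  \<open>w\<close> serves for its closures, since a curl changes only \<open>strands\<close> and
  \<open>loops\<close>.\<close>

definition state_element :: "('c set \<Rightarrow> laurent) \<Rightarrow> (smoothing \<Rightarrow>\<^sub>0 laurent)" where
  "state_element w = (\<Sum>S\<in>Pow N.
     Poly_Mapping.single (strands S) (w S * loop_value ^ card (loops S)))"

lemma lookup_state_element:
  assumes "\<And>S. S \<subseteq> N \<Longrightarrow> w S = c * (- q_pow 1) ^ card S"
  shows "Poly_Mapping.lookup (state_element w) \<sigma> =
     c * (\<Sum>S\<in>{S \<in> Pow N. strands S = \<sigma>}. state_weight S)"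
  unfolding state_element_def sum_distrib_left
  using assms finite_N
  by (simp add: lookup_sum_single state_weight_def mult.assoc)

text \<open>The constant by which \<open>card S\<close> exceeds the number of descents of a loopless
  state, obtained by solving \<open>loopless_cycles\<close> and \<open>card_ups\<close> for
  \<open>card S\<close>.\<close>

definition cycle_defect :: int where
  "cycle_defect = int (card N) - int (num_cycles 1 N) +
     (if g (\<beta> (2 * m - 1)) then 0 else 1)"

lemma card_loopless:
  assumes "S \<subseteq> N" "loops S = {}"
  shows "int (card S) = int (descents (strands S)) + cycle_defect"
  using loopless_cycles(3)[OF assms] card_ups[of S] by (auto simp: cycle_defect_def)

lemma lookup_state_sum_sign_coherent:
  assumes "z = int (descents \<sigma>) + cycle_defect"
  shows "sign_coherent z z (\<Sum>S\<in>{S \<in> Pow N. strands S = \<sigma>}. state_weight S)"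
  by (rule sign_coherent_state_sum)
    (use assms card_loopless sign_coherent_single in \<open>auto simp: minus_q_power\<close>)

text \<open>No loopless state has such strands, so the condition on the leaves holds vacuously for
  every \<open>u\<close> and \<open>v\<close>, and a polynomial that is sign coherent for two
  opposite sign patterns vanishes. States with loops are thus covered without examining their
  strands.\<close>

lemma state_sum_eq_0:
  assumes "\<sigma> \<notin> oriented_smoothings m in_ends"
  shows "(\<Sum>S\<in>{S \<in> Pow N. strands S = \<sigma>}. state_weight S) = 0" (is "?A = 0")
proof -
  have coherent: "sign_coherent u 0 ?A" for u
    by (rule sign_coherent_state_sum) (use assms strands_oriented_smoothing in blast)
  have "Poly_Mapping.lookup ?A w = 0" for w
  proof (rule ccontr)
    assume "Poly_Mapping.lookup ?A w \<noteq> 0"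
    moreover from this have "0 \<le> neg_one_pow (0 + w div 2) * Poly_Mapping.lookup ?A w"
      "0 \<le> neg_one_pow (1 + w div 2) * Poly_Mapping.lookup ?A w"
      using coherent[of 0] coherent[of 1] by (auto simp: sign_coherent_def)
    ultimately show False by (simp add: neg_one_pow_def split: if_splits)
  qed
  then show ?thesis by (intro poly_mapping_eqI) simp
qed

theorem alternating_state_element:
  assumes w: "\<And>S. S \<subseteq> N \<Longrightarrow> w S = Poly_Mapping.single e (neg_one_pow s) * (- q_pow 1) ^ card S"
  shows "alternating_element m in_ends (state_element w)"
proof -
  let ?P = "state_element w" and ?I = in_ends
  let ?R = "rotation_offset m ?I"
  have coherent: "sign_coherent (int (descents \<sigma>) + cycle_defect + s) (int (descents \<sigma>) + cycle_defect + e)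
      (Poly_Mapping.lookup ?P \<sigma>)" for \<sigma>
  proof -
    have "Poly_Mapping.lookup ?P \<sigma> = Poly_Mapping.single e (neg_one_pow s) *
        (\<Sum>S\<in>{S \<in> Pow N. strands S = \<sigma>}. state_weight S)"
      by (rule lookup_state_element) (rule w)
    then show ?thesis
      using sign_coherent_mult_single[OF lookup_state_sum_sign_coherent[OF HOL.refl]] by simp
  qed
  have "?P \<in> smoothing_module m ?I"
    unfolding smoothing_module_def
  proof (intro CollectI subsetI)
    fix \<sigma> assume "\<sigma> \<in> Poly_Mapping.keys ?P"
    then have "Poly_Mapping.lookup ?P \<sigma> \<noteq> 0" by (simp add: in_keys_iff)
    then show "\<sigma> \<in> oriented_smoothings m ?I"
      using state_sum_eq_0[of \<sigma>] lookup_state_element[of w, OF w] by fastforce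
  qed
  moreover have "\<forall>\<sigma>\<in>oriented_smoothings m ?I. alternating_poly (Poly_Mapping.lookup ?P \<sigma>)"
    using sign_coherent_imp_same_parity[OF coherent] by blast
  moreover have "\<exists>c\<^sub>1 c\<^sub>2 :: rat. 2 * c\<^sub>1 \<in> \<int> \<and> 2 * c\<^sub>2 \<in> \<int> \<and>
      (\<forall>\<sigma>\<in>oriented_smoothings m ?I. \<exists>u v :: int.
         of_int u = rotation_number m \<sigma> + c\<^sub>1 \<and> of_int v = rotation_number m \<sigma> + c\<^sub>2 \<and>
         same_parity (Poly_Mapping.lookup ?P \<sigma>) (Poly_Mapping.single v (neg_one_pow u)))"
  \<comment> \<open>The constants replace the pattern part \<open>?R\<close> of the rotation number
    by \<open>cycle_defect\<close> and the exponents of the monomial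
    \<open>(-1)^s q^e\<close>.\<close>
  proof (rule exI[of _ "of_int (cycle_defect + s) - ?R"], rule exI[of _ "of_int (cycle_defect + e) - ?R"],
      intro conjI ballI)
    have "2 * (of_int z - ?R) = of_int (2 * z) - 2 * ?R" for z by simp
    then show "2 * (of_int (cycle_defect + s) - ?R) \<in> \<int>" "2 * (of_int (cycle_defect + e) - ?R) \<in> \<int>"
      using rotation_offset_half_integer[OF boundary_pattern m_pos] by (metis Ints_diff Ints_of_int)+
    fix \<sigma> assume "\<sigma> \<in> oriented_smoothings m ?I"
    then have "rotation_number m \<sigma> = of_nat (descents \<sigma>) + ?R"
      by (rule rotation_number_eq[OF boundary_pattern m_pos])
    then show "\<exists>u v :: int. of_int u = rotation_number m \<sigma> + (of_int (cycle_defect + s) - ?R) \<and>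
        of_int v = rotation_number m \<sigma> + (of_int (cycle_defect + e) - ?R) \<and>
        same_parity (Poly_Mapping.lookup ?P \<sigma>) (Poly_Mapping.single v (neg_one_pow u))"
      using sign_coherent_imp_same_parity[OF coherent[of \<sigma>]]
      by (intro exI[of _ "int (descents \<sigma>) + cycle_defect + s"] exI[of _ "int (descents \<sigma>) + cycle_defect + e"])
        simp
  qed
  ultimately show ?thesis unfolding alternating_element_def by blast
qed

end

section \<open>Adding a curl\<close>

lemma bij_betw_rotation:
  fixes c n :: nat
  assumes "0 < n"
  shows "bij_betw (\<lambda>t. (c + t) mod n) {..<n} {..<n}"
proof -
  have "inj_on (\<lambda>t. (c + t) mod n) {..<n}"
    by (rule inj_onI) (metis add.commute lessThan_iff mod_add_right_cancel)
  moreover have "(\<lambda>t. (c + t) mod n) ` {..<n} \<subseteq> {..<n}" using assms by auto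
  ultimately show ?thesis by (simp add: bij_betw_def endo_inj_surj)
qed

locale curled_diagram = planar_closed_diagram D g curl m \<beta>
  for D :: "'c diagram" and g curl m \<beta> +
  fixes j :: nat and \<phi> :: "nat \<Rightarrow> nat" and s :: nat
  assumes m2: "2 \<le> m" and j: "j < 2 * m"
    and \<phi>: "\<And>i. i < 2 * m - 2 \<Longrightarrow> \<phi> ((j + 2 + i) mod (2 * m)) = (s + i) mod (2 * m - 2)"
begin

text \<open>Numbering of the input points that starts behind the curl: the curl occupies the
  positions \<open>2 * m - 2\<close> and \<open>2 * m - 1\<close>, and on the others
  \<open>\<phi>\<close> is the rotation by \<open>s\<close>.\<close>

definition pos :: "nat \<Rightarrow> nat" where "pos t = (j + 2 + t) mod (2 * m)"

definition m' :: nat where "m' = m - 1"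

definition j' :: nat where "j' = (j + 1) mod (2 * m)"

abbreviation C :: "nat set" where "C \<equiv> curl_ends m j"

abbreviation inner :: "nat set" where "inner \<equiv> {..<2 * m} - C"

definition curl' :: "'c tend \<Rightarrow> 'c tend" where
  "curl' = curl(\<beta> j := \<beta> j', \<beta> j' := \<beta> j)"

definition \<beta>' :: "nat \<Rightarrow> 'c tend" where
  "\<beta>' i = \<beta> (inv_into inner \<phi> i)"

lemma C_eq: "C = {j, j'}"
  by (simp add: curl_ends_def j'_def)

lemma pos_bij: "bij_betw pos {..<2 * m} {..<2 * m}"
  using bij_betw_rotation[of "2 * m" "j + 2"] m_pos unfolding pos_def by simp

lemma pos_less: "pos t < 2 * m" using m_pos by (simp add: pos_def)

lemma pos_eq_iff: "t < 2 * m \<Longrightarrow> t' < 2 * m \<Longrightarrow> pos t = pos t' \<longleftrightarrow> t = t'"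
  using pos_bij by (auto simp: bij_betw_def inj_on_eq_iff)

lemma pos_ex: "i < 2 * m \<Longrightarrow> \<exists>t<2 * m. i = pos t"
  using pos_bij unfolding bij_betw_def by (metis imageE lessThan_iff)

lemma pos_add: "(pos t + d) mod (2 * m) = pos ((t + d) mod (2 * m))"
proof -
  have "(pos t + d) mod (2 * m) = (j + 2 + t + d) mod (2 * m)" unfolding pos_def by (rule mod_add_left_eq)
  also have "\<dots> = (j + 2 + (t + d) mod (2 * m)) mod (2 * m)" by (metis add.assoc mod_add_right_eq)
  finally show ?thesis by (simp add: pos_def)
qed

lemma pos_j: "pos (2 * m - 2) = j" "pos (2 * m - 1) = j'"
proof -
  have "j + 2 + (2 * m - 2) = j + 2 * m" "j + 2 + (2 * m - 1) = j + 1 + 2 * m" using m2 by auto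
  then have "pos (2 * m - 2) = (j + 2 * m) mod (2 * m)" "pos (2 * m - 1) = (j + 1 + 2 * m) mod (2 * m)"
    unfolding pos_def by metis+
  then have "pos (2 * m - 2) = j mod (2 * m)" "pos (2 * m - 1) = (j + 1) mod (2 * m)"
    by (simp_all only: mod_add_self2)
  then show "pos (2 * m - 2) = j" "pos (2 * m - 1) = j'" using j by (simp_all add: j'_def)
qed

lemma j'_less: "j' < 2 * m" using m_pos by (simp add: j'_def)

lemma j'_neq: "j' \<noteq> j"
  using pos_j pos_eq_iff[of "2 * m - 2" "2 * m - 1"] m2 by auto

lemma inner_eq: "inner = pos ` {..<2 * m - 2}"
proof -
  have "{..<2 * m} = insert (2 * m - 2) (insert (2 * m - 1) {..<2 * m - 2})" using m2 by auto
  then have "pos ` {..<2 * m} = insert j (insert j' (pos ` {..<2 * m - 2}))" using pos_j by (metis image_insert)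
  moreover have "j \<notin> pos ` {..<2 * m - 2}" "j' \<notin> pos ` {..<2 * m - 2}"
  proof -
    have "pos t \<noteq> pos (2 * m - 2) \<and> pos t \<noteq> pos (2 * m - 1)" if "t < 2 * m - 2" for t
      using that pos_eq_iff[of t "2 * m - 2"] pos_eq_iff[of t "2 * m - 1"] by auto
    then show "j \<notin> pos ` {..<2 * m - 2}" "j' \<notin> pos ` {..<2 * m - 2}"
      unfolding pos_j by (metis imageE lessThan_iff)+
  qed
  moreover have "pos ` {..<2 * m} = {..<2 * m}" using pos_bij by (simp add: bij_betw_def)
  ultimately show ?thesis unfolding C_eq by auto
qed

lemma \<phi>_pos: "t < 2 * m - 2 \<Longrightarrow> \<phi> (pos t) = (s + t) mod (2 * m - 2)"
  unfolding pos_def by (rule \<phi>)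

lemma \<phi>_bij: "bij_betw \<phi> inner {..<2 * m - 2}"
proof (rule bij_betw_imageI)
  have rot: "bij_betw (\<lambda>t. (s + t) mod (2 * m - 2)) {..<2 * m - 2} {..<2 * m - 2}"
    by (rule bij_betw_rotation) (use m2 in simp)
  show "inj_on \<phi> inner" unfolding inner_eq
  proof (rule inj_onI)
    fix x y assume "x \<in> pos ` {..<2 * m - 2}" "y \<in> pos ` {..<2 * m - 2}" and eq: "\<phi> x = \<phi> y"
    then obtain t t' where t: "t < 2 * m - 2" "x = pos t" "t' < 2 * m - 2" "y = pos t'" by auto
    then have "(s + t) mod (2 * m - 2) = (s + t') mod (2 * m - 2)" using eq \<phi>_pos by metis
    then have "t = t'" using rot t unfolding bij_betw_def inj_on_def by blast
    then show "x = y" using t by simp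
  qed
  have "\<phi> ` inner = (\<lambda>t. (s + t) mod (2 * m - 2)) ` {..<2 * m - 2}"
    unfolding inner_eq image_image by (rule image_cong) (use \<phi>_pos in auto)
  then show "\<phi> ` inner = {..<2 * m - 2}" using rot by (simp add: bij_betw_def)
qed

lemma \<beta>'_\<phi>: "i \<in> inner \<Longrightarrow> \<beta>' (\<phi> i) = \<beta> i"
  unfolding \<beta>'_def using \<phi>_bij by (simp add: bij_betw_def)

lemma \<phi>_ex: "i < 2 * m - 2 \<Longrightarrow> \<exists>a\<in>inner. i = \<phi> a"
  using \<phi>_bij unfolding bij_betw_def by (metis imageE lessThan_iff)

lemma \<phi>_less: "a \<in> inner \<Longrightarrow> \<phi> a < 2 * m - 2"
  using \<phi>_bij unfolding bij_betw_def by (metis imageI lessThan_iff)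

lemma \<beta>'_pos: "t < 2 * m - 2 \<Longrightarrow> \<beta>' ((s + t) mod (2 * m - 2)) = \<beta> (pos t)"
  using \<beta>'_\<phi>[of "pos t"] \<phi>_pos inner_eq by auto

lemma Open'_eq: "\<beta>' ` {..<2 * m - 2} = Open - {\<beta> j, \<beta> j'}"
proof -
  have "\<beta>' ` {..<2 * m - 2} = \<beta> ` inner"
    using \<phi>_bij \<beta>'_\<phi> unfolding bij_betw_def by (metis (no_types, lifting) image_cong image_image)
  also have "\<dots> = Open - \<beta> ` C"
    using \<beta>_inj j j'_less unfolding C_eq by (intro inj_on_image_set_diff) auto
  finally show ?thesis by (simp add: C_eq)
qed

lemma g_j': "g (\<beta> j') \<longleftrightarrow> \<not> g (\<beta> j)"
  unfolding j'_def by (rule \<beta>_Suc[OF j])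

lemma g_pos: "g (\<beta> (pos t)) \<longleftrightarrow> (even t \<longleftrightarrow> g (\<beta> j))"
proof -
  have "pos t = (j + (2 + t)) mod (2 * m)" by (simp add: pos_def add.assoc)
  then show ?thesis using g_\<beta>_add[OF j, of "2 + t"] by simp
qed

lemma double_pred: "2 * m' = 2 * m - 2" by (simp add: m'_def)

lemma curled_closed_diagram: "closed_diagram D g curl' m' \<beta>'"
proof
  show "0 < m'" using m2 by (simp add: m'_def)
  show "inj_on \<beta>' {..<2 * m'}" unfolding double_pred
  proof (rule inj_onI)
    fix x y assume xy: "x \<in> {..<2 * m - 2}" "y \<in> {..<2 * m - 2}" "\<beta>' x = \<beta>' y"
    then obtain a b where ab: "a \<in> inner" "x = \<phi> a" "b \<in> inner" "y = \<phi> b" using \<phi>_ex by (metis lessThan_iff)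
    then have "\<beta> a = \<beta> b" using xy \<beta>'_\<phi> by simp
    then show "x = y" using ab \<beta>_eq_iff by auto
  qed
  show "\<beta>' i \<in> X \<inter> range Bd" if "i < 2 * m'" for i
    using \<phi>_ex[of i] that \<beta>'_\<phi> \<beta>_Bd unfolding double_pred by (metis Diff_iff lessThan_iff)
  show "g (\<beta>' ((i + 1) mod (2 * m'))) \<longleftrightarrow> \<not> g (\<beta>' i)" if i: "i < 2 * m'" for i
  proof -
    obtain t where t: "t < 2 * m - 2" "i = (s + t) mod (2 * m - 2)"
      using \<phi>_ex[of i] i \<phi>_pos unfolding inner_eq double_pred by auto
    have "(i + 1) mod (2 * m - 2) = (s + (t + 1)) mod (2 * m - 2)"
      unfolding t(2) by (metis add.assoc mod_add_left_eq)
    also have "\<dots> = (s + (t + 1) mod (2 * m - 2)) mod (2 * m - 2)" by (simp add: mod_add_right_eq)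
    finally have "\<beta>' ((i + 1) mod (2 * m - 2)) = \<beta> (pos ((t + 1) mod (2 * m - 2)))"
      using \<beta>'_pos[of "(t + 1) mod (2 * m - 2)"] m2 by simp
    moreover have "\<beta>' i = \<beta> (pos t)" using t \<beta>'_pos by simp
    \<comment> \<open>The modulus \<open>2 * m - 2\<close> is even, so a wrap keeps the
      parity.\<close>
    moreover have "even ((t + 1) mod (2 * m - 2)) \<longleftrightarrow> even (t + 1)" by (simp add: dvd_mod_iff)
    ultimately show ?thesis unfolding double_pred by (auto simp: g_pos)
  qed
  show "curl' e \<in> X \<inter> range Bd - \<beta>' ` {..<2 * m'} \<and> curl' (curl' e) = e \<and> (g (curl' e) \<longleftrightarrow> \<not> g e)"
    if e: "e \<in> X \<inter> range Bd - \<beta>' ` {..<2 * m'}" for e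
  proof -
    have uv: "\<beta> j \<in> Open" "\<beta> j' \<in> Open" "\<beta> j \<noteq> \<beta> j'" "\<beta> j \<in> X \<inter> range Bd" "\<beta> j' \<in> X \<inter> range Bd"
      using j j'_less j'_neq \<beta>_eq_iff \<beta>_Bd by auto
    consider "e = \<beta> j" | "e = \<beta> j'" | "e \<in> X \<inter> range Bd - Open" using e unfolding double_pred Open'_eq by blast
    then show ?thesis
    proof cases
      case 3
      from curl[OF this] have c: "curl e \<in> X \<inter> range Bd - Open" "curl (curl e) = e" "g (curl e) \<longleftrightarrow> \<not> g e" by auto
      have "e \<notin> Open" "curl e \<notin> Open" using 3 c(1) by blast+
      then have "e \<noteq> \<beta> j" "e \<noteq> \<beta> j'" "curl e \<noteq> \<beta> j" "curl e \<noteq> \<beta> j'" using uv(1,2) by metis+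
      then show ?thesis using c unfolding double_pred Open'_eq by (auto simp: curl'_def)
    qed (use uv g_j' in \<open>auto simp: curl'_def double_pred Open'_eq\<close>)
  qed
qed

end

section \<open>Effect of the curl on cycles, strands and loops\<close>

context curled_diagram
begin

interpretation new: closed_diagram D g curl' m' \<beta>'
  by (rule curled_closed_diagram)

lemma new_Open: "\<beta>' ` {..<2 * m'} = Open - {\<beta> j, \<beta> j'}"
  unfolding double_pred by (rule Open'_eq)

lemma curl_points: "\<beta> j \<in> Open" "\<beta> j' \<in> Open" "\<beta> j \<noteq> \<beta> j'" "\<beta> j \<in> X" "\<beta> j' \<in> X"
  using j j'_less j'_neq \<beta>_eq_iff \<beta>_Bd by auto

lemma new_partner:
  "e \<in> X - Open \<Longrightarrow> new.partner S e = partner S e"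
  "new.partner S (\<beta> j) = \<beta> j'" "new.partner S (\<beta> j') = \<beta> j"
proof -
  show "new.partner S e = partner S e" if "e \<in> X - Open"
  proof (cases e)
    case (Bd i)
    have "e \<noteq> \<beta> j" "e \<noteq> \<beta> j'" using that curl_points(1,2) by auto
    then have "curl' e = curl e" by (simp add: curl'_def)
    then show ?thesis using Bd by (simp add: new.partner_def partner_def)
  qed simp
  obtain a b where "\<beta> j = Bd a" "\<beta> j' = Bd b" using \<beta>_Bd j j'_less by blast
  then show "new.partner S (\<beta> j) = \<beta> j'" "new.partner S (\<beta> j') = \<beta> j"
    using curl_points(3) new.partner_def[of S "Bd a"] new.partner_def[of S "Bd b"] by (simp_all add: curl'_def)
qed

lemma new_curves: "equivcl (new.curves S) = equivcl (insert (\<beta> j, \<beta> j') (curves S))"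
proof -
  have "X - \<beta>' ` {..<2 * m'} = insert (\<beta> j) (insert (\<beta> j') (X - Open))"
    using curl_points unfolding new_Open by auto
  moreover have "graph_on (X - Open) (new.partner S) = graph_on (X - Open) (partner S)"
    unfolding graph_on_def using new_partner(1) by (intro image_cong) auto
  ultimately have "new.curves S = insert (\<beta> j, \<beta> j') (insert (\<beta> j', \<beta> j) (curves S))"
    unfolding new.curves_def curves_def using new_partner(2,3)[of S] by (simp add: graph_on_def)
  then show ?thesis
    by (intro ec_eqI) (auto intro: ec_base ec_base_sym)
qed

lemma new_bd_index: "t < 2 * m - 2 \<Longrightarrow>
    new.bd_index (\<beta> (pos t)) = (s + t) mod (2 * m - 2)"
  using new.bd_index_\<beta>[of "(s + t) mod (2 * m - 2)"] \<beta>'_pos[of t] m2 unfolding double_pred by simp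

lemma travel_pos: "mt e = \<beta> (pos t) \<Longrightarrow> travel d S e = \<beta> (pos ((t + d) mod (2 * m)))"
  using pos_less bd_index_\<beta>[OF pos_less[of t]] by (simp add: travel_def pos_add)

lemma new_travel_pos:
  assumes "mt e = \<beta> (pos t)" "t < 2 * m - 2"
  shows "new.travel d S e = \<beta> (pos ((t + d) mod (2 * m - 2)))"
proof -
  have "\<beta> (pos t) \<in> \<beta>' ` {..<2 * m - 2}"
    using \<beta>'_pos[OF assms(2)] m2 by (intro image_eqI[of _ _ "(s + t) mod (2 * m - 2)"]) auto
  then have "new.travel d S e = \<beta>' (((s + t) mod (2 * m - 2) + d) mod (2 * m - 2))"
    using assms new_bd_index unfolding new.travel_def double_pred by simp
  also have "((s + t) mod (2 * m - 2) + d) mod (2 * m - 2) = (s + (t + d) mod (2 * m - 2)) mod (2 * m - 2)"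
    by (simp add: mod_add_left_eq mod_add_right_eq add.assoc)
  also have "\<beta>' \<dots> = \<beta> (pos ((t + d) mod (2 * m - 2)))" using m2 by (intro \<beta>'_pos) simp
  finally show ?thesis .
qed

lemma new_travel_interior:
  assumes "e \<in> X" "mt e \<notin> Open"
  shows "new.travel d' S e = travel d S e"
  using assms mate new_partner(1)[of "mt e" S] unfolding new.travel_def travel_def new_Open by auto

lemma new_travel_curl:
  "mt e = \<beta> j \<Longrightarrow> new.travel d S e = \<beta> j'" "mt e = \<beta> j' \<Longrightarrow> new.travel d S e = \<beta> j"
  using new_partner unfolding new.travel_def new_Open by auto

lemma Y_cases:
  assumes "e \<in> Y"
  obtains "mt e \<notin> Open" | t where "t < 2 * m" "mt e = \<beta> (pos t)" "even t \<longleftrightarrow> \<not> g (\<beta> j)"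
proof (cases "mt e \<in> Open")
  case True
  then obtain t where t: "t < 2 * m" "mt e = \<beta> (pos t)" using pos_ex by auto
  have "\<not> g (mt e)" using assms mate(3) by (simp add: Y_def)
  then have "even t \<longleftrightarrow> \<not> g (\<beta> j)" using t g_pos by auto
  then show ?thesis using that t by blast
qed (use that in blast)

lemma mt_pos_Y: "\<not> g (\<beta> (pos t)) \<Longrightarrow> mt (\<beta> (pos t)) \<in> Y \<and> mt (mt (\<beta> (pos t))) = \<beta> (pos t)"
  using mate[of "\<beta> (pos t)"] pos_less Open_X by (auto simp: Y_def)

lemma num_cycles_same:
  assumes "\<And>e. e \<in> Y \<Longrightarrow> new.travel d' S e = travel d S e"
  shows "new.num_cycles d' S = num_cycles d S"
proof -
  have "graph_on Y (new.travel d' S) = graph_on Y (travel d S)"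
    unfolding graph_on_def using assms by (intro image_cong) auto
  then show ?thesis by (simp add: num_cycles_def new.num_cycles_def)
qed

lemma num_cycles_swapped:
  assumes "odd d" "p < 2 * m" "r < 2 * m" "p \<noteq> r" "\<not> g (\<beta> (pos p))" "\<not> g (\<beta> (pos r))"
    and "new.travel d' S (mt (\<beta> (pos p))) = travel d S (mt (\<beta> (pos r)))"
    and "new.travel d' S (mt (\<beta> (pos r))) = travel d S (mt (\<beta> (pos p)))"
    and else: "\<And>e. e \<in> Y \<Longrightarrow> mt e \<noteq> \<beta> (pos p) \<Longrightarrow> mt e \<noteq> \<beta> (pos r) \<Longrightarrow> new.travel d' S e = travel d S e"
  shows "num_cycles d S \<le> Suc (new.num_cycles d' S)"
proof -
  let ?p = "mt (\<beta> (pos p))" and ?r = "mt (\<beta> (pos r))"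
  note p = mt_pos_Y[OF assms(5)] and r = mt_pos_Y[OF assms(6)]
  interpret swapped_maps Y "travel d S" "new.travel d' S" ?p ?r
  proof
    show "finite Y" by (rule finite_Y)
    show "inj_on (travel d S) Y" by (rule travel_inj[OF assms(1)])
    show "travel d S ` Y \<subseteq> Y" using travel_Y[OF assms(1)] by auto
    have "\<beta> (pos p) \<noteq> \<beta> (pos r)" using \<beta>_eq_iff pos_less pos_eq_iff assms(2-4) by simp
    then show "?p \<noteq> ?r" using p r by metis
    show "new.travel d' S e = travel d S e" if "e \<in> Y" "e \<noteq> ?p" "e \<noteq> ?r" for e
      by (rule else[OF that(1)]) (use that mate[of e] in \<open>auto simp: Y_def\<close>)
  qed (use p r assms in auto)
  show ?thesis using num_comps_swap_le by (simp add: num_cycles_def new.num_cycles_def)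
qed

text \<open>The left-hand side drops by one. If \<open>\<beta> j\<close> is an out-point, then the
  step from \<open>j\<close> to the next point is the one that the curl makes, so the positive
  cycles stay; for the negative ones, the arrivals at \<open>j\<close> and at position 0 exchange
  their successors, which costs at most one cycle. If \<open>\<beta> j\<close> is an in-point, then
  positive and negative are exchanged, \<open>j'\<close> takes the place of \<open>j\<close>, and
  position \<open>2 * m - 3\<close> that of 0.\<close>

lemma new_euler:
  "card N + m' + 1 \<le>
     new.num_cycles 1 N + new.num_cycles (2 * m' - 1) {}"
proof -
  let ?n = "2 * m"
  have succ_same: "(t + 1) mod (?n - 2) = (t + 1) mod ?n" if "t + 1 < ?n - 2" for t using that by simp
  have pred_same: "(t + (?n - 2 - 1)) mod (?n - 2) = (t + (?n - 1)) mod ?n" if "0 < t" "t < ?n - 2" for t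
  proof -
    have "(t + (?n - 2 - 1)) = (t - 1) + (?n - 2)" "(t + (?n - 1)) = (t - 1) + ?n" using that by auto
    then have "(t + (?n - 2 - 1)) mod (?n - 2) = (t - 1) mod (?n - 2)" "(t + (?n - 1)) mod ?n = (t - 1) mod ?n"
      by (simp_all only: mod_add_self2)
    then show ?thesis using that by simp
  qed
  have n: "4 \<le> ?n" using m2 by simp
  show ?thesis
  proof (cases "g (\<beta> j')")
    case True
    then have gj: "\<not> g (\<beta> j)" using g_j' by simp
    have "new.num_cycles 1 N = num_cycles 1 N"
    proof (rule num_cycles_same)
      fix e assume "e \<in> Y"
      then show "new.travel 1 N e = travel 1 N e"
      proof (cases rule: Y_cases)
        case 1 then show ?thesis using \<open>e \<in> Y\<close> new_travel_interior by (simp add: Y_def)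
      next
        case (2 t)
        have "even t" using 2 gj by simp
        then have "t = ?n - 2 \<or> t + 1 < ?n - 2" using 2(1) n by presburger
        then show ?thesis
        proof
          assume t: "t = ?n - 2"
          then have "(t + 1) mod ?n = ?n - 1" using n by simp
          then show ?thesis using travel_pos[OF 2(2)] new_travel_curl(1) 2(2) pos_j t by simp
        next
          assume "t + 1 < ?n - 2"
          then show ?thesis using travel_pos[OF 2(2)] new_travel_pos[OF 2(2)] succ_same by simp
        qed
      qed
    qed
    moreover have "num_cycles (?n - 1) {} \<le> Suc (new.num_cycles (?n - 2 - 1) {})"
    proof (rule num_cycles_swapped[OF odd_minus_one, of 0 "?n - 2"])
      show "\<not> g (\<beta> (pos 0))" "\<not> g (\<beta> (pos (?n - 2)))" using gj by (auto simp: g_pos)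
      note mm = mt_pos_Y[OF this(1)] mt_pos_Y[OF this(2)]
      have eqs: "(0 + (?n - 1)) mod ?n = ?n - 1" "(?n - 2 + (?n - 1)) mod ?n = ?n - 3"
        "(0 + (?n - 2 - 1)) mod (?n - 2) = ?n - 3"
      proof -
        have "?n - 2 + (?n - 1) = ?n - 3 + ?n" using n by simp
        then have "(?n - 2 + (?n - 1)) mod ?n = (?n - 3) mod ?n" by (metis mod_add_self2)
        then show "(?n - 2 + (?n - 1)) mod ?n = ?n - 3" using n by simp
      qed (use n in auto)
      show "new.travel (?n - 2 - 1) {} (mt (\<beta> (pos 0))) = travel (?n - 1) {} (mt (\<beta> (pos (?n - 2))))"
        using mm n eqs travel_pos new_travel_pos[of "mt (\<beta> (pos 0))" 0] by simp
      show "new.travel (?n - 2 - 1) {} (mt (\<beta> (pos (?n - 2)))) = travel (?n - 1) {} (mt (\<beta> (pos 0)))"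
        using mm eqs travel_pos[of "mt (\<beta> (pos 0))" 0] new_travel_curl(1) pos_j by simp
      fix e assume e: "e \<in> Y" "mt e \<noteq> \<beta> (pos 0)" "mt e \<noteq> \<beta> (pos (?n - 2))"
      from e(1) show "new.travel (?n - 2 - 1) {} e = travel (?n - 1) {} e"
      proof (cases rule: Y_cases)
        case 1 then show ?thesis using e(1) new_travel_interior by (simp add: Y_def)
      next
        case (2 t)
        have "even t" using 2 gj by simp
        moreover have "t \<noteq> 0" "t \<noteq> ?n - 2" using e(2,3) 2(2) by metis+
        ultimately have t: "0 < t" "t < ?n - 2" using 2(1) by presburger+
        then show ?thesis
          unfolding travel_pos[OF 2(2)] new_travel_pos[OF 2(2) t(2)] by (simp only: pred_same)
      qed
    qed (use n in auto)
    ultimately show ?thesis using euler m2 unfolding double_pred by (simp add: m'_def)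
  next
    case False
    then have gj: "g (\<beta> j)" using g_j' by simp
    have "new.num_cycles (?n - 2 - 1) {} = num_cycles (?n - 1) {}"
    proof (rule num_cycles_same)
      fix e assume "e \<in> Y"
      then show "new.travel (?n - 2 - 1) {} e = travel (?n - 1) {} e"
      proof (cases rule: Y_cases)
        case 1 then show ?thesis using \<open>e \<in> Y\<close> new_travel_interior by (simp add: Y_def)
      next
        case (2 t)
        have "odd t" using 2 gj by simp
        then have "t = ?n - 1 \<or> 0 < t \<and> t < ?n - 2" using 2(1) n by presburger
        then show ?thesis
        proof
          assume t: "t = ?n - 1"
          have "?n - 1 + (?n - 1) = ?n - 2 + ?n" using n by simp
          then have "(t + (?n - 1)) mod ?n = (?n - 2) mod ?n" unfolding t by (metis mod_add_self2)
          then have "(t + (?n - 1)) mod ?n = ?n - 2" using n by simp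
          then show ?thesis using travel_pos[OF 2(2)] new_travel_curl(2) 2(2) pos_j t by simp
        next
          assume t: "0 < t \<and> t < ?n - 2"
          then show ?thesis
            unfolding travel_pos[OF 2(2)] new_travel_pos[OF 2(2) conjunct2[OF t]] by (simp only: pred_same)
        qed
      qed
    qed
    moreover have "num_cycles 1 N \<le> Suc (new.num_cycles 1 N)"
    proof (rule num_cycles_swapped[of 1 "?n - 3" "?n - 1"])
      have "odd (?n - 3)" "odd (?n - 1)" using n by auto
      then show "\<not> g (\<beta> (pos (?n - 3)))" "\<not> g (\<beta> (pos (?n - 1)))" using gj by (auto simp: g_pos)
      note mm = mt_pos_Y[OF this(1)] mt_pos_Y[OF this(2)]
      have eqs: "(?n - 3 + 1) mod ?n = ?n - 2" "(?n - 1 + 1) mod ?n = 0" "(?n - 3 + 1) mod (?n - 2) = 0"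
      proof -
        have "?n - 3 + 1 = ?n - 2" using n by simp
        then show "(?n - 3 + 1) mod ?n = ?n - 2" "(?n - 3 + 1) mod (?n - 2) = 0" using n by auto
      qed (use n in auto)
      show "new.travel 1 N (mt (\<beta> (pos (?n - 3)))) = travel 1 N (mt (\<beta> (pos (?n - 1))))"
        using mm n eqs travel_pos[of "mt (\<beta> (pos (?n - 1)))" "?n - 1"]
          new_travel_pos[of "mt (\<beta> (pos (?n - 3)))" "?n - 3"] by simp
      show "new.travel 1 N (mt (\<beta> (pos (?n - 1)))) = travel 1 N (mt (\<beta> (pos (?n - 3))))"
        using mm eqs travel_pos[of "mt (\<beta> (pos (?n - 3)))" "?n - 3"] new_travel_curl(2) pos_j by simp
      fix e assume e: "e \<in> Y" "mt e \<noteq> \<beta> (pos (?n - 3))" "mt e \<noteq> \<beta> (pos (?n - 1))"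
      from e(1) show "new.travel 1 N e = travel 1 N e"
      proof (cases rule: Y_cases)
        case 1 then show ?thesis using e(1) new_travel_interior by (simp add: Y_def)
      next
        case (2 t)
        have "odd t" using 2 gj by simp
        moreover have "t \<noteq> ?n - 3" "t \<noteq> ?n - 1" using e(2,3) 2(2) by metis+
        ultimately have "t + 1 < ?n - 2" using 2(1) n by presburger
        then show ?thesis using travel_pos[OF 2(2)] new_travel_pos[OF 2(2)] succ_same by simp
      qed
    qed (use n in auto)
    ultimately show ?thesis using euler m2 unfolding double_pred by (simp add: m'_def)
  qed
qed

lemma curled_planar: "planar_closed_diagram D g curl' m' \<beta>'"
  by unfold_locales (rule new_euler)

text \<open>The new link could be passed in both directions; by \<open>same_sign_eq\<close> gravity
  admits only the one in which the strand from \<open>a\<close> arrives at an out-point.\<close>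

lemma strand_curl_iff:
  assumes "a \<in> inner" "b \<in> inner" "g (\<beta> a)" "\<not> g (\<beta> b)"
  shows "(\<beta> a, \<beta> b) \<in> equivcl (new.curves S) \<longleftrightarrow>
     (a, b) \<in> strands S \<or> (\<exists>x\<in>C. \<exists>y\<in>C. x \<noteq> y \<and> (a, x) \<in> strands S \<and> (y, b) \<in> strands S)"
proof -
  let ?E = "conn S"
  have ab: "a < 2 * m" "b < 2 * m" "a \<noteq> j" "a \<noteq> j'" "b \<noteq> j" "b \<noteq> j'" using assms by (auto simp: C_eq)
  have through: "(\<beta> a, \<beta> x) \<in> ?E \<and> (\<beta> y, \<beta> b) \<in> ?E \<longleftrightarrow> (a, x) \<in> strands S \<and> (y, b) \<in> strands S"
    if "x = j \<and> y = j' \<or> x = j' \<and> y = j" for x y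
  proof -
    have x: "x < 2 * m" "y < 2 * m" "a \<noteq> x" "b \<noteq> y" "g (\<beta> x) \<longleftrightarrow> \<not> g (\<beta> y)"
      using that j j'_less ab g_j' by auto
    show ?thesis
    proof
      assume e: "(\<beta> a, \<beta> x) \<in> ?E \<and> (\<beta> y, \<beta> b) \<in> ?E"
      then have "\<not> g (\<beta> x)" using same_sign_eq[of a x S] ab x assms by blast
      then show "(a, x) \<in> strands S \<and> (y, b) \<in> strands S"
        using e ab x assms by (auto simp: strands_def)
    qed (auto simp: strands_def)
  qed
  have "(\<beta> a, \<beta> b) \<in> ?E \<longleftrightarrow> (a, b) \<in> strands S" using ab assms by (auto simp: strands_def)
  then show ?thesis
    unfolding new_curves ec_insert C_eq using through[of j j'] through[of j' j] j'_neq by auto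
qed

lemma new_strands: "new.strands S = insert_smoothing m j \<phi> (strands S)"
proof -
  let ?Q = "\<lambda>a b. (a, b) \<in> strands S \<or> (\<exists>x\<in>C. \<exists>y\<in>C. x \<noteq> y \<and> (a, x) \<in> strands S \<and> (y, b) \<in> strands S)"
  have Q: "a < 2 * m \<and> b < 2 * m \<and> g (\<beta> a) \<and> \<not> g (\<beta> b)" if "?Q a b" for a b
    using that by (auto simp: strands_def)
  have "new.strands S = map_prod \<phi> \<phi> ` {(a, b). a \<notin> C \<and> b \<notin> C \<and> ?Q a b}"
  proof (intro equalityI subrelI)
    fix a' b' assume ab': "(a', b') \<in> new.strands S"
    then have lt: "a' < 2 * m - 2" "b' < 2 * m - 2" "g (\<beta>' a')" "\<not> g (\<beta>' b')"
      "(\<beta>' a', \<beta>' b') \<in> equivcl (new.curves S)"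
      unfolding new.strands_def double_pred by auto
    then obtain a b where ab: "a \<in> inner" "a' = \<phi> a" "b \<in> inner" "b' = \<phi> b" using \<phi>_ex by metis
    then have "?Q a b" using lt strand_curl_iff[OF ab(1,3)] \<beta>'_\<phi> by simp
    then show "(a', b') \<in> map_prod \<phi> \<phi> ` {(a, b). a \<notin> C \<and> b \<notin> C \<and> ?Q a b}"
      using ab by (intro image_eqI[of _ _ "(a, b)"]) auto
  next
    fix a' b' assume "(a', b') \<in> map_prod \<phi> \<phi> ` {(a, b). a \<notin> C \<and> b \<notin> C \<and> ?Q a b}"
    then obtain a b where ab: "a' = \<phi> a" "b' = \<phi> b" "a \<notin> C" "b \<notin> C" "?Q a b" by auto
    then have "a \<in> inner" "b \<in> inner" "g (\<beta> a)" "\<not> g (\<beta> b)" using Q[OF ab(5)] by auto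
    then show "(a', b') \<in> new.strands S"
      using ab strand_curl_iff[of a b S] \<beta>'_\<phi> \<phi>_less unfolding new.strands_def double_pred by auto
  qed
  then show ?thesis by (simp add: insert_smoothing_def Let_def)
qed

lemma insert_loop_factor_eq:
  "insert_loop_factor m j (strands S) =
     (if (\<beta> j, \<beta> j') \<in> conn S then loop_value else 1)"
proof -
  have "(\<exists>x\<in>C. \<exists>y\<in>C. (x, y) \<in> strands S) \<longleftrightarrow> (\<beta> j, \<beta> j') \<in> conn S"
    using j j'_less g_j' ec_sym[of "\<beta> j" "\<beta> j'"] ec_sym[of "\<beta> j'" "\<beta> j"] unfolding C_eq strands_def by auto
  then show ?thesis by (simp add: insert_loop_factor_def)
qed

lemma finite_loops: "finite (loops S)"
  unfolding loops_def using finite_X by simp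

text \<open>If the curl joins the two ends of one strand, it closes it to a loop. Otherwise it
  merges two strands, and the far end of the first remains open.\<close>

lemma card_new_loops:
  "card (new.loops S) = card (loops S) + (if (\<beta> j, \<beta> j') \<in> conn S then 1 else 0)"
proof (cases "(\<beta> j, \<beta> j') \<in> conn S")
  case True
  let ?c = "component (curves S)"
  have comp: "component (new.curves S) = ?c"
    using new_curves ec_insert_absorb[OF True] by (intro component_cong) simp
  have cu: "?c (\<beta> j) \<inter> (Open - {\<beta> j, \<beta> j'}) = {}"
  proof (rule ccontr)
    assume "?c (\<beta> j) \<inter> (Open - {\<beta> j, \<beta> j'}) \<noteq> {}"
    then obtain e where "e \<in> Open" and e: "e \<noteq> \<beta> j" "e \<noteq> \<beta> j'" "(\<beta> j, e) \<in> conn S"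
      unfolding mem_component[symmetric] by blast
    then obtain i where i: "i < 2 * m" "\<beta> i \<noteq> \<beta> j" "\<beta> i \<noteq> \<beta> j'" "(\<beta> j, \<beta> i) \<in> conn S"
      by blast
    then have "(\<beta> j', \<beta> i) \<in> conn S" using True ec_sym ec_trans by metis
    then show False using i same_sign_eq[of j i S] same_sign_eq[of j' i S] j j'_less g_j' by metis
  qed
  have "new.loops S = insert (?c (\<beta> j)) (loops S)"
  proof (intro equalityI subsetI)
    fix c assume "c \<in> new.loops S"
    then obtain x where x: "x \<in> X" "c = ?c x" "c \<inter> (Open - {\<beta> j, \<beta> j'}) = {}"
      unfolding new.loops_def comp new_Open by auto
    show "c \<in> insert (?c (\<beta> j)) (loops S)"
    proof (cases "c \<inter> Open = {}")
      case False
      then obtain e where "e \<in> c" "e \<in> Open" by (meson disjoint_iff)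
      moreover have "e \<notin> c \<inter> (Open - {\<beta> j, \<beta> j'})" unfolding x(3) by (rule notI) (erule emptyE)
      ultimately have "e = \<beta> j \<or> e = \<beta> j'" by (simp only: Int_iff Diff_iff insert_iff) simp
      with \<open>e \<in> c\<close> have "\<beta> j \<in> c \<or> \<beta> j' \<in> c" by (elim disjE) simp_all
      then have "(x, \<beta> j) \<in> conn S \<or> (x, \<beta> j') \<in> conn S"
        using x(2) by (simp add: mem_component)
      then have "(x, \<beta> j) \<in> conn S" using ec_trans[OF _ ec_sym[OF True]] by blast
      then have "c = ?c (\<beta> j)" unfolding x(2) component_eq_iff .
      then show ?thesis by (simp only: insert_iff simp_thms)
    qed (use x in \<open>auto simp: loops_def\<close>)
  next
    fix c assume "c \<in> insert (?c (\<beta> j)) (loops S)"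
    then show "c \<in> new.loops S"
      using cu curl_points unfolding new.loops_def loops_def comp new_Open by auto
  qed
  moreover have "\<beta> j \<in> ?c (\<beta> j) \<inter> Open"
    using curl_points(1) by (simp only: Int_iff mem_component ec_refl simp_thms)
  then have "?c (\<beta> j) \<notin> loops S" unfolding loops_def by blast
  ultimately show ?thesis using True finite_loops by simp
next
  case False
  let ?E = "conn S"
  let ?c = "component (curves S)" and ?c' = "component (new.curves S)"
  have comp: "?c' = component (insert (\<beta> j, \<beta> j') (curves S))" by (rule component_cong[OF new_curves])
  have other: "?c' x = ?c x" if "(x, \<beta> j) \<notin> ?E" "(x, \<beta> j') \<notin> ?E" for x
    unfolding comp using that by (rule component_insert)
  obtain i where i: "i < 2 * m" "g (\<beta> i) \<longleftrightarrow> \<not> g (\<beta> j)" "(\<beta> j, \<beta> i) \<in> ?E" by (rule strand_ex[OF j])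
  then have i_open: "\<beta> i \<in> Open - {\<beta> j, \<beta> j'}" using False by auto
  have "new.loops S = loops S"
  proof (intro equalityI subsetI)
    fix c assume "c \<in> new.loops S"
    then obtain x where x: "x \<in> X" "c = ?c' x" "c \<inter> (Open - {\<beta> j, \<beta> j'}) = {}"
      unfolding new.loops_def new_Open by auto
    have "(x, \<beta> j) \<notin> ?E \<and> (x, \<beta> j') \<notin> ?E"
    proof (rule ccontr)
      assume "\<not> ((x, \<beta> j) \<notin> ?E \<and> (x, \<beta> j') \<notin> ?E)"
      then have "(x, \<beta> i) \<in> ?E \<or> (x, \<beta> j') \<in> ?E \<and> (\<beta> j, \<beta> i) \<in> ?E"
        using ec_trans[OF _ i(3)] i(3) by blast
      then have "(x, \<beta> i) \<in> equivcl (new.curves S)"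
        unfolding new_curves ec_insert by blast
      then show False using x i_open by (auto simp: mem_component)
    qed
    then have "c = ?c x" "\<beta> j \<notin> ?c x" "\<beta> j' \<notin> ?c x" using x other by (auto simp: mem_component)
    then show "c \<in> loops S" using x unfolding loops_def by auto
  next
    fix c assume "c \<in> loops S"
    then obtain x where x: "x \<in> X" "c = ?c x" "c \<inter> Open = {}" unfolding loops_def by auto
    then have "(x, \<beta> j) \<notin> ?E" "(x, \<beta> j') \<notin> ?E" using curl_points mem_component by fast+
    then have "c = ?c' x" using other x by simp
    then show "c \<in> new.loops S" using x unfolding new.loops_def new_Open by auto
  qed
  then show ?thesis using False by simp
qed

text \<open>The operator acts state by state, and the loop that the curl may close off accounts for
  \<open>insert_loop_factor\<close>.\<close>

lemma unary_operator_state_element: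
  "unary_operator m j \<phi> (state_element w) = planar_closed_diagram.state_element D g curl' m' \<beta>' w"
proof -
  interpret newp: planar_closed_diagram D g curl' m' \<beta>' by (rule curled_planar)
  have fin: "finite (Pow N)" using finite_N by simp
  show ?thesis
    unfolding state_element_def newp.state_element_def unary_operator_linear_extension
      linear_extension_sum_single[OF fin] new_strands card_new_loops insert_loop_factor_eq
    by (intro sum.cong) (auto simp: mult_ac)
qed

lemma new_in_ends: "new.in_ends = insert_pattern m j \<phi> in_ends"
proof -
  have "new.in_ends = \<phi> ` (in_ends - C)"
  proof (intro equalityI subsetI)
    fix i assume "i \<in> new.in_ends"
    then have "i < 2 * m - 2" "g (\<beta>' i)" unfolding new.in_ends_def double_pred by auto
    then obtain a where "a \<in> inner" "i = \<phi> a" "g (\<beta> a)" using \<phi>_ex \<beta>'_\<phi> by metis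
    then show "i \<in> \<phi> ` (in_ends - C)" by (auto simp: in_ends_def)
  next
    fix i assume "i \<in> \<phi> ` (in_ends - C)"
    then obtain a where "a \<in> inner" "i = \<phi> a" "g (\<beta> a)" by (auto simp: in_ends_def)
    then show "i \<in> new.in_ends" using \<beta>'_\<phi> \<phi>_less unfolding new.in_ends_def double_pred by auto
  qed
  then show ?thesis by (simp add: insert_pattern_def)
qed

end

text \<open>The crossings, and with them \<open>w\<close>, are the same for all closures; only
  \<open>curl\<close> and \<open>\<beta>\<close> change from step to step.\<close>

lemma partial_closure_state_element:
  assumes "planar_closed_diagram D g curl k \<beta>"
    and "partial_closure k (closed_diagram.in_ends g k \<beta>)
      (planar_closed_diagram.state_element D g curl k \<beta> w) m J Q"
  shows "\<exists>curl \<beta>. planar_closed_diagram D g curl m \<beta> \<and> J = closed_diagram.in_ends g m \<beta> \<and>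
    Q = planar_closed_diagram.state_element D g curl m \<beta> w"
  using assms(2)
proof (induction rule: partial_closure.induct)
  case refl
  then show ?case using assms(1) by blast
next
  case (step m J Q j \<phi>)
  then obtain curl \<beta> where planar: "planar_closed_diagram D g curl m \<beta>"
    and J: "J = closed_diagram.in_ends g m \<beta>"
    and Q: "Q = planar_closed_diagram.state_element D g curl m \<beta> w" by blast
  from step.hyps(2) obtain s where "2 \<le> m" "j < 2 * m"
    "\<forall>i<2 * m - 2. \<phi> ((j + 2 + i) mod (2 * m)) = (s + i) mod (2 * m - 2)"
    unfolding unary_basic_def by blast
  with planar interpret curled_diagram D g curl m \<beta> j \<phi> s
    by (simp add: curled_diagram_def curled_diagram_axioms_def)
  show ?case
    using curled_planar new_in_ends unary_operator_state_element[of w] unfolding J Q m'_def by metis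
qed

section \<open>Planar diagrams\<close>

lemma all_less_4: "(\<forall>i<4. P i) \<longleftrightarrow> P 0 \<and> P 1 \<and> P 2 \<and> P (3 :: nat)"
  by (simp add: numeral_eq_Suc All_less_Suc) blast

locale planar_diagram = gravity_diagram D g
  for D :: "'c diagram" and g :: "'c tend \<Rightarrow> bool" +
  fixes k :: nat
  assumes planar: "connected_planar_diagram D" and num_bd: "num_bd D = 2 * k" and k: "0 < k"
begin

abbreviation "n \<equiv> card N"

definition f :: "'c tend \<Rightarrow> 'c tend" where "f = next_end D \<circ> mt"

definition \<nu> :: "'c tend \<Rightarrow> 'c tend" where
  "\<nu> e = (case e of Cr x i \<Rightarrow> next_end D e | Bd j \<Rightarrow> e)"

lemma card_X: "card X = 4 * n + 2 * k"
proof -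
  have "X = (\<lambda>(x, i). Cr x i) ` (N \<times> {..<4}) \<union> Bd ` {..<2 * k}"
    by (auto simp: ends_def num_bd)
  also have "card \<dots> = card ((\<lambda>(x, i). Cr x i) ` (N \<times> {..<4::nat})) + card (Bd ` {..<2 * k} :: 'c tend set)"
    using finite_N by (intro card_Un_disjoint) auto
  also have "\<dots> = card (N \<times> {..<4::nat}) + card {..<2 * k}"
    by (intro arg_cong2[where f = "(+)"] card_image) (auto simp: inj_on_def)
  finally show ?thesis by (simp add: card_cartesian_product)
qed

lemma card_edges: "2 * card (edges D) = card X"
proof -
  have "card (\<Union> (edges D)) = 2 * card (edges D)"
  proof (rule card_partition[symmetric, where k = 2 and C = "edges D"])
    show "finite (edges D)" "finite (\<Union> (edges D))"
      using finite_X by (auto simp: edges_def)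
    show "card c = 2" if "c \<in> edges D" for c
      using that mate(4) by (auto simp: edges_def card_2_iff)
    show "c \<inter> c' = {}" if "c \<in> edges D" "c' \<in> edges D" "c \<noteq> c'" for c c'
      using that mate(2) unfolding edges_def by (auto; metis)
  qed
  moreover have "\<Union> (edges D) = X" using mate by (auto simp: edges_def)
  ultimately show ?thesis by simp
qed

text \<open>There are \<open>2 * n + k\<close> edges and \<open>n + 1\<close> vertices, the
  collapsed boundary being one of them.\<close>

lemma card_faces: "card (faces D) = n + k + 1"
  using planar card_edges card_X by (simp add: connected_planar_diagram_def)

lemma next_end_X: "e \<in> X \<Longrightarrow> next_end D e \<in> X"
  by (cases e) (auto simp: num_bd k)

lemma next_end_inj: "inj_on (next_end D) X"
proof (rule inj_onI)
  fix e e' assume e: "e \<in> X" "e' \<in> X" "next_end D e = next_end D e'"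
  show "e = e'"
  proof (cases e; cases e')
    fix x i y j assume "e = Cr x i" "e' = Cr y j"
    then have "x = y" "(i + 1) mod 4 = (j + 1) mod 4" "i < 4" "j < 4" using e by auto
    then show ?thesis using \<open>e = Cr x i\<close> \<open>e' = Cr y j\<close> mod_add_right_cancel by blast
  next
    fix i j assume *: "e = Bd i" "e' = Bd j"
    then have "(i + (2 * k - 1)) mod (2 * k) = (j + (2 * k - 1)) mod (2 * k)" "i < 2 * k" "j < 2 * k"
      using e k by (auto simp: num_bd)
    then show ?thesis using * mod_add_right_cancel by blast
  qed (use e in auto)
qed

lemma f_X: "f ` X \<subseteq> X"
  unfolding f_def using mate next_end_X by auto

lemma mate_inj: "inj_on mt X"
  by (rule inj_on_inverseI[where g = mt]) (rule mate(2))

lemma f_inj: "inj_on f X"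
  unfolding f_def using mate by (intro comp_inj_on mate_inj inj_on_subset[OF next_end_inj]) auto

lemma \<nu>_inj: "inj_on \<nu> X"
proof (rule inj_onI)
  fix e e' assume e: "e \<in> X" "e' \<in> X" "\<nu> e = \<nu> e'"
  show "e = e'"
  proof (cases e; cases e')
    fix x i y j assume "e = Cr x i" "e' = Cr y j"
    moreover from this have "next_end D e = next_end D e'" using e(3) by (simp add: \<nu>_def)
    ultimately show ?thesis using e(1,2) next_end_inj by (metis inj_onD)
  qed (use e in \<open>auto simp: \<nu>_def\<close>)
qed

lemma \<nu>_X: "\<nu> ` X \<subseteq> X"
  using next_end_X by (auto simp: \<nu>_def split: tend.split)

text \<open>The labels \<open>Inl x\<close> and \<open>Inr j\<close> are constant along
  \<open>\<nu>\<close>, so there are at least as many classes as labels.\<close>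

lemma \<nu>_components: "n + 2 * k \<le> num_comps X (graph_on X \<nu>)"
proof -
  let ?l = "\<lambda>e. case e of Cr x i \<Rightarrow> Inl x | Bd j \<Rightarrow> Inr j"
  let ?Z = "Inl ` N \<union> Inr ` {..<2 * k} :: ('c + nat) set"
  have "component {} z = {z}" for z :: "'c + nat" by (auto simp: component_def equivcl_def)
  then have "component {} ` ?Z = (\<lambda>z. {z}) ` ?Z" by auto
  then have "num_comps ?Z {} = card ?Z" by (simp add: num_comps_def card_image)
  also have "card ?Z = n + 2 * k"
    using finite_N by (subst card_Un_disjoint) (auto simp: card_image)
  finally have "n + 2 * k = num_comps ?Z {}" ..
  also have "\<dots> \<le> num_comps X (graph_on X \<nu>)"
  proof (rule num_comps_le[where \<phi> = ?l])
    show "\<exists>e\<in>X. (?l e, z) \<in> equivcl {}" if "z \<in> ?Z" for z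
    proof -
      from that consider x where "z = Inl x" "x \<in> N" | j where "z = Inr j" "j < 2 * k" by auto
      then show ?thesis
      proof cases
        case 1 then show ?thesis by (intro bexI[of _ "Cr x 0"]) auto
      next
        case 2 then show ?thesis by (intro bexI[of _ "Bd j"]) (auto simp: num_bd)
      qed
    qed
    show "(?l x, ?l y) \<in> equivcl {}" if "(x, y) \<in> graph_on X \<nu>" for x y
      using that by (auto simp: graph_on_def \<nu>_def split: tend.split)
  qed (rule finite_X)
  finally show ?thesis .
qed

lemma connected_components: "num_comps X (graph_on X \<nu> \<union> graph_on X mt) = 1"
proof -
  let ?R = "graph_on X \<nu> \<union> graph_on X mt"
  have base: "(Cr x i, Cr x ((i + 1) mod 4)) \<in> equivcl ?R" if "x \<in> N" "i < 4" for x i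
    using that by (intro ec_base) (auto simp: graph_on_def \<nu>_def image_iff)
  have to0: "(Cr x i, Cr x 0) \<in> equivcl ?R" if x: "x \<in> N" and i: "i < 4" for x i
  proof -
    have 3: "(Cr x 3, Cr x 0) \<in> equivcl ?R" using base[OF x, of 3] by simp
    have 2: "(Cr x 2, Cr x 0) \<in> equivcl ?R" using ec_trans[OF _ 3] base[OF x, of 2] by simp
    have 1: "(Cr x 1, Cr x 0) \<in> equivcl ?R"
      using ec_trans[OF _ 2] base[OF x, of 1] by (simp add: numeral_2_eq_2)
    from i consider "i = 0" | "i = 1" | "i = 2" | "i = 3" by linarith
    then show ?thesis using 1 2 3 by cases auto
  qed
  have "mate_steps D \<union> {(Cr x i, Cr x i') | x i i'. x \<in> N \<and> i < 4 \<and> i' < 4} \<subseteq> equivcl ?R"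
  proof (rule subrelI)
    fix a b
    assume "(a, b) \<in> mate_steps D \<union> {(Cr x i, Cr x i') | x i i'. x \<in> N \<and> i < 4 \<and> i' < 4}"
    then consider "(a, b) \<in> ?R" | x i i' where "a = Cr x i" "b = Cr x i'" "x \<in> N" "i < 4" "i' < 4"
      by (auto simp: mate_steps_def graph_on_def)
    then show "(a, b) \<in> equivcl ?R"
    proof cases
      case 1 then show ?thesis by (rule ec_base)
    next
      case 2 then show ?thesis using ec_trans[OF to0 ec_sym[OF to0]] by blast
    qed
  qed
  then have "(mate_steps D \<union> {(Cr x i, Cr x i') | x i i'. x \<in> N \<and> i < 4 \<and> i' < 4})\<^sup>*
      \<subseteq> (equivcl ?R)\<^sup>*" by (rule rtrancl_mono)
  also have "(equivcl ?R)\<^sup>* = equivcl ?R" by (simp add: equivcl_def)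
  finally have "(a, b) \<in> equivcl ?R" if "a \<in> X" "b \<in> X" for a b
    using connected that unfolding connected_diagram_def by blast
  then have "component ?R a = component ?R (Bd 0)" if "a \<in> X" for a
    using that k by (simp add: component_eq_iff num_bd)
  moreover have "Bd 0 \<in> X" using k by (simp add: num_bd)
  ultimately have "component ?R ` X = {component ?R (Bd 0)}" by blast
  then show ?thesis by (simp add: num_comps_def)
qed

text \<open>If the boundary vertex is split into \<open>2 * k\<close> vertices of degree 1, then the diagram remains
  connected and has at most \<open>n - k + 2\<close> faces, at least one of which touches the boundary.  The
  faces away from the boundary are not affected, so the \<open>2 * k\<close> corners at the boundary vertex lie
  in \<open>2 * k\<close> different faces.\<close>

lemma boundary_faces_inj: "inj_on (\<lambda>j. orbit f (Bd j)) {..<2 * k}"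
proof -
  let ?f' = "\<lambda>e. \<nu> (mt e)"
  have f'_inj: "inj_on ?f' X"
    using comp_inj_on[OF mate_inj inj_on_subset[OF \<nu>_inj]] mate by (auto simp: comp_def)
  have f'_X: "?f' ` X \<subseteq> X" using mate \<nu>_X by auto
  have comp: "component (graph_on X f) e = orbit f e" if "e \<in> X" for e
    by (rule component_graph_on[OF finite_X f_inj f_X that])
  have comp': "component (graph_on X ?f') e = orbit ?f' e" if "e \<in> X" for e
    by (rule component_graph_on[OF finite_X f'_inj f'_X that])
  define CO where "CO = {c \<in> orbit f ` X. \<forall>j. Bd j \<notin> c}"
  define CO' where "CO' = {c \<in> orbit ?f' ` X. \<forall>j. Bd j \<notin> c}"
  have "CO \<subseteq> CO'"
  proof
    fix c assume "c \<in> CO"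
    then obtain e where e: "e \<in> X" "c = orbit f e" "\<forall>j. Bd j \<notin> c" by (auto simp: CO_def)
    have "e \<in> c" unfolding e(2) comp[OF e(1), symmetric] by (simp add: mem_component)
    moreover have "f a \<in> c" if "a \<in> c" for a using that unfolding e(2) by (rule orbit.step)
    moreover have "f a = ?f' a" if "a \<in> c" for a
    proof -
      have "f a \<in> c" using that unfolding e(2) by (rule orbit.step)
      then show ?thesis using e(3) by (cases "mt a") (auto simp: f_def \<nu>_def)
    qed
    ultimately have "orbit f e = orbit ?f' e" by (intro orbit_cong0[where A = c]) auto
    then show "c \<in> CO'" using e by (auto simp: CO'_def)
  qed
  moreover have fin: "finite CO'" "finite CO" using finite_X by (auto simp: CO'_def CO_def)
  ultimately have "card CO \<le> card CO'" by (simp add: card_mono)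
  moreover have "card CO' + 1 \<le> num_comps X (graph_on X ?f')"
  proof -
    have "Bd 0 \<in> X" using k by (simp add: num_bd)
    moreover from this have "Bd 0 \<in> orbit ?f' (Bd 0)" using comp'[of "Bd 0"] mem_component ec_refl by metis
    ultimately have "orbit ?f' (Bd 0) \<in> orbit ?f' ` X - CO'" unfolding CO'_def by blast
    then have "card (insert (orbit ?f' (Bd 0)) CO') \<le> card (orbit ?f' ` X)"
      using finite_X by (intro card_mono) (auto simp: CO'_def)
    moreover have "component (graph_on X ?f') ` X = orbit ?f' ` X" using comp' by auto
    ultimately show ?thesis
      using \<open>orbit ?f' (Bd 0) \<in> orbit ?f' ` X - CO'\<close> fin by (simp add: num_comps_def)
  qed
  moreover have "2 * num_comps X (graph_on X ?f') + 2 * num_comps X (graph_on X \<nu>) \<le> card X + 4"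
  proof -
    have "graph_on X (\<lambda>e. \<nu> (if e \<in> X then mt e else e)) = graph_on X ?f'"
      unfolding graph_on_def by (intro image_cong) auto
    then show ?thesis
      using genus_inequality[OF finite_X \<nu>_inj \<nu>_X, of mt X] mate connected_components by simp
  qed
  moreover have "card (faces D) = card CO + card (orbit f ` Bd ` {..<2 * k})"
  proof -
    have "orbit f ` X = CO \<union> orbit f ` Bd ` {..<2 * k}"
    proof (intro equalityI subsetI)
      fix c assume "c \<in> orbit f ` X"
      then obtain e where e: "e \<in> X" "c = orbit f e" by auto
      show "c \<in> CO \<union> orbit f ` Bd ` {..<2 * k}"
      proof (cases "\<exists>j. Bd j \<in> c")
        case True
        then obtain j where j: "(e, Bd j) \<in> equivcl (graph_on X f)"
          using e comp by (metis mem_component)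
        have "graph_on X f \<subseteq> X \<times> X" using f_X by (auto simp: graph_on_def)
        with j e have "Bd j \<in> X" using ec_restrict by metis
        moreover from this have "c = orbit f (Bd j)" using j e comp component_eq_iff by metis
        ultimately show ?thesis by (auto simp: num_bd)
      qed (use e in \<open>auto simp: CO_def\<close>)
    qed (auto simp: CO_def num_bd)
    moreover have "CO \<inter> orbit f ` Bd ` {..<2 * k} = {}"
    proof -
      have "Bd j \<in> orbit f (Bd j)" if "j < 2 * k" for j
        using comp[of "Bd j"] that by (simp add: num_bd mem_component flip: comp)
      then show ?thesis by (auto simp: CO_def)
    qed
    ultimately show ?thesis
      using fin unfolding faces_def f_def[symmetric] by (simp add: card_Un_disjoint)
  qed
  \<comment> \<open>Subtracting the at most \<open>n - k + 1\<close> faces in \<open>CO\<close> from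
    all \<open>n + k + 1\<close> faces leaves \<open>2 * k\<close>.\<close>
  ultimately have "2 * k \<le> card (orbit f ` Bd ` {..<2 * k})"
    using card_faces card_X \<nu>_components by linarith
  moreover have "card ((\<lambda>j. orbit f (Bd j)) ` {..<2 * k}) \<le> 2 * k"
    using card_image_le[of "{..<2 * k}" "\<lambda>j. orbit f (Bd j)"] by simp
  ultimately show ?thesis by (intro eq_card_imp_inj_on) (auto simp: image_image)
qed

lemma orbit_self: "e \<in> X \<Longrightarrow> e \<in> orbit f e"
  using component_graph_on[OF finite_X f_inj f_X, of e] mem_component[of e "graph_on X f" e] by simp

lemma orbit_X: "e \<in> X \<Longrightarrow> y \<in> orbit f e \<Longrightarrow> y \<in> X"
proof -
  assume e: "e \<in> X"
  assume "y \<in> orbit f e"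
  then show "y \<in> X" by induction (use e f_X in auto)
qed

lemma g_next_end_Cr: "Cr x i \<in> X \<Longrightarrow> g (next_end D (Cr x i)) \<longleftrightarrow> \<not> g (Cr x i)"
  using g_Cr[of x i] g_Cr[of x "(i + 1) mod 4"] by (auto simp: dvd_mod_iff)

text \<open>The face of \<open>Bd j\<close> meets the boundary vertex only once, by
  \<open>boundary_faces_inj\<close>. Along it \<open>g\<close> is constant, since passing an edge
  and turning at a crossing both reverse it. Its last end before \<open>Bd j\<close> is mated to the
  boundary point after \<open>Bd j\<close>, which thus has the opposite direction.\<close>

lemma gravity_alternates:
  assumes j: "j < 2 * k"
  shows "g (Bd ((j + 1) mod (2 * k))) \<longleftrightarrow> \<not> g (Bd j)"
proof -
  let ?e = "Bd j"
  have eX: "?e \<in> X" using j by (simp add: num_bd)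
  have only: "i = j" if "Bd i \<in> orbit f ?e" for i
  proof -
    have i: "i < 2 * k" using orbit_X[OF eX that] by (simp add: num_bd)
    then have "Bd i \<in> X" by (simp add: num_bd)
    then have "orbit f (Bd i) = orbit f ?e"
      using that eX component_graph_on[OF finite_X f_inj f_X] component_eq_iff mem_component by metis
    then show ?thesis using boundary_faces_inj i j by (auto dest: inj_onD)
  qed
  have step: "g (f a) \<longleftrightarrow> g ?e" if a: "a \<in> orbit f ?e" "g a \<longleftrightarrow> g ?e" for a
  proof (cases "mt a")
    case (Cr x i)
    have "a \<in> X" using orbit_X[OF eX a(1)] .
    then show ?thesis using Cr mate[of a] a(2) g_next_end_Cr[of x i] by (simp add: f_def)
  next
    case (Bd i)
    then have "f a = Bd ((i + num_bd D - 1) mod num_bd D)" by (simp add: f_def)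
    moreover have "f a \<in> orbit f ?e" using a(1) by (rule orbit.step)
    ultimately show ?thesis using only by metis
  qed
  have same_g: "g a \<longleftrightarrow> g ?e" if "a \<in> orbit f ?e" for a
    using that by (induction rule: orbit.induct) (use step orbit_self[OF eX] in blast)+
  obtain y where y: "y \<in> orbit f ?e" "f y = ?e"
  proof -
    obtain r where r: "0 < r" "(f ^^ r) ?e = ?e" using finite_return[OF finite_X f_inj f_X eX] .
    then have "f ((f ^^ (r - 1)) ?e) = ?e" by (metis Suc_pred' comp_apply funpow.simps(2))
    moreover have "(f ^^ (r - 1)) ?e \<in> orbit f ?e"
      using orbit_self[OF eX] by (rule funpow_in_orbit)
    ultimately show ?thesis using that by blast
  qed
  have yX: "y \<in> X" using orbit_X[OF eX y(1)] .
  obtain i where i: "mt y = Bd i" using y(2) by (cases "mt y") (auto simp: f_def)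
  then have "i < 2 * k" using mate(1)[OF yX] by (simp add: num_bd)
  have "(i + (2 * k - 1)) mod (2 * k) = j" using y(2) i k by (simp add: f_def num_bd)
  then have "(j + 1) mod (2 * k) = (i + (2 * k - 1) + 1) mod (2 * k)" by (metis mod_add_left_eq)
  also have "i + (2 * k - 1) + 1 = i + 2 * k" using k by simp
  finally have "(j + 1) mod (2 * k) = i" using \<open>i < 2 * k\<close> by simp
  then show ?thesis using i mate(3)[OF yX] same_g[OF y(1)] by simp
qed

lemma Bd_image: "X \<inter> range Bd = Bd ` {..<2 * k}"
  by (auto simp: num_bd)

lemma closed_diagram: "closed_diagram D g id k Bd"
proof
  show "0 < k" by (rule k)
  show "inj_on Bd {..<2 * k}" by (simp add: inj_on_def)
  show "Bd i \<in> X \<inter> range Bd" if "i < 2 * k" for i using that by (simp add: num_bd)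
  show "g (Bd ((i + 1) mod (2 * k))) \<longleftrightarrow> \<not> g (Bd i)" if "i < 2 * k" for i
    using gravity_alternates[OF that] .
qed (simp add: Bd_image)

interpretation cd: closed_diagram D g id k Bd
  by (rule closed_diagram)

lemma index_Bd: "i < 2 * k \<Longrightarrow> cd.bd_index (Bd i) = i"
  by (rule cd.bd_index_\<beta>)

text \<open>Gravity arrives at even ends, and the state \<open>{}\<close> joins these to their
  counterclockwise successors, as \<open>f\<close> does; at the boundary both step
  backwards.\<close>

lemma travel_minus: "e \<in> cd.Y \<Longrightarrow> cd.travel (2 * k - 1) {} e = f e"
proof -
  assume "e \<in> cd.Y"
  then have e: "mt e \<in> X" "\<not> g (mt e)" using mate by (auto simp: cd.Y_def)
  show ?thesis
  proof (cases "mt e")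
    case (Cr x i)
    then have "i < 4" "even i" using e g_Cr by auto
    then have "i = 0 \<or> i = 2" by presburger
    then show ?thesis using Cr cd.Cr_not_Open
      by (auto simp: cd.travel_def f_def smoothing_partner_simps)
  next
    case (Bd i)
    then have "i < 2 * k" using e by (simp add: num_bd)
    then show ?thesis using Bd k index_Bd by (simp add: cd.travel_def f_def num_bd)
  qed
qed

text \<open>The state \<open>N\<close> joins an arriving end to its counterclockwise predecessor, so
  \<open>next_end\<close> undoes the turn: positive cycles are faces run through backwards.\<close>

lemma travel_plus: "e \<in> cd.Y \<Longrightarrow> next_end D (cd.travel 1 N e) = mt e"
proof -
  assume "e \<in> cd.Y"
  then have e: "mt e \<in> X" "\<not> g (mt e)" using mate by (auto simp: cd.Y_def)
  show ?thesis
  proof (cases "mt e")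
    case (Cr x i)
    then have "i < 4" "even i" "x \<in> N" using e g_Cr by auto
    then have "i = 0 \<or> i = 2" by presburger
    then show ?thesis using Cr cd.Cr_not_Open \<open>x \<in> N\<close>
      by (auto simp: cd.travel_def smoothing_partner_simps)
  next
    case (Bd i)
    then have i: "i < 2 * k" using e by (simp add: num_bd)
    have "((i + 1) mod (2 * k) + (2 * k - 1)) mod (2 * k) = (i + 1 + (2 * k - 1)) mod (2 * k)"
      by (rule mod_add_left_eq)
    also have "i + 1 + (2 * k - 1) = i + 2 * k" using k by simp
    finally have "((i + 1) mod (2 * k) + (2 * k - 1)) mod (2 * k) = i" using i by simp
    then show ?thesis using Bd i k index_Bd by (simp add: cd.travel_def num_bd)
  qed
qed

text \<open>Passing an edge and turning at a vertex both reverse gravity, so \<open>f\<close>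
  preserves it and each face lies in \<open>?Y\<close> or in \<open>?Z\<close>. The faces in
  \<open>?Y\<close> are the negative cycles of the state \<open>{}\<close>; those in
  \<open>?Z\<close> correspond under \<open>mt\<close> to the positive cycles of
  \<open>N\<close>.\<close>

lemma planar_closed_diagram: "planar_closed_diagram D g id k Bd"
proof unfold_locales
  let ?Y = cd.Y and ?Z = "{e \<in> X. \<not> g e}"
  have g_f: "g (f e) \<longleftrightarrow> g e" if e: "e \<in> X" for e
  proof (cases "mt e")
    case (Cr x i)
    then show ?thesis using mate[OF e] g_next_end_Cr[of x i] by (simp add: f_def)
  next
    case (Bd i)
    then have "i < 2 * k" using mate(1)[OF e] by (simp add: num_bd)
    then have "g (Bd ((i + (2 * k - 1)) mod (2 * k))) \<longleftrightarrow> \<not> g (Bd i)"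
      using cd.g_\<beta>_add[of i "2 * k - 1"] cd.odd_minus_one by blast
    then show ?thesis using Bd mate(3)[OF e] k by (simp add: f_def num_bd)
  qed
  have f_Y: "f e \<in> ?Y" if "e \<in> ?Y" for e using that f_X g_f by (auto simp: cd.Y_def)
  have f_Z: "f ` ?Z \<subseteq> ?Z" using f_X g_f by auto
  have "card (orbit f ` ?Y) = cd.num_cycles (2 * k - 1) {}"
  proof -
    have "orbit f e = component (graph_on ?Y (cd.travel (2 * k - 1) {})) e" if "e \<in> ?Y" for e
    proof -
      have "orbit (cd.travel (2 * k - 1) {}) e = orbit f e"
        using that travel_minus f_Y by (intro orbit_cong0[where A = ?Y]) auto
      then show ?thesis
        using component_graph_on[OF cd.finite_Y cd.travel_inj[OF cd.odd_minus_one] _ that]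
          cd.travel_Y[OF cd.odd_minus_one] by blast
    qed
    then show ?thesis by (simp add: cd.num_cycles_def num_comps_def)
  qed
  moreover have "card (orbit f ` ?Z) \<le> cd.num_cycles 1 N"
  proof -
    have "component (graph_on ?Z f) ` ?Z = orbit f ` ?Z"
      using finite_X f_Z inj_on_subset[OF f_inj, of ?Z] by (intro image_cong component_graph_on) auto
    then have "card (orbit f ` ?Z) = num_comps ?Z (graph_on ?Z f)"
      by (simp add: num_comps_def)
    also have "\<dots> \<le> num_comps ?Y (graph_on ?Y (cd.travel 1 N))"
    proof (rule num_comps_le[where \<phi> = mt, OF cd.finite_Y])
      show "\<exists>y\<in>?Y. (mt y, z) \<in> equivcl (graph_on ?Z f)" if "z \<in> ?Z" for z
        using that mate[of z] by (intro bexI[of _ "mt z"]) (auto simp: cd.Y_def)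
      fix x y assume "(x, y) \<in> graph_on ?Y (cd.travel 1 N)"
      then have x: "x \<in> ?Y" "y = cd.travel 1 N x" by (auto simp: graph_on_def)
      then have "y \<in> ?Y" using cd.travel_Y[of 1] by simp
      then have "mt y \<in> ?Z" "f (mt y) = mt x"
        using mate[of y] travel_plus[OF x(1)] x(2) by (auto simp: cd.Y_def f_def)
      then show "(mt x, mt y) \<in> equivcl (graph_on ?Z f)"
        by (intro ec_base_sym) (auto simp: graph_on_def image_iff)
    qed
    finally show ?thesis by (simp add: cd.num_cycles_def)
  qed
  moreover have "card (faces D) \<le> card (orbit f ` ?Y) + card (orbit f ` ?Z)"
  proof -
    have "X = ?Y \<union> ?Z" by (auto simp: cd.Y_def)
    then have "faces D = orbit f ` ?Y \<union> orbit f ` ?Z" unfolding faces_def f_def by (metis image_Un)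
    then show ?thesis by (metis card_Un_le)
  qed
  ultimately show "n + k + 1 \<le> cd.num_cycles 1 N + cd.num_cycles (2 * k - 1) {}"
    using card_faces by simp
qed

section \<open>Comparison with the Jones polynomial\<close>

lemma in_points_eq: "in_points D g = cd.in_ends"
  by (simp add: in_points_def cd.in_ends_def num_bd)

text \<open>\<open>state_curves\<close> is only a reflexive transitive closure, but
  \<open>mt\<close> and \<open>partner\<close> are involutions, so the relation is symmetric
  already.\<close>

lemma state_curves_eq: "state_curves D S = equivcl (cd.curves S)"
proof -
  have "X - Bd ` {..<2 * k} = {Cr x i | x i. x \<in> N \<and> i < 4}"
    by (auto simp: ends_def num_bd)
  then have "graph_on (X - Bd ` {..<2 * k}) (cd.partner S) =
      {(Cr x i, Cr x (smoothing_partner (x \<in> S) i)) | x i. x \<in> N \<and> i < 4}"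
    by (auto simp: graph_on_def)
  then have eq: "cd.curves S = mate_steps D \<union>
      {(Cr x i, Cr x (smoothing_partner (x \<in> S) i)) | x i. x \<in> N \<and> i < 4}"
    by (auto simp: cd.curves_def mate_steps_def graph_on_def)
  have "(b, a) \<in> cd.curves S" if "(a, b) \<in> cd.curves S" for a b
  proof -
    from that consider "a \<in> X" "b = mt a" | "a \<in> X - Bd ` {..<2 * k}" "b = cd.partner S a"
      by (auto simp: cd.curves_def graph_on_def)
    then show ?thesis
    proof cases
      case 1
      then have "b \<in> X" "a = mt b" using mate by auto
      then show ?thesis by (auto simp: cd.curves_def graph_on_def)
    next
      case 2
      then have "b \<in> X - Bd ` {..<2 * k}" "a = cd.partner S b" using cd.partner by auto
      then show ?thesis unfolding cd.curves_def graph_on_def by blast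
    qed
  qed
  then have "(cd.curves S)\<inverse> \<subseteq> cd.curves S" by auto
  then have "cd.curves S \<union> (cd.curves S)\<inverse> = cd.curves S" by blast
  then show ?thesis unfolding state_curves_def equivcl_def by (simp add: eq)
qed

lemma orient_state_smoothing: "orient_smoothing (in_points D g) (state_smoothing D S) = cd.strands S"
proof (intro equalityI subrelI)
  fix a b assume "(a, b) \<in> orient_smoothing (in_points D g) (state_smoothing D S)"
  then obtain i j where ij: "{a, b} = {i, j}" "i < 2 * k" "j < 2 * k"
    "(Bd i, Bd j) \<in> equivcl (cd.curves S)" and g: "g (Bd a)" "a < 2 * k" "b \<notin> in_points D g"
    by (auto simp: orient_smoothing_def state_smoothing_def num_bd in_points_def state_curves_eq)
  then have "b < 2 * k" "(Bd a, Bd b) \<in> equivcl (cd.curves S)"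
    using ec_sym by (auto simp: doubleton_eq_iff)
  then show "(a, b) \<in> cd.strands S" using g by (auto simp: cd.strands_def in_points_def num_bd)
next
  fix a b assume "(a, b) \<in> cd.strands S"
  then show "(a, b) \<in> orient_smoothing (in_points D g) (state_smoothing D S)"
    unfolding cd.strands_def orient_smoothing_def state_smoothing_def in_points_def state_curves_eq num_bd
    by blast
qed

lemma state_loops_eq: "state_loops D S = card (cd.loops S)"
proof -
  have "X // state_curves D S = component (cd.curves S) ` X"
    by (auto simp: quotient_def component_def state_curves_eq)
  moreover have "(\<forall>j. Bd j \<notin> c) \<longleftrightarrow> c \<inter> Bd ` {..<2 * k} = {}" if "c \<in> component (cd.curves S) ` X" for c
  proof -
    have "c \<subseteq> X" using that cd.ec_curves_X by (auto simp: mem_component)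
    then have "Bd j \<in> c \<Longrightarrow> j < 2 * k" for j by (auto simp: num_bd)
    then show ?thesis by blast
  qed
  ultimately have "{c \<in> X // state_curves D S. \<forall>j. Bd j \<notin> c} = cd.loops S"
    unfolding cd.loops_def by auto
  then show ?thesis by (simp add: state_loops_def)
qed

definition skein_weight :: "('c tend \<Rightarrow> bool) \<Rightarrow> 'c set \<Rightarrow> laurent" where
  "skein_weight ori S = (\<Prod>x\<in>N. skein_coeff ori x (x \<in> S))"

lemma orient_jones:
  "orient_element (in_points D g) (jones D ori) =
     planar_closed_diagram.state_element D g id k Bd (skein_weight ori)"
proof -
  have fin: "finite (Pow N)" using finite_N by simp
  show ?thesis
    unfolding planar_closed_diagram.state_element_def[OF planar_closed_diagram]
      orient_element_linear_extension jones_def linear_extension_sum_single[OF fin]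
      orient_state_smoothing state_loops_eq skein_weight_def
    by simp
qed

text \<open>At a positive crossing \<open>False\<close> is the oriented smoothing, with
  \<open>q\<close> against \<open>-q^2\<close>; at a negative one \<open>True\<close> is, with
  \<open>q^-1\<close> against \<open>-q^-2\<close>. The ratio of \<open>True\<close> to
  \<open>False\<close> is \<open>-q\<close> both times, so the orientation affects only a common
  monomial.\<close>

lemma skein_coeff_True:
  assumes "orientation D ori" "x \<in> N"
  shows "skein_coeff ori x True = skein_coeff ori x False * - q_pow 1"
proof -
  have o: "\<forall>i<4. ori (Cr x ((i + 2) mod 4)) \<longleftrightarrow> \<not> ori (Cr x i)"
    using assms unfolding orientation_def by blast
  have "(0 + 2) mod 4 = (2 :: nat)" "(1 + 2) mod 4 = (3 :: nat)" by simp_all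
  then have o2: "ori (Cr x 2) \<longleftrightarrow> \<not> ori (Cr x 0)" "ori (Cr x 3) \<longleftrightarrow> \<not> ori (Cr x (Suc 0))"
    using o[rule_format, of 0] o[rule_format, of 1] by (metis zero_less_numeral, metis One_nat_def one_less_numeral_iff semiring_norm(76))
  have "is_oriented_smoothing ori x False \<longleftrightarrow> positive_crossing ori x"
    "is_oriented_smoothing ori x True \<longleftrightarrow> \<not> positive_crossing ori x"
    unfolding is_oriented_smoothing_def all_less_4 positive_crossing_def
    using o2 by (auto simp: smoothing_partner_simps)
  then show ?thesis by (simp add: skein_coeff_def q_pow_mult)
qed

lemma skein_weight_eq:
  assumes "orientation D ori"
  obtains e s where "\<And>S. S \<subseteq> N \<Longrightarrow>
    skein_weight ori S = Poly_Mapping.single e (neg_one_pow s) * (- q_pow 1) ^ card S"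
proof -
  have "\<exists>e s. (\<Prod>x\<in>M. skein_coeff ori x False) = Poly_Mapping.single e (neg_one_pow s)" if "finite M" for M
    using that
  proof (induction M rule: finite_induct)
    case empty
    then show ?case by (auto intro!: exI[of _ 0] simp: neg_one_pow_def)
  next
    case (insert x M)
    then obtain e s where IH: "(\<Prod>x\<in>M. skein_coeff ori x False) = Poly_Mapping.single e (neg_one_pow s)" by blast
    have "\<exists>e s. skein_coeff ori x False = Poly_Mapping.single e (neg_one_pow s)"
    proof -
      have "q_pow e = Poly_Mapping.single e (neg_one_pow 0)" "- q_pow e = Poly_Mapping.single e (neg_one_pow 1)" for e
        by (simp_all add: q_pow_def neg_one_pow_def single_uminus)
      then show ?thesis unfolding skein_coeff_def by meson
    qed
    then obtain e' s' where "skein_coeff ori x False = Poly_Mapping.single e' (neg_one_pow s')" by blast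
    then have "(\<Prod>x\<in>insert x M. skein_coeff ori x False) = Poly_Mapping.single (e' + e) (neg_one_pow (s' + s))"
      using insert IH by (simp add: mult_single neg_one_pow_add)
    then show ?case by blast
  qed
  then obtain e s where es: "(\<Prod>x\<in>N. skein_coeff ori x False) = Poly_Mapping.single e (neg_one_pow s)"
    using finite_N by blast
  show ?thesis
  proof (rule that)
    fix S assume S: "S \<subseteq> N"
    have "skein_weight ori S =
        (\<Prod>x\<in>N. skein_coeff ori x False * (if x \<in> S then - q_pow 1 else 1))"
      unfolding skein_weight_def using skein_coeff_True[OF assms] by (intro prod.cong) auto
    also have "\<dots> = Poly_Mapping.single e (neg_one_pow s) * (\<Prod>x\<in>N. if x \<in> S then - q_pow 1 else 1)"
      by (simp only: prod.distrib es)
    also have "(\<Prod>x\<in>N. if x \<in> S then - q_pow 1 else (1 :: laurent)) = (\<Prod>x\<in>S. - q_pow 1)"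
      using S finite_N by (subst prod.inter_restrict[symmetric]) (simp_all add: Int_absorb1)
    also have "\<dots> = (- q_pow 1) ^ card S" by (rule prod_constant)
    finally show "skein_weight ori S = Poly_Mapping.single e (neg_one_pow s) * (- q_pow 1) ^ card S" .
  qed
qed

end

theorem theorem2:
  fixes D :: "'c diagram" and k :: nat and ori g :: "'c tend \<Rightarrow> bool"
  assumes "connected_planar_diagram D"
    and "alternating_diagram D"
    and "num_bd D = 2 * k"
    and "k > 0"
    and "orientation D ori"
    and "gravity D g"
  shows "orient_element (in_points D g) (jones D ori) \<in> coherently_alternating k (in_points D g)"
proof -
  interpret planar_diagram D g k
    by unfold_locales (use assms in \<open>auto simp: connected_planar_diagram_def\<close>)
  let ?I = "in_points D g" and ?P = "orient_element (in_points D g) (jones D ori)"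
  obtain e s where w: "\<And>S. S \<subseteq> N \<Longrightarrow>
      skein_weight ori S = Poly_Mapping.single e (neg_one_pow s) * (- q_pow 1) ^ card S"
    by (rule skein_weight_eq[OF assms(5)]) blast
  have closures: "alternating_element m J Q" if "partial_closure k ?I ?P m J Q" for m J Q
  proof -
    from partial_closure_state_element[OF planar_closed_diagram] that
    obtain curl \<beta> where "planar_closed_diagram D g curl m \<beta>" "J = closed_diagram.in_ends g m \<beta>"
      "Q = planar_closed_diagram.state_element D g curl m \<beta> (skein_weight ori)"
      unfolding in_points_eq orient_jones[unfolded in_points_eq] by blast
    then show ?thesis using planar_closed_diagram.alternating_state_element w by blast
  qed
  have "alternating_element k ?I ?P" by (rule closures) (rule partial_closure.refl)
  moreover have "boundary_pattern k ?I"
    using closed_diagram.boundary_pattern[OF closed_diagram] in_points_eq by simp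
  ultimately show ?thesis
    using closures unfolding coherently_alternating_def alternating_element_def by blast
qed

end
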